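(* Let $\mathcal{X}\in\{\mathcal{X}_c,\mathcal{X}_d\}$, $\mathcal{U}\in\{\mathcal{U}_c,\mathcal{U}_c(x),\mathcal{U}_d,\mathcal{U}_d(x)\}$ and $\mathcal{Y}\in\{\mathcal{Y}_c,\mathcal{Y}_d\}$. (i) If $K$ is polynomial in the input, then $$\text{Bounded-}1\text{-Adaptability}(\mathcal{X},\mathcal{U},\mathcal{Y})\le\text{Bounded-}K\text{-Adaptability}(\mathcal{X},\mathcal{U},\mathcal{Y}).$$ (ii) If $K$ is polynomial in the input and $\mathcal{Y}=\mathcal{Y}_d$, then $$\text{Bounded-}K\text{-Adaptability}(\mathcal{X},\mathcal{U},\mathcal{Y})\le\text{Bounded-Two-Stage}(\mathcal{X},\mathcal{U},\mathcal{Y}).$$ (iii) If $\mathcal{U}=\mathcal{U}_d$, or $\mathcal{U}=\mathcal{U}_d(x)$, or $\mathcal{Y}=\mathcal{Y}_d$, then $$\text{Bounded-Two-Stage}(\mathcal{X},\mathcal{U},\mathcal{Y})\le\text{Bounded-Finite-Adaptability}(\mathcal{X},\mathcal{U},\mathcal{Y}).$$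
   Context: An instance consists of rational data encoded in binary: a bound $R\in\mathbb{Z}_+$, vectors $a\in\mathbb{Q}^{m_x}$, $b\in\mathbb{Q}^{m_u}$, matrices $A\in\mathbb{Q}^{m_x\times n_x}$, $W\in\mathbb{Q}^{m_y\times n_y}$, an $m_u\times n_u$ matrix $B(x)$ whose entries depend linearly on $x$ with rational coefficients, and an $m_y\times n_x$ matrix $T(u)$ whose entries depend linearly on $u$ with rational coefficients. (Affine dependence can be modelled by auxiliary coordinates of $x$ and $u$ fixed to $1$.) The sets are $\mathcal{X}_c=\{x\in[0,R]^{n_x}: Ax\le a\}$, $\mathcal{U}_c(x)=\{u\in[0,R]^{n_u}: B(x)u\le b\}$, $\mathcal{Y}_c(x,u)=\{y\in[0,R]^{n_y}: T(u)x+Wy\le 0\}$, and $\mathcal{X}_d=\mathcal{X}_c\cap\mathbb{Z}^{n_x}$, $\mathcal{U}_d(x)=\mathcal{U}_c(x)\cap\mathbb{Z}^{n_u}$, $\mathcal{Y}_d(x,u)=\mathcal{Y}_c(x,u)\cap\mathbb{Z}^{n_y}$. The notations $\mathcal{U}_c$, $\mathcal{U}_d$ (without $x$) are used for the restriction to instances in which $B$ is a constant matrix. For chosen types of sets: Bounded-Two-Stage$(\mathcal{X},\mathcal{U},\mathcal{Y})$: $\ \exists x\in\mathcal{X}\ \forall u\in\mathcal{U}(x)\ \exists y\in\mathcal{Y}(x,u)$? Bounded-$K$-Adaptability$(\mathcal{X},\mathcal{U},\mathcal{Y})$: $\ \exists x\in\mathcal{X},\ y^1,\dots,y^K\in\mathbb{R}^{n_y}\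 \forall u\in\mathcal{U}(x):\ \{y^1,\dots,y^K\}\cap\mathcal{Y}(x,u)\ne\emptyset$? Here $K$ is given by a function of the input, the function itself not being part of the input (constant $K$ is a special case). Bounded-Finite-Adaptability$(\mathcal{X},\mathcal{U},\mathcal{Y})$: the variant of Bounded-$K$-Adaptability in which the value $K$ is part of the input (encoded in binary). "$K$ is polynomial in the input" means that $K$ is bounded by a polynomial in the encoding length of the instance (this includes constant $K$). $P\le Q$ means that decision problem $P$ reduces to $Q$ by a polynomial-time many-one reduction.
   Formalization: In (ii) the function K is additionally assumed computable in polynomial time (for an uncomputable, polynomially bounded K the claim fails); throughout, K is at least 1, and B(x) may have a constant term. *)

theory Defs
  imports
    "HOL-Computational_Algebra.Polynomial"
    "Jordan_Normal_Form.Matrix"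
begin

section \<open>Polynomial time\<close>

text \<open>
  The machine model is a structured program over finitely many stacks of bits, every elementary
  step having unit cost. It simulates and is simulated by multi-tape Turing machines with constant
  overhead per step: a tape is a pair of stacks (the parts to the left and to the right of the
  head, tape symbols and the blank being written as bit blocks), and the finite control is a
  stack of bounded height; conversely, a stack is a tape whose head stays at the top.
\<close>

datatype com =
    Push nat bool
  | Pop nat
  | Seq com com
  | Case nat com com com
  | While nat com

type_synonym stacks = "nat \<Rightarrow> bool list"

text \<open>
  \<open>exec c s t s'\<close>: started in \<open>s\<close>, the program \<open>c\<close> halts in \<open>s'\<close> after exactly \<open>t\<close> steps.
  \<open>Case r c0 c1 c2\<close> branches on stack \<open>r\<close>: empty, top \<open>False\<close>, top \<open>True\<close>.
  \<open>While r c\<close> repeats \<open>c\<close> as long as stack \<open>r\<close> is nonempty.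
\<close>

inductive exec :: "com \<Rightarrow> stacks \<Rightarrow> nat \<Rightarrow> stacks \<Rightarrow> bool" where
  Push: "exec (Push r b) s 1 (s(r := b # s r))"
| Pop: "exec (Pop r) s 1 (s(r := tl (s r)))"
| Seq: "exec c1 s t1 s1 \<Longrightarrow> exec c2 s1 t2 s2 \<Longrightarrow> exec (Seq c1 c2) s (t1 + t2) s2"
| Case_empty: "s r = [] \<Longrightarrow> exec c0 s t s' \<Longrightarrow> exec (Case r c0 c1 c2) s (Suc t) s'"
| Case_False: "s r = False # w \<Longrightarrow> exec c1 s t s' \<Longrightarrow> exec (Case r c0 c1 c2) s (Suc t) s'"
| Case_True: "s r = True # w \<Longrightarrow> exec c2 s t s' \<Longrightarrow> exec (Case r c0 c1 c2) s (Suc t) s'"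
| While_end: "s r = [] \<Longrightarrow> exec (While r c) s 1 s"
| While_step: "s r \<noteq> [] \<Longrightarrow> exec c s t1 s1 \<Longrightarrow> exec (While r c) s1 t2 s2
    \<Longrightarrow> exec (While r c) s (Suc (t1 + t2)) s2"

inductive_cases exec_PushE: "exec (Push r b) s t s'"
inductive_cases exec_PopE: "exec (Pop r) s t s'"
inductive_cases exec_SeqE: "exec (Seq c1 c2) s t s'"
inductive_cases exec_CaseE: "exec (Case r c0 c1 c2) s t s'"
inductive_cases exec_WhileE: "exec (While r c) s t s'"

lemma exec_deterministic:
  "exec c s t s' \<Longrightarrow> exec c s u s'' \<Longrightarrow> u = t \<and> s'' = s'"
proof (induction arbitrary: u s'' rule: exec.induct)
  case (Seq c1 s t1 s1 c2 t2 s2)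
  show ?case using Seq.prems by (rule exec_SeqE) (use Seq.IH in blast)
next
  case (Case_empty s r c0 t s' c1 c2)
  show ?case
    using Case_empty.prems by (rule exec_CaseE) (use Case_empty.IH Case_empty.hyps in \<open>metis list.distinct(1) list.inject\<close>)+
next
  case (Case_False s r w c1 t s' c0 c2)
  show ?case
    using Case_False.prems by (rule exec_CaseE) (use Case_False.IH Case_False.hyps in \<open>metis list.distinct(1) list.inject\<close>)+
next
  case (Case_True s r w c2 t s' c0 c1)
  show ?case
    using Case_True.prems by (rule exec_CaseE) (use Case_True.IH Case_True.hyps in \<open>metis list.distinct(1) list.inject\<close>)+
next
  case (While_end s r c)
  show ?case using While_end.prems by (rule exec_WhileE) (use While_end.hyps in auto)
next
  case (While_step s r c t1 s1 t2 s2)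
  show ?case using While_step.prems
    by (rule exec_WhileE) (use While_step.IH While_step.hyps in metis)+
next
  case (Push r b s)
  then show ?case by (rule exec_PushE) simp
next
  case (Pop r s)
  then show ?case by (rule exec_PopE) simp
qed

text \<open>Input and output are on stack 0; all other stacks are initially empty.\<close>

definition polytime_on :: "bool list set \<Rightarrow> (bool list \<Rightarrow> bool list) \<Rightarrow> bool" where
  "polytime_on D f \<longleftrightarrow> (\<exists>c. \<exists>p :: nat poly. \<forall>w\<in>D. \<exists>t s.
     exec c ((\<lambda>_. [])(0 := w)) t s \<and> s 0 = f w \<and> t \<le> poly p (length w))"

text \<open>A decision problem consists of its (encoded) instances and its yes-instances.\<close>

type_synonym problem = "bool list set \<times> bool list set"

definition problem :: "('a \<Rightarrow> bool list) \<Rightarrow> 'a set \<Rightarrow> ('a \<Rightarrow> bool) \<Rightarrow> problem" where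
  "problem enc D P = (enc ` D, enc ` {I \<in> D. P I})"

definition reduces_to :: "problem \<Rightarrow> problem \<Rightarrow> bool"  (infix \<open>\<le>\<^sub>p\<close> 50) where
  "P \<le>\<^sub>p Q \<longleftrightarrow> (\<exists>f. polytime_on (fst P) f \<and>
     (\<forall>w \<in> fst P. f w \<in> fst Q \<and> (w \<in> snd P \<longleftrightarrow> f w \<in> snd Q)))"


section \<open>Instances\<close>

text \<open>
  The matrix \<open>B(x)\<close> is \<open>B_const + (\<Sum>j. x\<^sub>j B_coef\<^sub>j)\<close>; the constant term is there so that the
  instances with constant \<open>B\<close> are a special case. The matrix \<open>T(u)\<close> is \<open>\<Sum>k. u\<^sub>k T_coef\<^sub>k\<close>.
\<close>

record inst =
  n_x :: nat
  n_u :: nat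
  n_y :: nat
  m_x :: nat
  m_u :: nat
  m_y :: nat
  bound_R :: nat
  vec_a :: "rat vec"
  vec_b :: "rat vec"
  mat_A :: "rat mat"
  mat_W :: "rat mat"
  B_const :: "rat mat"
  B_coef :: "rat mat list"
  T_coef :: "rat mat list"

definition wf_inst :: "inst \<Rightarrow> bool" where
  "wf_inst I \<longleftrightarrow>
     vec_a I \<in> carrier_vec (m_x I) \<and>
     vec_b I \<in> carrier_vec (m_u I) \<and>
     mat_A I \<in> carrier_mat (m_x I) (n_x I) \<and>
     mat_W I \<in> carrier_mat (m_y I) (n_y I) \<and>
     B_const I \<in> carrier_mat (m_u I) (n_u I) \<and>
     length (B_coef I) = n_x I \<and> set (B_coef I) \<subseteq> carrier_mat (m_u I) (n_u I) \<and>
     length (T_coef I) = n_u I \<and> set (T_coef I) \<subseteq> carrier_mat (m_y I) (n_x I)"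

definition B_of :: "inst \<Rightarrow> real vec \<Rightarrow> real mat" where
  "B_of I x = mat (m_u I) (n_u I) (\<lambda>(i, k).
     of_rat (B_const I $$ (i, k)) + (\<Sum>j<n_x I. of_rat ((B_coef I ! j) $$ (i, k)) * x $ j))"

definition T_of :: "inst \<Rightarrow> real vec \<Rightarrow> real mat" where
  "T_of I u = mat (m_y I) (n_x I) (\<lambda>(i, j).
     (\<Sum>k<n_u I. of_rat ((T_coef I ! k) $$ (i, j)) * u $ k))"

definition box :: "inst \<Rightarrow> nat \<Rightarrow> real vec set" where
  "box I n = {v \<in> carrier_vec n. \<forall>i<n. 0 \<le> v $ i \<and> v $ i \<le> real (bound_R I)}"

definition int_vecs :: "nat \<Rightarrow> real vec set" where
  "int_vecs n = {v \<in> carrier_vec n. \<forall>i<n. v $ i \<in> \<int>}"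

datatype xtype = Xc | Xd
datatype utype = Uc | Ucx | Ud | Udx
datatype ytype = Yc | Yd

definition X_cont :: "inst \<Rightarrow> real vec set" where
  "X_cont I = {x \<in> box I (n_x I). map_mat of_rat (mat_A I) *\<^sub>v x \<le> map_vec of_rat (vec_a I)}"

definition U_cont :: "inst \<Rightarrow> real vec \<Rightarrow> real vec set" where
  "U_cont I x = {u \<in> box I (n_u I). B_of I x *\<^sub>v u \<le> map_vec of_rat (vec_b I)}"

definition Y_cont :: "inst \<Rightarrow> real vec \<Rightarrow> real vec \<Rightarrow> real vec set" where
  "Y_cont I x u =
     {y \<in> box I (n_y I). T_of I u *\<^sub>v x + map_mat of_rat (mat_W I) *\<^sub>v y \<le> 0\<^sub>v (m_y I)}"

fun X_set :: "xtype \<Rightarrow> inst \<Rightarrow> real vec set" where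
  "X_set Xc I = X_cont I"
| "X_set Xd I = X_cont I \<inter> int_vecs (n_x I)"

fun U_set :: "utype \<Rightarrow> inst \<Rightarrow> real vec \<Rightarrow> real vec set" where
  "U_set Uc I x = U_cont I x"
| "U_set Ucx I x = U_cont I x"
| "U_set Ud I x = U_cont I x \<inter> int_vecs (n_u I)"
| "U_set Udx I x = U_cont I x \<inter> int_vecs (n_u I)"

fun Y_set :: "ytype \<Rightarrow> inst \<Rightarrow> real vec \<Rightarrow> real vec \<Rightarrow> real vec set" where
  "Y_set Yc I x u = Y_cont I x u"
| "Y_set Yd I x u = Y_cont I x u \<inter> int_vecs (n_y I)"

definition constant_B :: "inst \<Rightarrow> bool" where
  "constant_B I \<longleftrightarrow> (\<forall>x \<in> carrier_vec (n_x I). \<forall>x' \<in> carrier_vec (n_x I). B_of I x = B_of I x')"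

definition instances :: "utype \<Rightarrow> inst set" where
  "instances U = {I. wf_inst I \<and> (U \<in> {Uc, Ud} \<longrightarrow> constant_B I)}"


section \<open>Binary encoding\<close>

fun bits :: "nat \<Rightarrow> bool list" where
  "bits n = (if n = 0 then [] else odd n # bits (n div 2))"

declare bits.simps [simp del]

text \<open>Self-delimiting: each binary digit is preceded by \<open>True\<close>, and \<open>False\<close> marks the end.\<close>

definition enc_nat :: "nat \<Rightarrow> bool list" where
  "enc_nat n = concat (map (\<lambda>b. [True, b]) (bits n)) @ [False]"

definition enc_int :: "int \<Rightarrow> bool list" where
  "enc_int k = (k < 0) # enc_nat (nat \<bar>k\<bar>)"

definition enc_rat :: "rat \<Rightarrow> bool list" where
  "enc_rat q = (case quotient_of q of (k, d) \<Rightarrow> enc_int k @ enc_int d)"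

definition enc_vec :: "rat vec \<Rightarrow> bool list" where
  "enc_vec v = concat (map enc_rat (list_of_vec v))"

definition enc_mat :: "rat mat \<Rightarrow> bool list" where
  "enc_mat M = concat (map enc_rat (concat (mat_to_list M)))"

text \<open>
  Dimensions are written in unary, so that the encoding length bounds them even if matrices have
  no rows; all other data are binary.
\<close>

definition enc_dim :: "nat \<Rightarrow> bool list" where
  "enc_dim n = replicate n True @ [False]"

definition enc_inst :: "inst \<Rightarrow> bool list" where
  "enc_inst I =
     enc_dim (n_x I) @ enc_dim (n_u I) @ enc_dim (n_y I) @
     enc_dim (m_x I) @ enc_dim (m_u I) @ enc_dim (m_y I) @
     enc_nat (bound_R I) @
     enc_vec (vec_a I) @ enc_vec (vec_b I) @ enc_mat (mat_A I) @ enc_mat (mat_W I) @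
     enc_mat (B_const I) @ concat (map enc_mat (B_coef I)) @ concat (map enc_mat (T_coef I))"

definition enc_inst_K :: "inst \<times> nat \<Rightarrow> bool list" where
  "enc_inst_K = (\<lambda>(I, K). enc_nat K @ enc_inst I)"


section \<open>The decision problems\<close>

definition two_stage_yes :: "xtype \<Rightarrow> utype \<Rightarrow> ytype \<Rightarrow> inst \<Rightarrow> bool" where
  "two_stage_yes X U Y I \<longleftrightarrow>
     (\<exists>x \<in> X_set X I. \<forall>u \<in> U_set U I x. \<exists>y. y \<in> Y_set Y I x u)"

definition adaptability_yes :: "nat \<Rightarrow> xtype \<Rightarrow> utype \<Rightarrow> ytype \<Rightarrow> inst \<Rightarrow> bool" where
  "adaptability_yes K X U Y I \<longleftrightarrow>
     (\<exists>x \<in> X_set X I. \<exists>ys :: nat \<Rightarrow> real vec. (\<forall>k \<in> {1..K}. ys k \<in> carrier_vec (n_y I)) \<and>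
        (\<forall>u \<in> U_set U I x. ys ` {1..K} \<inter> Y_set Y I x u \<noteq> {}))"

definition Bounded_Two_Stage :: "xtype \<Rightarrow> utype \<Rightarrow> ytype \<Rightarrow> problem" where
  "Bounded_Two_Stage X U Y = problem enc_inst (instances U) (two_stage_yes X U Y)"

definition Bounded_K_Adaptability ::
    "(inst \<Rightarrow> nat) \<Rightarrow> xtype \<Rightarrow> utype \<Rightarrow> ytype \<Rightarrow> problem" where
  "Bounded_K_Adaptability K X U Y =
     problem enc_inst (instances U) (\<lambda>I. adaptability_yes (K I) X U Y I)"

definition Bounded_Finite_Adaptability :: "xtype \<Rightarrow> utype \<Rightarrow> ytype \<Rightarrow> problem" where
  "Bounded_Finite_Adaptability X U Y =
     problem enc_inst_K (instances U \<times> {1..}) (\<lambda>(I, K). adaptability_yes K X U Y I)"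

definition polynomial_in_input :: "utype \<Rightarrow> (inst \<Rightarrow> nat) \<Rightarrow> bool" where
  "polynomial_in_input U K \<longleftrightarrow>
     (\<forall>I \<in> instances U. 1 \<le> K I) \<and>
     (\<exists>p :: nat poly. \<forall>I \<in> instances U. K I \<le> poly p (length (enc_inst I)))"

definition polytime_computable :: "utype \<Rightarrow> (inst \<Rightarrow> nat) \<Rightarrow> bool" where
  "polytime_computable U K \<longleftrightarrow>
     (\<exists>f. polytime_on (enc_inst ` instances U) f \<and>
        (\<forall>I \<in> instances U. f (enc_inst I) = enc_nat (K I)))"


subsection \<open>The encodings are unambiguous\<close>

lemma bits_inject: "bits m = bits n \<Longrightarrow> m = n"
proof (induction m arbitrary: n rule: bits.induct)
  case (1 m)
  show ?case
  proof (cases "m = 0 \<or> n = 0")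
    case True
    then show ?thesis using "1.prems" bits.simps[of m] bits.simps[of n] by (metis list.distinct(1))
  next
    case False
    then have *: "odd m = odd n" "bits (m div 2) = bits (n div 2)"
      using "1.prems" by (simp_all add: bits.simps[of m] bits.simps[of n])
    have "m div 2 = n div 2" by (rule "1.IH"[OF _ *(2)]) (use False in simp)
    moreover have "m mod 2 = n mod 2" using *(1) by presburger
    ultimately show ?thesis by (metis div_mult_mod_eq)
  qed
qed

lemma enc_nat_prefix:
  assumes "enc_nat m @ v = enc_nat n @ w"
  shows "m = n \<and> v = w"
proof -
  have *: "concat (map (\<lambda>b. [True, b]) bs) @ False # v = concat (map (\<lambda>b. [True, b]) cs) @ False # w
    \<longrightarrow> bs = cs \<and> v = w" for bs cs
  proof (induction bs arbitrary: cs)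
    case Nil then show ?case by (cases cs) simp_all
  next
    case (Cons b bs) then show ?case by (cases cs) simp_all
  qed
  have "bits m = bits n \<and> v = w"
    using assms *[of "bits m" "bits n"] by (simp add: enc_nat_def)
  then show ?thesis using bits_inject by blast
qed

lemma enc_int_prefix:
  assumes "enc_int k @ v = enc_int l @ w"
  shows "k = l \<and> v = w"
proof -
  have "(k < 0) = (l < 0)" "enc_nat (nat \<bar>k\<bar>) @ v = enc_nat (nat \<bar>l\<bar>) @ w"
    using assms by (simp_all add: enc_int_def)
  with enc_nat_prefix[OF this(2)] show ?thesis by linarith
qed

lemma enc_rat_prefix:
  assumes "enc_rat q @ v = enc_rat r @ w"
  shows "q = r \<and> v = w"
proof -
  obtain k d l e where q: "quotient_of q = (k, d)" and r: "quotient_of r = (l, e)"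
    by (metis surj_pair)
  have "enc_int k @ enc_int d @ v = enc_int l @ enc_int e @ w"
    using assms by (simp add: enc_rat_def q r)
  note 1 = enc_int_prefix[OF this]
  note 2 = enc_int_prefix[OF 1[THEN conjunct2]]
  show ?thesis using 1 2 q r by (metis quotient_of_inject)
qed

lemma enc_dim_prefix: "enc_dim m @ v = enc_dim n @ w \<Longrightarrow> m = n \<and> v = w"
proof (induction m arbitrary: n)
  case 0 then show ?case by (cases n) (auto simp: enc_dim_def)
next
  case (Suc m) then show ?case by (cases n) (auto simp: enc_dim_def)
qed

lemma concat_map_prefix:
  assumes "\<And>a b v w. a \<in> S \<Longrightarrow> b \<in> S \<Longrightarrow> e a @ v = e b @ w \<Longrightarrow> a = b \<and> v = w"
  shows "length as = length bs \<Longrightarrow> set as \<subseteq> S \<Longrightarrow> set bs \<subseteq> S \<Longrightarrow>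
    concat (map e as) @ v = concat (map e bs) @ w \<Longrightarrow> as = bs \<and> v = w"
proof (induction as bs rule: list_induct2)
  case (Cons a as b bs)
  then show ?case using assms[of a b "concat (map e as) @ v" "concat (map e bs) @ w"] by auto
qed simp

lemma enc_vec_prefix:
  assumes "x \<in> carrier_vec n" "y \<in> carrier_vec n" "enc_vec x @ v = enc_vec y @ w"
  shows "x = y \<and> v = w"
proof -
  have "list_of_vec x = list_of_vec y \<and> v = w"
    using assms by (intro concat_map_prefix[of UNIV enc_rat])
      (auto simp: enc_vec_def dest: enc_rat_prefix)
  then show ?thesis by (metis vec_list)
qed

lemma enc_mat_prefix:
  assumes M: "M \<in> carrier_mat m n" and N: "N \<in> carrier_mat m n"
    and eq: "enc_mat M @ v = enc_mat N @ w"
  shows "M = N \<and> v = w"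
proof -
  have len: "length (concat (mat_to_list Q)) = m * n" if "Q \<in> carrier_mat m n" for Q :: "rat mat"
    using that by (simp add: mat_to_list_def length_concat o_def interv_sum_list_conv_sum_set_nat)
  have c: "concat (mat_to_list M) = concat (mat_to_list N) \<and> v = w"
    using eq len[OF M] len[OF N] by (intro concat_map_prefix[of UNIV enc_rat])
      (auto simp: enc_mat_def dest: enc_rat_prefix)
  have "mat_to_list M = mat_to_list N"
  proof (rule concat_injective)
    show "concat (mat_to_list M) = concat (mat_to_list N)" using c by simp
    show "length (mat_to_list M) = length (mat_to_list N)"
      using M N by (simp add: mat_to_list_def)
    show "\<forall>(x, y) \<in> set (zip (mat_to_list M) (mat_to_list N)). length x = length y"
      using M N by (auto simp: mat_to_list_def set_zip)
  qed
  then have "M $$ (i, j) = N $$ (i, j)" if "i < m" "j < n" for i j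
  proof -
    have "mat_to_list Q ! i ! j = Q $$ (i, j)" if "Q \<in> carrier_mat m n" for Q :: "rat mat"
      using that \<open>i < m\<close> \<open>j < n\<close> by (simp add: mat_to_list_def)
    then show ?thesis using M N \<open>mat_to_list M = mat_to_list N\<close> by metis
  qed
  then have "M = N" using M N by (intro eq_matI) auto
  then show ?thesis using c by simp
qed

lemma enc_mats_prefix:
  assumes "length Ms = length Ns" "set Ms \<subseteq> carrier_mat m n" "set Ns \<subseteq> carrier_mat m n"
    and "concat (map enc_mat Ms) @ v = concat (map enc_mat Ns) @ w"
  shows "Ms = Ns \<and> v = w"
proof (rule concat_map_prefix[of "carrier_mat m n" enc_mat, OF _ assms])
  show "a = b \<and> v = w"
    if "a \<in> carrier_mat m n" "b \<in> carrier_mat m n" "enc_mat a @ v = enc_mat b @ w" for a b v w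
    by (rule enc_mat_prefix[OF that])
qed

lemma inj_on_enc_inst: "inj_on enc_inst {I. wf_inst I}"
proof (rule inj_onI, clarsimp)
  fix I J assume wf: "wf_inst I" "wf_inst J" and eq: "enc_inst I = enc_inst J"
  note d1 = enc_dim_prefix[OF eq[unfolded enc_inst_def]]
  note d2 = enc_dim_prefix[OF d1[THEN conjunct2]]
  note d3 = enc_dim_prefix[OF d2[THEN conjunct2]]
  note d4 = enc_dim_prefix[OF d3[THEN conjunct2]]
  note d5 = enc_dim_prefix[OF d4[THEN conjunct2]]
  note d6 = enc_dim_prefix[OF d5[THEN conjunct2]]
  note d7 = enc_nat_prefix[OF d6[THEN conjunct2]]
  note d = d1[THEN conjunct1] d2[THEN conjunct1] d3[THEN conjunct1] d4[THEN conjunct1]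
    d5[THEN conjunct1] d6[THEN conjunct1] d7[THEN conjunct1]
  note w = wf[unfolded wf_inst_def, unfolded d]
  have e2: "vec_a I = vec_a J \<and> enc_vec (vec_b I) @ enc_mat (mat_A I) @ enc_mat (mat_W I) @
     enc_mat (B_const I) @ concat (map enc_mat (B_coef I)) @ concat (map enc_mat (T_coef I)) =
     enc_vec (vec_b J) @ enc_mat (mat_A J) @ enc_mat (mat_W J) @
     enc_mat (B_const J) @ concat (map enc_mat (B_coef J)) @ concat (map enc_mat (T_coef J))"
    by (rule enc_vec_prefix[of _ "m_x J", OF _ _ d7[THEN conjunct2]]) (use w in blast)+
  have e3: "vec_b I = vec_b J \<and> enc_mat (mat_A I) @ enc_mat (mat_W I) @
     enc_mat (B_const I) @ concat (map enc_mat (B_coef I)) @ concat (map enc_mat (T_coef I)) =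
     enc_mat (mat_A J) @ enc_mat (mat_W J) @
     enc_mat (B_const J) @ concat (map enc_mat (B_coef J)) @ concat (map enc_mat (T_coef J))"
    by (rule enc_vec_prefix[of _ "m_u J", OF _ _ e2[THEN conjunct2]]) (use w in blast)+
  have e4: "mat_A I = mat_A J \<and> enc_mat (mat_W I) @
     enc_mat (B_const I) @ concat (map enc_mat (B_coef I)) @ concat (map enc_mat (T_coef I)) =
     enc_mat (mat_W J) @
     enc_mat (B_const J) @ concat (map enc_mat (B_coef J)) @ concat (map enc_mat (T_coef J))"
    by (rule enc_mat_prefix[of _ "m_x J" "n_x J", OF _ _ e3[THEN conjunct2]]) (use w in blast)+
  have e5: "mat_W I = mat_W J \<and>
     enc_mat (B_const I) @ concat (map enc_mat (B_coef I)) @ concat (map enc_mat (T_coef I)) =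
     enc_mat (B_const J) @ concat (map enc_mat (B_coef J)) @ concat (map enc_mat (T_coef J))"
    by (rule enc_mat_prefix[of _ "m_y J" "n_y J", OF _ _ e4[THEN conjunct2]]) (use w in blast)+
  have e6: "B_const I = B_const J \<and>
     concat (map enc_mat (B_coef I)) @ concat (map enc_mat (T_coef I)) =
     concat (map enc_mat (B_coef J)) @ concat (map enc_mat (T_coef J))"
    by (rule enc_mat_prefix[of _ "m_u J" "n_u J", OF _ _ e5[THEN conjunct2]]) (use w in blast)+
  have "length (B_coef I) = length (B_coef J)" "length (T_coef I) = length (T_coef J)"
    using w by (elim conjE, simp)+
  note len = this
  have e7: "B_coef I = B_coef J \<and> concat (map enc_mat (T_coef I)) = concat (map enc_mat (T_coef J))"
    by (rule enc_mats_prefix[of _ _ "m_u J" "n_u J", OF len(1) _ _ e6[THEN conjunct2]]) (use w in blast)+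
  then have "concat (map enc_mat (T_coef I)) @ [] = concat (map enc_mat (T_coef J)) @ []"
    by simp
  then have e8: "T_coef I = T_coef J \<and> [] = ([] :: bool list)"
    by (rule enc_mats_prefix[of _ _ "m_y J" "n_x J", OF len(2), rotated 2]) (use w in blast)+
  show "I = J"
    by (rule inst.equality) (use d e2 e3 e4 e5 e6 e7 e8 in simp_all)
qed

lemma inj_on_enc_inst_K: "inj_on enc_inst_K ({I. wf_inst I} \<times> UNIV)"
proof (rule inj_onI)
  fix p q assume p: "p \<in> {I. wf_inst I} \<times> UNIV" and q: "q \<in> {I. wf_inst I} \<times> (UNIV :: nat set)"
    and eq: "enc_inst_K p = enc_inst_K q"
  have "enc_nat (snd p) @ enc_inst (fst p) = enc_nat (snd q) @ enc_inst (fst q)"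
    using eq by (simp add: enc_inst_K_def split_beta)
  from enc_nat_prefix[OF this] have "snd p = snd q" "enc_inst (fst p) = enc_inst (fst q)" by simp_all
  moreover have "fst p = fst q"
    using inj_onD[OF inj_on_enc_inst calculation(2)] p q by (simp add: mem_Times_iff)
  ultimately show "p = q" by (simp add: prod_eq_iff)
qed

end

theory Submission
  imports Defs
begin

text \<open>
  (i) The uncertain \<open>u\<close> enters the second stage only through the right-hand sides of the rows. If every
  row gets its own copy of \<open>u\<close>, then finitely many failing policies can be made to fail all at
  once: for each row take the worst of the failures. Hence in the new instance any number of policies
  is as good as one, whatever the value of \<open>K\<close> on that instance.

  (ii) Move the policies into the first stage and let the second stage select one of them with
  integral indicators. Policies that are not integral are never selected, so \<open>X\<close> may be continuous.

  (iii) There are at most \<open>(R + 1)^n\<close> integral vectors \<open>u\<close> or \<open>y\<close>, and a number of policies at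
  least as large can be written down with polynomially many bits.

  For the running times, programs of nested loops with unary counters, which write constants and
  numbers of the input instance, are compiled to the stack machine; these loops always run in
  polynomial time, and the encodings of the new instances are such loops over matrix entries.
\<close>

section \<open>Time bounds\<close>

text \<open>In (i) the function \<open>K\<close> is evaluated at the new instance, so padding
  against a known number of policies is impossible: one construction has to defeat every number at
  once. The failures to be combined are finitely many, so a finite maximum per row suffices. In (ii)
  the obstacle is that \<open>T(u) x\<close> is bilinear: it has neither a constant term nor terms
  linear in \<open>x\<close> alone. Both are simulated by a coordinate of \<open>u\<close> fixed to
  1 and a coordinate of \<open>x\<close> fixed to \<open>R\<close>. For \<open>R = 0\<close> the
  former does not fit into the box, and this degenerate case needs its own argument. In (iii) the
  number of policies must be printable without arithmetic on binary numbers, which is why it is a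
  power of two. The loop language represents a number by the height of a stack. Dimensions and
  polynomially bounded \<open>K\<close> can be counted in this way, but the binary bound
  \<open>R\<close> cannot: it is only copied, and only the length of its code enters
  calculations.\<close>

definition poly_bounded :: "(nat \<Rightarrow> nat) \<Rightarrow> bool" where
  "poly_bounded f \<longleftrightarrow> (\<exists>p :: nat poly. \<forall>n. f n \<le> poly p n)"

lemma poly_nat_mono: "m \<le> n \<Longrightarrow> poly p m \<le> poly (p :: nat poly) n"
  by (induction p) (auto intro!: add_mono mult_mono)

lemma poly_bounded_poly: "poly_bounded (poly p)"
  unfolding poly_bounded_def by blast

lemma poly_bounded_const: "poly_bounded (\<lambda>n. c)"
  unfolding poly_bounded_def by (rule exI[of _ "[:c:]"]) simp

lemma poly_bounded_id: "poly_bounded (\<lambda>n. n)"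
  unfolding poly_bounded_def by (rule exI[of _ "[:0, 1:]"]) simp

lemma poly_bounded_add:
  assumes "poly_bounded f" "poly_bounded g"
  shows "poly_bounded (\<lambda>n. f n + g n)"
proof -
  obtain p q where "\<And>n. f n \<le> poly p n" "\<And>n. g n \<le> poly q n"
    using assms unfolding poly_bounded_def by blast
  then show ?thesis
    unfolding poly_bounded_def by (intro exI[of _ "p + q"]) (simp add: add_mono)
qed

lemma poly_bounded_mult:
  assumes "poly_bounded f" "poly_bounded g"
  shows "poly_bounded (\<lambda>n. f n * g n)"
proof -
  obtain p q where "\<And>n. f n \<le> poly p n" "\<And>n. g n \<le> poly q n"
    using assms unfolding poly_bounded_def by blast
  then show ?thesis
    unfolding poly_bounded_def by (intro exI[of _ "p * q"]) (simp add: mult_mono)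
qed

text \<open>Monotonicity is taken from the polynomial that bounds \<open>f\<close>; the function
  \<open>f\<close> itself may be arbitrary.\<close>

lemma poly_bounded_comp:
  assumes "poly_bounded f" "poly_bounded g"
  shows "poly_bounded (\<lambda>n. f (g n))"
proof -
  obtain p q where pq: "\<And>n. f n \<le> poly p n" "\<And>n. g n \<le> poly q n"
    using assms unfolding poly_bounded_def by blast
  have "f (g n) \<le> poly (pcompose p q) n" for n
    using order_trans[OF pq(1) poly_nat_mono[OF pq(2)]] by (simp add: poly_pcompose)
  then show ?thesis
    unfolding poly_bounded_def by blast
qed

lemmas poly_bounded_intros =
  poly_bounded_poly poly_bounded_const poly_bounded_id poly_bounded_add poly_bounded_mult

text \<open>Relaxing the exact step count of \<open>exec\<close> to an upper bound allows the
  budgets of program parts to be rounded up and added.\<close>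

definition runs :: "com \<Rightarrow> stacks \<Rightarrow> nat \<Rightarrow> stacks \<Rightarrow> bool" where
  "runs c s T s' \<longleftrightarrow> (\<exists>t\<le>T. exec c s t s')"

lemma runs_weaken: "runs c s T s' \<Longrightarrow> T \<le> T' \<Longrightarrow> s' = s'' \<Longrightarrow> runs c s T' s''"
  unfolding runs_def by (meson order_trans)

lemma runs_Push: "runs (Push r b) s 1 (s(r := b # s r))"
  unfolding runs_def using exec.Push by blast

lemma runs_Pop: "runs (Pop r) s 1 (s(r := tl (s r)))"
  unfolding runs_def using exec.Pop by blast

lemma runs_Seq: "runs c1 s T1 s1 \<Longrightarrow> runs c2 s1 T2 s2 \<Longrightarrow> runs (Seq c1 c2) s (T1 + T2) s2"
  unfolding runs_def by (meson exec.Seq add_mono)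

lemma runs_Case_Nil: "s r = [] \<Longrightarrow> runs c0 s T s' \<Longrightarrow> runs (Case r c0 c1 c2) s (Suc T) s'"
  unfolding runs_def by (meson exec.Case_empty Suc_le_mono)

lemma runs_Case_Cons:
  "s r = b # w \<Longrightarrow> runs (if b then c2 else c1) s T s' \<Longrightarrow> runs (Case r c0 c1 c2) s (Suc T) s'"
  unfolding runs_def by (cases b) (use exec.Case_True exec.Case_False Suc_le_mono in \<open>metis (full_types)\<close>)+

lemma runs_While_Nil: "s r = [] \<Longrightarrow> runs (While r c) s 1 s"
  unfolding runs_def using exec.While_end by blast

lemma runs_While_step:
  assumes "s r \<noteq> []" "runs c s T1 s1" "runs (While r c) s1 T2 s2"
  shows "runs (While r c) s (Suc (T1 + T2)) s2"
proof -
  obtain t1 t2 where "t1 \<le> T1" "exec c s t1 s1" "t2 \<le> T2" "exec (While r c) s1 t2 s2"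
    using assms(2,3) unfolding runs_def by blast
  then show ?thesis
    unfolding runs_def using exec.While_step[of s r, OF assms(1)]
    by (intro exI[of _ "Suc (t1 + t2)"]) simp
qed

text \<open>Loop rule for the case that the states at the loop head can be written down as a
  sequence \<open>st\<close>. Each round pays one test on top of the body, and the last summand 1 is
  the failing test.\<close>

lemma runs_While:
  assumes "\<And>i. i < n \<Longrightarrow> st i r \<noteq> []" "\<And>i. i < n \<Longrightarrow> runs c (st i) T (st (Suc i))"
    and "st n r = []"
  shows "runs (While r c) (st 0) (n * (T + 1) + 1) (st n)"
  using assms
proof (induction n arbitrary: st)
  case 0
  then show ?case by (simp add: runs_While_Nil[simplified])
next
  case (Suc n)
  have "runs (While r c) (st (Suc 0)) (n * (T + 1) + 1) (st (Suc n))"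
    by (rule Suc.IH[of "\<lambda>i. st (Suc i)"]) (use Suc.prems in auto)
  with Suc.prems(1,2)[of 0] show ?case
    using runs_While_step[of "st 0" r c T "st (Suc 0)" "n * (T + 1) + 1" "st (Suc n)"] by (simp add: add_ac)
qed

text \<open>A step pushes at most one bit. This bounds the garbage left by an unknown program and
  the length of an output by running times.\<close>

lemma runs_length: "runs c s T s' \<Longrightarrow> length (s' r) \<le> length (s r) + T"
proof -
  have "exec c s t s' \<Longrightarrow> length (s' r) \<le> length (s r) + t" for t
    by (induction rule: exec.induct) auto
  then show "runs c s T s' \<Longrightarrow> length (s' r) \<le> length (s r) + T"
    unfolding runs_def by (meson add_left_mono order_trans)
qed

section \<open>Independence of a program from the registers it does not mention\<close>

primrec regs_below :: "com \<Rightarrow> nat \<Rightarrow> bool" where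
  "regs_below (Push r b) m \<longleftrightarrow> r < m"
| "regs_below (Pop r) m \<longleftrightarrow> r < m"
| "regs_below (Seq c1 c2) m \<longleftrightarrow> regs_below c1 m \<and> regs_below c2 m"
| "regs_below (Case r c0 c1 c2) m \<longleftrightarrow> r < m \<and> regs_below c0 m \<and> regs_below c1 m \<and> regs_below c2 m"
| "regs_below (While r c) m \<longleftrightarrow> r < m \<and> regs_below c m"

lemma regs_below_mono: "regs_below c m \<Longrightarrow> m \<le> n \<Longrightarrow> regs_below c n"
  by (induction c) auto

lemma ex_regs_below: "\<exists>m. regs_below c m"
proof (induction c)
  case (Seq c1 c2)
  then show ?case by (metis regs_below.simps(3) regs_below_mono linear)
next
  case (Case r c0 c1 c2)
  then obtain m0 m1 m2 where "regs_below c0 m0" "regs_below c1 m1" "regs_below c2 m2" by blast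
  then show ?case
    by (intro exI[of _ "Suc r + m0 + m1 + m2"]) (auto elim!: regs_below_mono)
next
  case (While r c)
  then obtain m where "regs_below c m" by blast
  then show ?case by (intro exI[of _ "Suc r + m"]) (auto elim!: regs_below_mono)
qed auto

text \<open>A foreign program can be run below a register that shelters a copy of the input: the
  contents \<open>h\<close> from \<open>m\<close> on influence neither its behaviour nor its running
  time.\<close>

lemma exec_frame:
  assumes "exec c s t s'" "regs_below c m"
  shows "(\<forall>r\<ge>m. s' r = s r) \<and>
    exec c (\<lambda>r. if r < m then s r else h r) t (\<lambda>r. if r < m then s' r else h r)"
  using assms
proof (induction rule: exec.induct)
  case (Push r b s)
  have "(\<lambda>r. if r < m then s r else h r)(r := b # (\<lambda>r. if r < m then s r else h r) r)
    = (\<lambda>q. if q < m then (s(r := b # s r)) q else h q)"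
    using Push by auto
  then show ?case using Push exec.Push[of r b "\<lambda>r. if r < m then s r else h r"] by auto
next
  case (Pop r s)
  have "(\<lambda>r. if r < m then s r else h r)(r := tl ((\<lambda>r. if r < m then s r else h r) r))
    = (\<lambda>q. if q < m then (s(r := tl (s r))) q else h q)"
    using Pop by auto
  then show ?case using Pop exec.Pop[of r "\<lambda>r. if r < m then s r else h r"] by auto
next
  case (Seq c1 s t1 s1 c2 t2 s2)
  then show ?case using exec.Seq by fastforce
next
  case (Case_empty s r c0 t s' c1 c2)
  then show ?case using exec.Case_empty by simp
next
  case (Case_False s r w c1 t s' c0 c2)
  then show ?case using exec.Case_False by simp
next
  case (Case_True s r w c2 t s' c0 c1)
  then show ?case using exec.Case_True by simp
next
  case (While_end s r c)
  then show ?case using exec.While_end by simp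
next
  case (While_step s r c t1 s1 t2 s2)
  then show ?case by (auto intro: exec.While_step)
qed

lemma runs_frame:
  assumes "runs c s T s'" "regs_below c m"
  shows "runs c (\<lambda>r. if r < m then s r else h r) T (\<lambda>r. if r < m then s' r else h r)"
  using assms exec_frame unfolding runs_def by blast


section \<open>Programs that move and copy stacks\<close>

definition Skip :: com where
  "Skip = Seq (Push 0 True) (Pop 0)"

lemma runs_Skip: "runs Skip s 2 s"
  unfolding Skip_def by (rule runs_weaken[OF runs_Seq[OF runs_Push runs_Pop]]) auto

definition Shift :: "nat \<Rightarrow> nat \<Rightarrow> com" where
  "Shift a b = Case a Skip (Seq (Pop a) (Push b False)) (Seq (Pop a) (Push b True))"

lemma runs_Shift:
  assumes "s a = x # w" "a \<noteq> b"
  shows "runs (Shift a b) s 3 (s(a := w, b := x # s b))"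
proof -
  have "runs (Seq (Pop a) (Push b x)) s 2 (s(a := w, b := x # s b))"
    by (rule runs_weaken[OF runs_Seq[OF runs_Pop runs_Push]]) (use assms in auto)
  then have "runs (if x then Seq (Pop a) (Push b True) else Seq (Pop a) (Push b False)) s 2
      (s(a := w, b := x # s b))"
    by (cases x) simp_all
  from runs_Case_Cons[of s a x w, OF assms(1) this] show ?thesis unfolding Shift_def by (simp add: numeral_eq_Suc)
qed

definition Clear :: "nat \<Rightarrow> com" where
  "Clear r = While r (Pop r)"

lemma runs_Clear: "runs (Clear r) s (2 * length (s r) + 1) (s(r := []))"
proof -
  have "s r = w \<Longrightarrow> runs (Clear r) s (2 * length w + 1) (s(r := []))" for w
  proof (induction w arbitrary: s)
    case Nil
    then show ?case unfolding Clear_def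
      by (intro runs_weaken[OF runs_While_Nil]) auto
  next
    case (Cons x w)
    have 1: "runs (Clear r) (s(r := tl (s r))) (2 * length w + 1) ((s(r := tl (s r)))(r := []))"
      by (rule Cons.IH) (use Cons.prems in simp)
    have "s r \<noteq> []" using Cons.prems by simp
    from runs_While_step[OF this runs_Pop 1[unfolded Clear_def]]
    show ?case unfolding Clear_def
      by (rule runs_weaken) (use Cons.prems in auto)
  qed
  then show ?thesis by simp
qed

definition Move :: "nat \<Rightarrow> nat \<Rightarrow> com" where
  "Move a b = While a (Shift a b)"

lemma runs_Move:
  assumes "a \<noteq> b"
  shows "runs (Move a b) s (4 * length (s a) + 1) (s(a := [], b := rev (s a) @ s b))"
proof -
  have "s a = w \<Longrightarrow> runs (Move a b) s (4 * length w + 1) (s(a := [], b := rev w @ s b))" for w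
  proof (induction w arbitrary: s)
    case Nil
    then show ?case unfolding Move_def
      by (intro runs_weaken[OF runs_While_Nil]) auto
  next
    case (Cons x w)
    let ?s = "s(a := w, b := x # s b)"
    have 1: "runs (Move a b) ?s (4 * length w + 1) (?s(a := [], b := rev w @ ?s b))"
      by (rule Cons.IH) (use assms in simp)
    have "s a \<noteq> []" using Cons.prems by simp
    from runs_While_step[OF this runs_Shift[of s a x w b, OF Cons.prems assms] 1[unfolded Move_def]]
    show ?case unfolding Move_def
      by (rule runs_weaken) (use assms in auto)
  qed
  then show ?thesis by simp
qed

definition Move2 :: "nat \<Rightarrow> nat \<Rightarrow> nat \<Rightarrow> com" where
  "Move2 a b c = While a (Case a Skip (Seq (Push c False) (Shift a b)) (Seq (Push c True) (Shift a b)))"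

lemma runs_Move2:
  assumes "a \<noteq> b" "a \<noteq> c" "b \<noteq> c"
  shows "runs (Move2 a b c) s (6 * length (s a) + 1)
    (s(a := [], b := rev (s a) @ s b, c := rev (s a) @ s c))"
proof -
  have "s a = w \<Longrightarrow> runs (Move2 a b c) s (6 * length w + 1)
    (s(a := [], b := rev w @ s b, c := rev w @ s c))" for w
  proof (induction w arbitrary: s)
    case Nil
    then show ?case unfolding Move2_def
      by (intro runs_weaken[OF runs_While_Nil]) auto
  next
    case (Cons x w)
    let ?s = "s(a := w, b := x # s b, c := x # s c)"
    have 1: "runs (Move2 a b c) ?s (6 * length w + 1) (?s(a := [], b := rev w @ ?s b, c := rev w @ ?s c))"
      by (rule Cons.IH) (use assms in simp)
    have "runs (Shift a b) (s(c := x # s c)) 3 ?s"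
      by (rule runs_weaken[OF runs_Shift[where x = x and w = w]]) (use assms Cons.prems in auto)
    from runs_Seq[OF runs_Push this]
    have "runs (if x then Seq (Push c True) (Shift a b) else Seq (Push c False) (Shift a b)) s 4 ?s"
      by (cases x) simp_all
    from runs_Case_Cons[of s a x w, OF Cons.prems this]
    have 2: "runs (Case a Skip (Seq (Push c False) (Shift a b)) (Seq (Push c True) (Shift a b))) s 5 ?s"
      by simp
    have "s a \<noteq> []" using Cons.prems by simp
    from runs_While_step[OF this 2 1[unfolded Move2_def]]
    show ?case unfolding Move2_def
      by (rule runs_weaken) (use assms in auto)
  qed
  then show ?thesis by simp
qed

text \<open>Reading a stack destroys it and reverses the order, so a copy takes two passes: one into
  the scratch stack \<open>c\<close>, and one back that fills \<open>a\<close> and \<open>b\<close>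
  together and restores the order.\<close>

definition Copy :: "nat \<Rightarrow> nat \<Rightarrow> nat \<Rightarrow> com" where
  "Copy a b c = Seq (Move a c) (Move2 c a b)"

lemma runs_Copy:
  assumes "a \<noteq> b" "a \<noteq> c" "b \<noteq> c" "s c = []"
  shows "runs (Copy a b c) s (10 * length (s a) + 2) (s(b := s a @ s b))"
  unfolding Copy_def
  by (rule runs_weaken[OF runs_Seq[OF runs_Move runs_Move2]]) (use assms in auto)


section \<open>Reading the encodings\<close>

text \<open>\<open>While\<close> tests only for emptiness, so the stack \<open>f\<close> serves as a
  flag that is nonempty exactly as long as another digit may follow. The code is not decoded but
  transferred, in reverse, onto \<open>b\<close>.\<close>

definition Read_nat :: "nat \<Rightarrow> nat \<Rightarrow> nat \<Rightarrow> com" where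
  "Read_nat a b f = Seq (Push f True)
     (While f (Seq (Pop f) (Case a Skip (Shift a b)
        (Seq (Shift a b) (Seq (Shift a b) (Push f True))))))"

lemma runs_Read_nat:
  assumes "s a = enc_nat n @ w" "s f = []" "a \<noteq> b" "a \<noteq> f" "b \<noteq> f"
  shows "runs (Read_nat a b f) s (10 * length (s a) + 10) (s(a := w, b := rev (enc_nat n) @ s b))"
proof -
  let ?e = "\<lambda>bs. concat (map (\<lambda>b. [True, b]) bs) @ [False]"
  let ?c = "Seq (Pop f) (Case a Skip (Shift a b) (Seq (Shift a b) (Seq (Shift a b) (Push f True))))"
  have loop: "runs (While f ?c) s (10 * length bs + 9) (s(f := [], a := w, b := rev (?e bs) @ s b))"
    if "s a = ?e bs @ w" "s f = [True]" for s bs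
    using that
  proof (induction bs arbitrary: s)
    case Nil
    let ?s = "s(f := [], a := w, b := False # s b)"
    have 1: "runs (Case a Skip (Shift a b) (Seq (Shift a b) (Seq (Shift a b) (Push f True))))
      (s(f := [])) 4 ?s"
      by (rule runs_weaken[OF runs_Case_Cons[where b = False and w = w and T = 3]])
         (use Nil assms(3-5) in \<open>auto intro!: runs_weaken[OF runs_Shift[where x = False and w = w]]\<close>)
    have 2: "runs ?c s 5 ?s"
      by (rule runs_weaken[OF runs_Seq[where ?T2.0 = 4, OF runs_Pop]]) (use 1 Nil in auto)
    have "s f \<noteq> []" using Nil by simp
    from runs_While_step[OF this 2 runs_While_Nil] show ?case
      by (rule runs_weaken) (use assms(3-5) in auto)
  next
    case (Cons x bs)
    let ?s = "s(a := ?e bs @ w, b := x # True # s b)"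
    let ?s1 = "s(f := [], a := x # ?e bs @ w, b := True # s b)"
    have 1: "runs (Shift a b) (s(f := [])) 3 ?s1"
      by (rule runs_weaken[OF runs_Shift[where x = True and w = "x # ?e bs @ w"]])
        (use Cons.prems assms in auto)
    have 2: "runs (Shift a b) ?s1 3 (s(f := [], a := ?e bs @ w, b := x # True # s b))"
      by (rule runs_weaken[OF runs_Shift[where x = x and w = "?e bs @ w"]])
        (use Cons.prems assms in auto)
    have 3: "runs (Push f True) (s(f := [], a := ?e bs @ w, b := x # True # s b)) 1 ?s"
      by (rule runs_weaken[OF runs_Push]) (use Cons.prems assms in auto)
    have 4: "runs (Case a Skip (Shift a b) (Seq (Shift a b) (Seq (Shift a b) (Push f True))))
      (s(f := [])) 8 ?s"
      by (rule runs_weaken[OF runs_Case_Cons[where b = True and w = "x # ?e bs @ w" and T = 7]])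
         (use Cons.prems assms runs_Seq[OF 1 runs_Seq[OF 2 3]] in \<open>auto simp: add_ac\<close>)
    have 5: "runs ?c s 9 ?s"
      by (rule runs_weaken[OF runs_Seq[where ?T2.0 = 8, OF runs_Pop]]) (use 4 Cons.prems in auto)
    have 6: "runs (While f ?c) ?s (10 * length bs + 9) (?s(f := [], a := w, b := rev (?e bs) @ ?s b))"
      by (rule Cons.IH) (use Cons.prems assms(3-5) in auto)
    have "s f \<noteq> []" using Cons.prems by simp
    from runs_While_step[OF this 5 6] show ?case
      by (rule runs_weaken) (use assms(3-5) in auto)
  qed
  have len: "length (?e bs) = 2 * length bs + 1" for bs :: "bool list"
    by (induction bs) auto
  have "runs (While f ?c) (s(f := True # s f)) (10 * length (bits n) + 9)
     (s(a := w, b := rev (enc_nat n) @ s b))"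
    by (rule runs_weaken[OF loop[where bs = "bits n"]]) (use assms in \<open>auto simp: enc_nat_def\<close>)
  from runs_Seq[OF runs_Push this] show ?thesis
    unfolding Read_nat_def
    by (rule runs_weaken) (use assms len[of "bits n"] in \<open>auto simp: enc_nat_def\<close>)
qed

definition Read_int :: "nat \<Rightarrow> nat \<Rightarrow> nat \<Rightarrow> com" where
  "Read_int a b f = Seq (Shift a b) (Read_nat a b f)"

lemma runs_Read_int:
  assumes "s a = enc_int k @ w" "s f = []" "a \<noteq> b" "a \<noteq> f" "b \<noteq> f"
  shows "runs (Read_int a b f) s (10 * length (s a) + 10) (s(a := w, b := rev (enc_int k) @ s b))"
proof -
  have a: "s a = (k < 0) # enc_nat (nat \<bar>k\<bar>) @ w" using assms by (simp add: enc_int_def)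
  show ?thesis
    unfolding Read_int_def
    by (rule runs_weaken[OF runs_Seq[OF runs_Shift[of s a, OF a] runs_Read_nat[where n = "nat \<bar>k\<bar>" and w = w]]])
      (use assms a in \<open>auto simp: enc_int_def\<close>)
qed

text \<open>The case distinction guards against an exhausted list: reading beyond the last number
  does nothing, so that \<open>take 1\<close> and \<open>tl\<close> describe the effect on every
  list.\<close>

definition Read_rat :: "nat \<Rightarrow> nat \<Rightarrow> nat \<Rightarrow> com" where
  "Read_rat a b f = Case a Skip (Seq (Read_int a b f) (Read_int a b f))
     (Seq (Read_int a b f) (Read_int a b f))"

lemma runs_Read_rat:
  assumes "s a = concat (map enc_rat qs)" "s f = []" "a \<noteq> b" "a \<noteq> f" "b \<noteq> f"
  shows "runs (Read_rat a b f) s (20 * length (s a) + 21)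
    (s(a := concat (map enc_rat (tl qs)), b := rev (concat (map enc_rat (take 1 qs))) @ s b))"
proof (cases qs)
  case Nil
  then show ?thesis
    unfolding Read_rat_def using assms
    by (intro runs_weaken[OF runs_Case_Nil[OF _ runs_Skip]]) auto
next
  case (Cons q qs')
  obtain k d where q: "quotient_of q = (k, d)" by fastforce
  let ?w = "concat (map enc_rat qs')"
  have a: "s a = enc_int k @ enc_int d @ ?w"
    using assms Cons q by (simp add: enc_rat_def)
  then obtain x v where x: "s a = x # v" by (simp add: enc_int_def)
  have "runs (Seq (Read_int a b f) (Read_int a b f)) s (20 * length (s a) + 20)
      (s(a := ?w, b := rev (enc_rat q) @ s b))"
    by (rule runs_weaken[OF runs_Seq[OF runs_Read_int[of s a, OF a] runs_Read_int[where k = d and w = ?w]]])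
      (use assms(2-5) a in \<open>simp_all add: enc_rat_def q fun_upd_twist\<close>)
  then show ?thesis
    unfolding Read_rat_def by (intro runs_weaken[OF runs_Case_Cons[of s a, OF x]]) (auto simp: Cons)
qed

definition Read_dim :: "nat \<Rightarrow> nat \<Rightarrow> nat \<Rightarrow> com" where
  "Read_dim a b f = Seq (Push f True)
     (While f (Case a Skip (Seq (Pop a) (Pop f)) (Shift a b)))"

lemma runs_Read_dim:
  assumes "s a = enc_dim n @ w" "s b = []" "s f = []" "a \<noteq> b" "a \<noteq> f" "b \<noteq> f"
  shows "runs (Read_dim a b f) s (5 * length (s a) + 10) (s(a := w, b := replicate n True))"
proof -
  let ?c = "Case a Skip (Seq (Pop a) (Pop f)) (Shift a b)"
  have loop: "runs (While f ?c) s (5 * n + 5) (s(f := [], a := w, b := replicate n True @ s b))"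
    if "s a = enc_dim n @ w" "s f = [True]" for s
    using that
  proof (induction n arbitrary: s)
    case 0
    have "runs ?c s 3 (s(f := [], a := w))"
      by (rule runs_weaken[OF runs_Case_Cons[where b = False and w = w and T = 2]])
         (use 0 assms(4-6) in \<open>auto simp: enc_dim_def intro!: runs_weaken[OF runs_Seq[OF runs_Pop runs_Pop]]\<close>)
    note 1 = this
    have "s f \<noteq> []" using 0 by simp
    from runs_While_step[OF this 1 runs_While_Nil] show ?case
      by (rule runs_weaken) (use assms(4-6) in auto)
  next
    case (Suc n)
    let ?s = "s(a := enc_dim n @ w, b := True # s b)"
    have 1: "runs ?c s 4 ?s"
      by (rule runs_weaken[OF runs_Case_Cons[where b = True and w = "enc_dim n @ w" and T = 3]])
        (use Suc.prems assms(4-6) in \<open>auto simp: enc_dim_def intro!: runs_Shift\<close>)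
    have 2: "runs (While f ?c) ?s (5 * n + 5) (?s(f := [], a := w, b := replicate n True @ ?s b))"
      by (rule Suc.IH) (use Suc.prems assms(4-6) in auto)
    have "s f \<noteq> []" using Suc.prems by simp
    from runs_While_step[OF this 1 2] show ?case
      by (rule runs_weaken) (use assms(4-6) in \<open>auto simp: replicate_app_Cons_same\<close>)
  qed
  have "runs (While f ?c) (s(f := True # s f)) (5 * n + 5) (s(a := w, b := replicate n True))"
    by (rule runs_weaken[OF loop]) (use assms in auto)
  from runs_Seq[OF runs_Push this] show ?thesis
    unfolding Read_dim_def
    by (rule runs_weaken) (use assms in \<open>auto simp: enc_dim_def\<close>)
qed

section \<open>A language of loops with unary counters\<close>

datatype nexp = Num nat | Var nat | Plus nexp nexp | Times nexp nexp | Minus nexp nexp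

primrec neval :: "nexp \<Rightarrow> (nat \<Rightarrow> nat) \<Rightarrow> nat" where
  "neval (Num n) \<sigma> = n"
| "neval (Var v) \<sigma> = \<sigma> v"
| "neval (Plus a b) \<sigma> = neval a \<sigma> + neval b \<sigma>"
| "neval (Times a b) \<sigma> = neval a \<sigma> * neval b \<sigma>"
| "neval (Minus a b) \<sigma> = neval a \<sigma> - neval b \<sigma>"

text \<open>Register 1 holds the output of the program and must not be read.\<close>

primrec nwf :: "nexp \<Rightarrow> nat \<Rightarrow> bool" where
  "nwf (Num n) d \<longleftrightarrow> True"
| "nwf (Var v) d \<longleftrightarrow> v < d \<and> v \<noteq> 1"
| "nwf (Plus a b) d \<longleftrightarrow> nwf a d \<and> nwf b d"
| "nwf (Times a b) d \<longleftrightarrow> nwf a d \<and> nwf b d"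
| "nwf (Minus a b) d \<longleftrightarrow> nwf a d \<and> nwf b d"

primrec nbound :: "nexp \<Rightarrow> nat \<Rightarrow> nat" where
  "nbound (Num n) B = n"
| "nbound (Var v) B = B"
| "nbound (Plus a b) B = nbound a B + nbound b B"
| "nbound (Times a b) B = nbound a B * nbound b B"
| "nbound (Minus a b) B = nbound a B"

primrec ntime :: "nexp \<Rightarrow> nat \<Rightarrow> nat" where
  "ntime (Num n) B = n + 2"
| "ntime (Var v) B = 13 * B + 3"
| "ntime (Plus a b) B = ntime a B + ntime b B"
| "ntime (Times a b) B = ntime a B + (nbound a B * (ntime b B + 2) + 1)"
| "ntime (Minus a b) B = ntime a B + ntime b B + (nbound b B * 3 + 1) + (nbound a B * 3 + 1)"

lemma neval_le_nbound: "nwf e d \<Longrightarrow> (\<And>v. v < d \<Longrightarrow> v \<noteq> 1 \<Longrightarrow> \<sigma> v \<le> B) \<Longrightarrow> neval e \<sigma> \<le> nbound e B"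
  by (induction e) (auto intro: add_mono mult_mono le_trans[OF diff_le_self])

lemma poly_bounded_nbound: "poly_bounded (nbound e)"
  by (induction e) (simp_all add: poly_bounded_intros del: nbound.simps add: nbound.simps[abs_def])

lemma poly_bounded_ntime: "poly_bounded (ntime e)"
proof (induction e)
  case (Times a b)
  then show ?case unfolding ntime.simps[abs_def]
    by (intro poly_bounded_intros poly_bounded_nbound)
next
  case (Minus a b)
  then show ?case unfolding ntime.simps[abs_def]
    by (intro poly_bounded_intros poly_bounded_nbound)
qed (unfold ntime.simps[abs_def], intro poly_bounded_intros; assumption)+

primrec Push_list :: "bool list \<Rightarrow> nat \<Rightarrow> com" where
  "Push_list [] r = Skip"
| "Push_list (b # bs) r = Seq (Push r b) (Push_list bs r)"

lemma runs_Push_list: "runs (Push_list bs r) s (length bs + 2) (s(r := rev bs @ s r))"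
proof (induction bs arbitrary: s)
  case Nil
  then show ?case using runs_Skip[of s] by (simp add: numeral_2_eq_2)
next
  case (Cons b bs)
  show ?case unfolding Push_list.simps
    by (rule runs_weaken[OF runs_Seq[OF runs_Push Cons]]) auto
qed

definition Count :: "nat \<Rightarrow> nat \<Rightarrow> com" where
  "Count a b = While a (Seq (Pop a) (Push b True))"

lemma runs_Count:
  assumes "a \<noteq> b"
  shows "runs (Count a b) s (length (s a) * 3 + 1) (s(a := [], b := replicate (length (s a)) True @ s b))"
proof -
  define st where "st i = s(a := drop i (s a), b := replicate i True @ s b)" for i
  have "runs (While a (Seq (Pop a) (Push b True))) (st 0) (length (s a) * (2 + 1) + 1) (st (length (s a)))"
  proof (rule runs_While)
    fix i assume i: "i < length (s a)"
    then show "st i a \<noteq> []" using assms by (simp add: st_def)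
    show "runs (Seq (Pop a) (Push b True)) (st i) 2 (st (Suc i))"
      by (rule runs_weaken[OF runs_Seq[OF runs_Pop runs_Push]])
        (use assms in \<open>auto simp: st_def drop_Suc tl_drop\<close>)
  qed (use assms in \<open>auto simp: st_def\<close>)
  moreover have "st 0 = s" using assms by (auto simp: st_def)
  ultimately have "runs (Count a b) s (length (s a) * (2 + 1) + 1) (st (length (s a)))"
    unfolding Count_def by simp
  then show ?thesis
    by (rule runs_weaken) (use assms in \<open>auto simp: st_def\<close>)
qed

text \<open>The target \<open>a\<close> receives the value in unary on top of its contents, and all
  registers from \<open>m\<close> on are empty scratch space. A sum is therefore two evaluations
  into one target, and a product is a repeated evaluation.\<close>

primrec nexp_com :: "nexp \<Rightarrow> nat \<Rightarrow> nat \<Rightarrow> com" where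
  "nexp_com (Num n) a m = Push_list (replicate n True) a"
| "nexp_com (Var v) a m = Seq (Copy v m (m + 1)) (Count m a)"
| "nexp_com (Plus e f) a m = Seq (nexp_com e a m) (nexp_com f a m)"
| "nexp_com (Times e f) a m = Seq (nexp_com e m (m + 1)) (While m (Seq (Pop m) (nexp_com f a (m + 1))))"
| "nexp_com (Minus e f) a m = Seq (Seq (Seq (nexp_com e m (m + 1)) (nexp_com f (m + 1) (m + 2)))
     (While (m + 1) (Seq (Pop (m + 1)) (Pop m)))) (Count m a)"

text \<open>As \<open>a\<close> lies at or beyond \<open>d\<close>, pushing onto it changes no
  variable; hence the later operands are evaluated in the same environment as the first.\<close>

lemma runs_nexp_com:
  assumes "nwf e d" "\<And>v. v < d \<Longrightarrow> v \<noteq> 1 \<Longrightarrow> length (s v) = \<sigma> v" "\<And>v. v < d \<Longrightarrow> v \<noteq> 1 \<Longrightarrow> \<sigma> v \<le> B"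
    and "d \<le> a" "a < m" "\<And>r. m \<le> r \<Longrightarrow> s r = []"
  shows "runs (nexp_com e a m) s (ntime e B) (s(a := replicate (neval e \<sigma>) True @ s a))"
  using assms
proof (induction e arbitrary: a m s)
  case (Num n)
  show ?case unfolding nexp_com.simps
    by (rule runs_weaken[OF runs_Push_list]) (simp_all add: fun_eq_iff)
next
  case (Var v)
  have v: "v < d" "v \<noteq> 1" "length (s v) = \<sigma> v" "\<sigma> v \<le> B" using Var.prems by auto
  have 1: "runs (Copy v m (m + 1)) s (10 * B + 2) (s(m := s v))"
    by (rule runs_weaken[OF runs_Copy]) (use Var.prems v in auto)
  have 2: "runs (Count m a) (s(m := s v)) (B * 3 + 1) (s(a := replicate (\<sigma> v) True @ s a))"
    by (rule runs_weaken[OF runs_Count]) (use Var.prems v in auto)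
  show ?case unfolding nexp_com.simps
    by (rule runs_weaken[OF runs_Seq[OF 1 2]]) auto
next
  case (Plus e f)
  let ?s = "s(a := replicate (neval e \<sigma>) True @ s a)"
  have 1: "runs (nexp_com e a m) s (ntime e B) ?s"
    by (rule Plus.IH) (use Plus.prems in auto)
  have 2: "runs (nexp_com f a m) ?s (ntime f B) (?s(a := replicate (neval f \<sigma>) True @ ?s a))"
    by (rule Plus.IH) (use Plus.prems in auto)
  show ?case
    unfolding nexp_com.simps by (rule runs_weaken[OF runs_Seq[OF 1 2]])
      (auto simp flip: append_assoc replicate_add simp: add.commute)
next
  case (Times e f)
  let ?n = "neval e \<sigma>" and ?k = "neval f \<sigma>"
  have 1: "runs (nexp_com e m (m + 1)) s (ntime e B) (s(m := replicate ?n True))"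
    by (rule runs_weaken[OF Times.IH(1)]) (use Times.prems in auto)
  define st where "st i = s(m := replicate (?n - i) True, a := replicate (i * ?k) True @ s a)" for i
  have "runs (While m (Seq (Pop m) (nexp_com f a (m + 1)))) (st 0) (?n * (ntime f B + 1 + 1) + 1) (st ?n)"
  proof (rule runs_While)
    fix i assume i: "i < ?n"
    then show "st i m \<noteq> []" using Times.prems by (simp add: st_def)
    let ?s = "s(m := replicate (?n - Suc i) True, a := replicate (i * ?k) True @ s a)"
    have 2: "runs (nexp_com f a (m + 1)) ?s (ntime f B) (?s(a := replicate ?k True @ ?s a))"
      by (rule Times.IH(2)) (use Times.prems in auto)
    have 3: "runs (Pop m) (st i) 1 ?s"
      by (rule runs_weaken[OF runs_Pop]) (use i Times.prems in \<open>auto simp: st_def\<close>)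
    show "runs (Seq (Pop m) (nexp_com f a (m + 1))) (st i) (ntime f B + 1) (st (Suc i))"
      by (rule runs_weaken[OF runs_Seq[OF 3 2]])
        (use Times.prems in \<open>auto simp: st_def replicate_add fun_upd_twist\<close>)
  qed (use Times.prems in \<open>auto simp: st_def\<close>)
  moreover have "st 0 = s(m := replicate ?n True)" using Times.prems by (auto simp: st_def)
  ultimately have 4: "runs (While m (Seq (Pop m) (nexp_com f a (m + 1)))) (s(m := replicate ?n True))
      (?n * (ntime f B + 2) + 1) (st ?n)" by simp
  have 5: "?n \<le> nbound e B" by (rule neval_le_nbound) (use Times.prems in auto)
  show ?case unfolding nexp_com.simps
    by (rule runs_weaken[OF runs_Seq[OF 1 4]])
      (use Times.prems mult_right_mono[OF 5, of "ntime f B + 2"] in \<open>auto simp: st_def\<close>)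
next
  case (Minus e f)
  let ?n = "neval e \<sigma>" and ?k = "neval f \<sigma>"
  have 1: "runs (nexp_com e m (m + 1)) s (ntime e B) (s(m := replicate ?n True))"
    by (rule runs_weaken[OF Minus.IH(1)]) (use Minus.prems in auto)
  let ?s = "s(m := replicate ?n True, m + 1 := replicate ?k True)"
  have 2: "runs (nexp_com f (m + 1) (m + 2)) (s(m := replicate ?n True)) (ntime f B) ?s"
    by (rule runs_weaken[OF Minus.IH(2)]) (use Minus.prems in auto)
  define st where "st i = s(m := replicate (?n - i) True, m + 1 := replicate (?k - i) True)" for i
  have "runs (While (m + 1) (Seq (Pop (m + 1)) (Pop m))) (st 0) (?k * (2 + 1) + 1) (st ?k)"
  proof (rule runs_While)
    fix i assume i: "i < ?k"
    then show "st i (m + 1) \<noteq> []" using Minus.prems by (simp add: st_def)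
    show "runs (Seq (Pop (m + 1)) (Pop m)) (st i) 2 (st (Suc i))"
      by (rule runs_weaken[OF runs_Seq[OF runs_Pop runs_Pop]]) (use i in \<open>auto simp: st_def\<close>)
  qed (auto simp: st_def)
  then have 3: "runs (While (m + 1) (Seq (Pop (m + 1)) (Pop m))) ?s (?k * 3 + 1) (st ?k)"
    by (simp add: st_def)
  have 4: "runs (Count m a) (st ?k) ((?n - ?k) * 3 + 1) (s(a := replicate (?n - ?k) True @ s a))"
    by (rule runs_weaken[OF runs_Count]) (use Minus.prems in \<open>auto simp: st_def\<close>)
  have 5: "?n \<le> nbound e B" "?k \<le> nbound f B"
    using neval_le_nbound[of _ d \<sigma> B] Minus.prems by auto
  show ?case unfolding nexp_com.simps
    by (rule runs_weaken[OF runs_Seq[OF runs_Seq[OF runs_Seq[OF 1 2] 3] 4]]) (use 5 in auto)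
qed

text \<open>Numbers of the input are never decoded: \<open>Token e\<close> copies the code of the
  rational at position \<open>e\<close> of the input stream, and \<open>Bound\<close> copies the
  code of \<open>R\<close>.\<close>

datatype stmt =
    Emit "bool list"
  | Token nexp
  | Bound
  | For nexp stmt
  | IfZ nexp stmt stmt
  | Then stmt stmt  (infixr \<open>;;\<close> 60)

text \<open>
  A loop at depth \<open>d\<close> keeps the number of remaining rounds in register \<open>d\<close> and the index in
  register \<open>d + 1\<close>.
\<close>

primrec den :: "stmt \<Rightarrow> rat list \<Rightarrow> nat \<Rightarrow> nat \<Rightarrow> (nat \<Rightarrow> nat) \<Rightarrow> bool list" where
  "den (Emit bs) qs R d \<sigma> = bs"
| "den (Token e) qs R d \<sigma> = concat (map enc_rat (take 1 (drop (neval e \<sigma>) qs)))"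
| "den Bound qs R d \<sigma> = enc_nat R"
| "den (For e S) qs R d \<sigma> =
     concat (map (\<lambda>i. den S qs R (d + 2) (\<sigma>(d := neval e \<sigma> - Suc i, d + 1 := i))) [0..<neval e \<sigma>])"
| "den (IfZ e S1 S2) qs R d \<sigma> = (if neval e \<sigma> = 0 then den S1 qs R d \<sigma> else den S2 qs R d \<sigma>)"
| "den (S1 ;; S2) qs R d \<sigma> = den S1 qs R d \<sigma> @ den S2 qs R d \<sigma>"

primrec swf :: "stmt \<Rightarrow> nat \<Rightarrow> bool" where
  "swf (Emit bs) d \<longleftrightarrow> True"
| "swf (Token e) d \<longleftrightarrow> nwf e d"
| "swf Bound d \<longleftrightarrow> True"
| "swf (For e S) d \<longleftrightarrow> nwf e d \<and> swf S (d + 2)"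
| "swf (IfZ e S1 S2) d \<longleftrightarrow> nwf e d \<and> swf S1 d \<and> swf S2 d"
| "swf (S1 ;; S2) d \<longleftrightarrow> swf S1 d \<and> swf S2 d"

text \<open>Inside a loop the two new registers are at most the number of rounds, so the bound on
  the variables rises from \<open>B\<close> to \<open>B + nbound e B\<close>. The nesting depth is
  fixed by the program, hence the composition stays polynomial in \<open>B\<close>.\<close>

primrec stime :: "stmt \<Rightarrow> nat \<Rightarrow> nat" where
  "stime (Emit bs) B = length bs + 2"
| "stime (Token e) B = ntime e B + (10 * B + 2) + (nbound e B * (20 * B + 23) + 1) + (20 * B + 21)
     + (2 * B + 1) + (2 * B + 1)"
| "stime Bound B = (10 * B + 2) + (4 * B + 1)"
| "stime (For e S) B = ntime e B + (nbound e B * (stime S (B + nbound e B) + 3) + 1) + (2 * nbound e B + 1)"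
| "stime (IfZ e S1 S2) B = ntime e B + (1 + (2 * nbound e B + 1) + stime S1 B + stime S2 B)"
| "stime (S1 ;; S2) B = stime S1 B + stime S2 B"

lemma poly_bounded_stime: "poly_bounded (stime S)"
proof (induction S)
  case (For e S)
  have "poly_bounded (\<lambda>B. stime S (B + nbound e B))"
    by (rule poly_bounded_comp[OF For]) (intro poly_bounded_intros poly_bounded_nbound)
  then show ?case unfolding stime.simps[abs_def]
    by (intro poly_bounded_intros poly_bounded_nbound poly_bounded_ntime)
qed (unfold stime.simps[abs_def],
  (intro poly_bounded_intros poly_bounded_nbound poly_bounded_ntime; assumption)+)

text \<open>\<open>Token\<close> obtains random access by rescanning a fresh copy of the stream: the
  first \<open>e\<close> numbers are skipped onto a stack that is thrown away, and the next one goes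
  to the output.\<close>

primrec stmt_com :: "stmt \<Rightarrow> nat \<Rightarrow> com" where
  "stmt_com (Emit bs) d = Push_list bs 1"
| "stmt_com (Token e) d = Seq (Seq (Seq (Seq (Seq (nexp_com e d (d + 1)) (Copy 0 (d + 1) (d + 2)))
     (While d (Seq (Pop d) (Read_rat (d + 1) (d + 2) (d + 3)))))
     (Read_rat (d + 1) 1 (d + 3))) (Clear (d + 1))) (Clear (d + 2))"
| "stmt_com Bound d = Seq (Copy 2 d (d + 1)) (Move d 1)"
| "stmt_com (For e S) d = Seq (Seq (nexp_com e d (d + 2))
     (While d (Seq (Seq (Pop d) (stmt_com S (d + 2))) (Push (d + 1) True)))) (Clear (d + 1))"
| "stmt_com (IfZ e S1 S2) d = Seq (nexp_com e d (d + 1))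
     (Case d (stmt_com S1 d) (Seq (Clear d) (stmt_com S2 d)) (Seq (Clear d) (stmt_com S2 d)))"
| "stmt_com (S1 ;; S2) d = Seq (stmt_com S1 d) (stmt_com S2 d)"

text \<open>Invariant between statements: the registers from \<open>d\<close> on are empty, the data
  in registers 0 and 2 are intact, and the output so far lies reversed in register 1. Outputs thus
  concatenate, and a single final move puts them in order.\<close>

lemma runs_stmt_com:
  assumes "swf S d" "\<And>v. v < d \<Longrightarrow> v \<noteq> 1 \<Longrightarrow> length (s v) = \<sigma> v" "\<And>v. v < d \<Longrightarrow> v \<noteq> 1 \<Longrightarrow> \<sigma> v \<le> B"
    and "2 < d" "\<And>r. d \<le> r \<Longrightarrow> s r = []" "s 0 = concat (map enc_rat qs)" "s 2 = enc_nat R"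
  shows "runs (stmt_com S d) s (stime S B) (s(1 := rev (den S qs R d \<sigma>) @ s 1))"
  using assms
proof (induction S arbitrary: d s \<sigma> B)
  case (Emit bs)
  show ?case unfolding stmt_com.simps
    by (rule runs_weaken[OF runs_Push_list]) (simp_all add: fun_eq_iff)
next
  case (Token e)
  let ?n = "neval e \<sigma>" and ?w = "\<lambda>i. concat (map enc_rat (drop i qs))"
    and ?v = "\<lambda>i. rev (concat (map enc_rat (take i qs)))"
  have n: "?n \<le> nbound e B" by (rule neval_le_nbound) (use Token.prems in auto)
  have len: "length (?w i) \<le> B" "length (?v i) \<le> B" for i
  proof -
    have "length (s 0) \<le> B" using Token.prems(2,3)[of 0] Token.prems(4) by simp
    moreover have "?w 0 = concat (map enc_rat (take i qs)) @ ?w i"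
      by (simp flip: concat_append map_append)
    ultimately show "length (?w i) \<le> B" "length (?v i) \<le> B" using Token.prems(6) by auto
  qed
  have 1: "runs (nexp_com e d (d + 1)) s (ntime e B) (s(d := replicate ?n True))"
    by (rule runs_weaken[OF runs_nexp_com]) (use Token.prems in auto)
  have 2: "runs (Copy 0 (d + 1) (d + 2)) (s(d := replicate ?n True)) (10 * B + 2)
      (s(d := replicate ?n True, d + 1 := ?w 0))"
    by (rule runs_weaken[OF runs_Copy]) (use Token.prems len[of 0] in auto)
  define st where "st i = s(d := replicate (?n - i) True, d + 1 := ?w i, d + 2 := ?v i)" for i
  have "runs (While d (Seq (Pop d) (Read_rat (d + 1) (d + 2) (d + 3)))) (st 0)
    (?n * ((20 * B + 22) + 1) + 1) (st ?n)"
  proof (rule runs_While)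
    fix i assume i: "i < ?n"
    then show "st i d \<noteq> []" by (simp add: st_def)
    let ?s = "(st i)(d := replicate (?n - Suc i) True)"
    have a: "runs (Pop d) (st i) 1 ?s"
      by (rule runs_weaken[OF runs_Pop]) (use i in \<open>auto simp: st_def\<close>)
    have b: "runs (Read_rat (d + 1) (d + 2) (d + 3)) ?s (20 * B + 21) (st (Suc i))"
    proof (rule runs_weaken[OF runs_Read_rat])
      show "?s (d + 1) = concat (map enc_rat (drop i qs))" by (simp add: st_def)
      show "20 * length (?s (d + 1)) + 21 \<le> 20 * B + 21" using len(1)[of i] by (simp add: st_def)
      show "?s(d + 1 := concat (map enc_rat (tl (drop i qs))),
          d + 2 := rev (concat (map enc_rat (take 1 (drop i qs)))) @ ?s (d + 2)) = st (Suc i)"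
        using take_add[of i 1 qs] by (auto simp: st_def drop_Suc tl_drop)
    qed (use Token.prems in \<open>auto simp: st_def\<close>)
    show "runs (Seq (Pop d) (Read_rat (d + 1) (d + 2) (d + 3))) (st i) (20 * B + 22) (st (Suc i))"
      by (rule runs_weaken[OF runs_Seq[OF a b]]) auto
  qed (auto simp: st_def)
  moreover have "st 0 = s(d := replicate ?n True, d + 1 := ?w 0)"
    using Token.prems by (auto simp: st_def)
  ultimately have 3: "runs (While d (Seq (Pop d) (Read_rat (d + 1) (d + 2) (d + 3))))
    (s(d := replicate ?n True, d + 1 := ?w 0)) (?n * (20 * B + 23) + 1) (st ?n)"
    by (simp add: add.commute)
  let ?s1 = "(st ?n)(d + 1 := ?w (Suc ?n), 1 := rev (den (Token e) qs R d \<sigma>) @ s 1)"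
  have 4: "runs (Read_rat (d + 1) 1 (d + 3)) (st ?n) (20 * B + 21) ?s1"
    by (rule runs_weaken[OF runs_Read_rat[where qs = "drop ?n qs"]])
      (use Token.prems len(1)[of ?n] in \<open>auto simp: st_def drop_Suc tl_drop\<close>)
  have 5: "runs (Clear (d + 1)) ?s1 (2 * B + 1) (?s1(d + 1 := []))"
    by (rule runs_weaken[OF runs_Clear]) (use Token.prems len(1)[of "Suc ?n"] in auto)
  have 6: "runs (Clear (d + 2)) (?s1(d + 1 := [])) (2 * B + 1)
      (s(1 := rev (den (Token e) qs R d \<sigma>) @ s 1))"
    by (rule runs_weaken[OF runs_Clear])
      (use Token.prems len(2)[of ?n] in \<open>auto simp: st_def simp del: den.simps\<close>)
  show ?case unfolding stmt_com.simps
    by (rule runs_weaken[OF runs_Seq[OF runs_Seq[OF runs_Seq[OF runs_Seq[OF runs_Seq[OF 1 2] 3] 4] 5] 6]])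
      (use mult_right_mono[OF n, of "20 * B + 23"] in auto)
next
  case Bound
  have B: "length (s 2) \<le> B" using Bound.prems(2,3)[of 2] Bound.prems(4) by simp
  have 1: "runs (Copy 2 d (d + 1)) s (10 * B + 2) (s(d := s 2))"
    by (rule runs_weaken[OF runs_Copy]) (use Bound.prems B in auto)
  have 2: "runs (Move d 1) (s(d := s 2)) (4 * B + 1) (s(1 := rev (s 2) @ s 1))"
    by (rule runs_weaken[OF runs_Move]) (use Bound.prems B in auto)
  show ?case unfolding stmt_com.simps
    by (rule runs_weaken[OF runs_Seq[OF 1 2]]) (use Bound.prems in auto)
next
  case (For e S)
  let ?n = "neval e \<sigma>"
  have n: "?n \<le> nbound e B" by (rule neval_le_nbound) (use For.prems in auto)
  have 1: "runs (nexp_com e d (d + 2)) s (ntime e B) (s(d := replicate ?n True))"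
    by (rule runs_weaken[OF runs_nexp_com]) (use For.prems in auto)
  define f where "f i = den S qs R (d + 2) (\<sigma>(d := ?n - Suc i, d + 1 := i))" for i
  define st where "st i = s(d := replicate (?n - i) True, d + 1 := replicate i True,
    1 := rev (concat (map f [0..<i])) @ s 1)" for i
  have "runs (While d (Seq (Seq (Pop d) (stmt_com S (d + 2))) (Push (d + 1) True))) (st 0)
    (?n * ((stime S (B + nbound e B) + 2) + 1) + 1) (st ?n)"
  proof (rule runs_While)
    fix i assume i: "i < ?n"
    then show "st i d \<noteq> []" using For.prems by (simp add: st_def)
    let ?s = "(st i)(d := replicate (?n - Suc i) True)"
    have a: "runs (Pop d) (st i) 1 ?s"
      by (rule runs_weaken[OF runs_Pop]) (use i For.prems in \<open>auto simp: st_def\<close>)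
    have b: "runs (stmt_com S (d + 2)) ?s (stime S (B + nbound e B)) (?s(1 := rev (f i) @ ?s 1))"
      unfolding f_def
    proof (rule For.IH)
      show "length (?s v) = (\<sigma>(d := ?n - Suc i, d + 1 := i)) v" if "v < d + 2" "v \<noteq> 1" for v
        using that For.prems(2)[of v] For.prems(4) i by (auto simp: st_def)
      show "(\<sigma>(d := ?n - Suc i, d + 1 := i)) v \<le> B + nbound e B" if "v < d + 2" "v \<noteq> 1" for v
        using that For.prems(3)[of v] i n by auto
    qed (use For.prems in \<open>auto simp: st_def\<close>)
    show "runs (Seq (Seq (Pop d) (stmt_com S (d + 2))) (Push (d + 1) True)) (st i)
        (stime S (B + nbound e B) + 2) (st (Suc i))"
      by (rule runs_weaken[OF runs_Seq[OF runs_Seq[OF a b] runs_Push]])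
        (use For.prems in \<open>auto simp: st_def fun_eq_iff\<close>)
  qed (use For.prems in \<open>auto simp: st_def\<close>)
  moreover have "st 0 = s(d := replicate ?n True)"
    using For.prems by (auto simp: st_def)
  ultimately have 2: "runs (While d (Seq (Seq (Pop d) (stmt_com S (d + 2))) (Push (d + 1) True)))
    (s(d := replicate ?n True)) (?n * (stime S (B + nbound e B) + 3) + 1) (st ?n)"
    by (simp add: numeral_eq_Suc)
  have 3: "runs (Clear (d + 1)) (st ?n) (2 * nbound e B + 1) (s(1 := rev (den (For e S) qs R d \<sigma>) @ s 1))"
    by (rule runs_weaken[OF runs_Clear])
      (use For.prems n in \<open>auto simp: st_def f_def[abs_def]\<close>)
  show ?case unfolding stmt_com.simps
    by (rule runs_weaken[OF runs_Seq[OF runs_Seq[OF 1 2] 3]])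
      (use mult_right_mono[OF n, of "stime S (B + nbound e B) + 3"] in auto)
next
  case (IfZ e S1 S2)
  let ?n = "neval e \<sigma>"
  have n: "?n \<le> nbound e B" by (rule neval_le_nbound) (use IfZ.prems in auto)
  have 1: "runs (nexp_com e d (d + 1)) s (ntime e B) (s(d := replicate ?n True))"
    by (rule runs_weaken[OF runs_nexp_com]) (use IfZ.prems in auto)
  have 2: "runs (Case d (stmt_com S1 d) (Seq (Clear d) (stmt_com S2 d)) (Seq (Clear d) (stmt_com S2 d)))
     (s(d := replicate ?n True)) (1 + (2 * nbound e B + 1) + stime S1 B + stime S2 B)
     (s(1 := rev (den (IfZ e S1 S2) qs R d \<sigma>) @ s 1))"
  proof (cases ?n)
    case 0
    have "runs (stmt_com S1 d) s (stime S1 B) (s(1 := rev (den S1 qs R d \<sigma>) @ s 1))"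
      by (rule IfZ.IH) (use IfZ.prems in auto)
    then have "runs (stmt_com S1 d) (s(d := replicate ?n True)) (stime S1 B) (s(1 := rev (den S1 qs R d \<sigma>) @ s 1))"
      using 0 IfZ.prems(5)[of d] by (simp add: fun_upd_idem)
    from runs_Case_Nil[OF _ this] show ?thesis
      by (rule runs_weaken) (use 0 in auto)
  next
    case (Suc k)
    have a: "runs (stmt_com S2 d) s (stime S2 B) (s(1 := rev (den S2 qs R d \<sigma>) @ s 1))"
      by (rule IfZ.IH) (use IfZ.prems in auto)
    have b: "runs (Clear d) (s(d := replicate ?n True)) (2 * nbound e B + 1) s"
      by (rule runs_weaken[OF runs_Clear]) (use n IfZ.prems in auto)
    have c: "(s(d := replicate ?n True)) d = True # replicate k True" using Suc by simp
    have "runs (if True then Seq (Clear d) (stmt_com S2 d) else Seq (Clear d) (stmt_com S2 d))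
        (s(d := replicate ?n True)) (2 * nbound e B + 1 + stime S2 B)
        (s(1 := rev (den S2 qs R d \<sigma>) @ s 1))"
      using runs_Seq[OF b a] by simp
    from runs_Case_Cons[of "s(d := replicate ?n True)" d, OF c this] show ?thesis
      by (rule runs_weaken) (use Suc in auto)
  qed
  show ?case unfolding stmt_com.simps
    by (rule runs_weaken[OF runs_Seq[OF 1 2]]) auto
next
  case (Then S1 S2)
  let ?s = "s(1 := rev (den S1 qs R d \<sigma>) @ s 1)"
  have 1: "runs (stmt_com S1 d) s (stime S1 B) ?s"
    by (rule Then.IH) (use Then.prems in auto)
  have 2: "runs (stmt_com S2 d) ?s (stime S2 B) (?s(1 := rev (den S2 qs R d \<sigma>) @ ?s 1))"
    by (rule Then.IH) (use Then.prems in auto)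
  show ?case unfolding stmt_com.simps
    by (rule runs_weaken[OF runs_Seq[OF 1 2]]) auto
qed

section \<open>Translating instances in polynomial time\<close>

abbreviation horner :: "nat \<Rightarrow> bool list \<Rightarrow> nat" where
  "horner \<equiv> foldl (\<lambda>n b. 2 * n + of_bool b)"

lemma horner_bits: "horner 0 (rev (bits n)) = n"
proof (induction n rule: bits.induct)
  case (1 n)
  then show ?case
    by (cases "n = 0") (simp_all add: bits.simps[of n] bits.simps[of 0] odd_two_times_div_two_succ)
qed

text \<open>No intermediate value of Horner's rule exceeds the final one, which makes the cost of a
  round linear in the result.\<close>

lemma horner_ge: "n \<le> horner n bs"
proof (induction bs arbitrary: n)
  case (Cons b bs)
  from Cons[of "2 * n + of_bool b"] show ?case by simp
qed simp

lemma length_bits_le: "length (bits n) \<le> n"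
proof (induction n rule: bits.induct)
  case (1 n)
  then show ?case by (cases "n = 0") (simp_all add: bits.simps[of n] bits.simps[of 0])
qed

definition Double :: "nat \<Rightarrow> nat \<Rightarrow> com" where
  "Double a b = While a (Seq (Seq (Pop a) (Push b True)) (Push b True))"

lemma runs_Double:
  assumes "a \<noteq> b" "s b = []"
  shows "runs (Double a b) s (length (s a) * 4 + 1) (s(a := [], b := replicate (2 * length (s a)) True))"
proof -
  define st where "st i = s(a := drop i (s a), b := replicate (2 * i) True)" for i
  have "runs (While a (Seq (Seq (Pop a) (Push b True)) (Push b True))) (st 0)
      (length (s a) * (3 + 1) + 1) (st (length (s a)))"
  proof (rule runs_While)
    fix i assume i: "i < length (s a)"
    then show "st i a \<noteq> []" using assms by (simp add: st_def)
    show "runs (Seq (Seq (Pop a) (Push b True)) (Push b True)) (st i) 3 (st (Suc i))"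
      by (rule runs_weaken[OF runs_Seq[OF runs_Seq[OF runs_Pop runs_Push] runs_Push]])
        (use assms in \<open>auto simp: st_def drop_Suc tl_drop\<close>)
  qed (use assms in \<open>auto simp: st_def\<close>)
  moreover have "st 0 = s" using assms by (auto simp: st_def)
  ultimately have "runs (Double a b) s (length (s a) * (3 + 1) + 1) (st (length (s a)))"
    unfolding Double_def by simp
  then show ?thesis
    by (rule runs_weaken) (use assms in \<open>auto simp: st_def\<close>)
qed

text \<open>Reversed, a code starts with its end mark; then come the digits, most significant first,
  each followed by its marker \<open>True\<close>. Each round of Horner's rule doubles the counter,
  adds the digit and drops the marker.\<close>

definition Unary :: "nat \<Rightarrow> nat \<Rightarrow> nat \<Rightarrow> com" where
  "Unary a b c = Seq (Pop a) (While a (Seq (Seq (Seq (Double b c)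
     (Case a Skip (Pop a) (Seq (Pop a) (Push c True)))) (Pop a)) (Count c b)))"

lemma runs_Unary:
  assumes "s a = rev (enc_nat n)" "s b = []" "s c = []" "a \<noteq> b" "a \<noteq> c" "b \<noteq> c"
  shows "runs (Unary a b c) s (n * (7 * n + 8) + 2) (s(a := [], b := replicate n True))"
proof -
  let ?w = "\<lambda>bs. concat (map (\<lambda>b. [b, True]) bs)"
  let ?c = "Seq (Seq (Seq (Double b c)
     (Case a Skip (Pop a) (Seq (Pop a) (Push c True)))) (Pop a)) (Count c b)"
  have loop: "runs (While a ?c) s (length bs * (7 * n + 8) + 1) (s(a := [], b := replicate n True))"
    if "s a = ?w bs" "s b = replicate k True" "s c = []" "horner k bs = n" for s bs k
    using that
  proof (induction bs arbitrary: s k)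
    case Nil
    then show ?case by (intro runs_weaken[OF runs_While_Nil]) auto
  next
    case (Cons x bs)
    let ?k = "2 * k + of_bool x"
    have k: "?k \<le> n" using horner_ge[of ?k bs] Cons.prems(4) by simp
    have 1: "runs (Double b c) s (k * 4 + 1) (s(b := [], c := replicate (2 * k) True))"
      by (rule runs_weaken[OF runs_Double]) (use Cons.prems assms(4-6) in auto)
    let ?s = "s(b := [], a := True # ?w bs, c := replicate ?k True)"
    have 2: "runs (Case a Skip (Pop a) (Seq (Pop a) (Push c True))) (s(b := [], c := replicate (2 * k) True)) 3 ?s"
    proof (rule runs_weaken[OF runs_Case_Cons[where b = x and w = "True # ?w bs" and T = 2]])
      show "runs (if x then Seq (Pop a) (Push c True) else Pop a)
          (s(b := [], c := replicate (2 * k) True)) 2 ?s"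
        by (cases x; simp only: if_True if_False)
          (rule runs_weaken[OF runs_Seq[OF runs_Pop runs_Push]] runs_weaken[OF runs_Pop];
            use Cons.prems assms(4-6) in auto)+
    qed (use Cons.prems assms(4-6) in auto)
    have 3: "runs (Pop a) ?s 1 (?s(a := ?w bs))"
      by (rule runs_weaken[OF runs_Pop]) (use assms(4-6) in auto)
    let ?s1 = "s(a := ?w bs, b := replicate ?k True)"
    have 4: "runs (Count c b) (?s(a := ?w bs)) (?k * 3 + 1) ?s1"
      by (rule runs_weaken[OF runs_Count]) (use Cons.prems(3) assms(4-6) in auto)
    have 5: "runs ?c s (7 * n + 7) ?s1"
      by (rule runs_weaken[OF runs_Seq[OF runs_Seq[OF runs_Seq[OF 1 2] 3] 4]]) (use k in auto)
    have 6: "runs (While a ?c) ?s1 (length bs * (7 * n + 8) + 1) (?s1(a := [], b := replicate n True))"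
      by (rule Cons.IH) (use Cons.prems assms(4-6) in auto)
    have "s a \<noteq> []" using Cons.prems by simp
    from runs_While_step[OF this 5 6] show ?case by (rule runs_weaken) (use assms(4-6) in auto)
  qed
  have rev: "rev (concat (map (\<lambda>b. [True, b]) bs)) = ?w (rev bs)" for bs :: "bool list"
    by (induction bs) auto
  have "runs (While a ?c) (s(a := tl (s a))) (length (rev (bits n)) * (7 * n + 8) + 1)
      (s(a := tl (s a), a := [], b := replicate n True))"
    by (rule loop[where k = 0]) (use assms in \<open>auto simp: enc_nat_def rev horner_bits\<close>)
  from runs_Seq[OF runs_Pop this] show ?thesis
    unfolding Unary_def
    by (rule runs_weaken) (use mult_right_mono[OF length_bits_le[of n], of "7 * n + 8"] in auto)
qed

primrec Clear_upto :: "nat \<Rightarrow> com" where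
  "Clear_upto 0 = Skip"
| "Clear_upto (Suc m) = Seq (Clear_upto m) (Clear (Suc m))"

lemma runs_Clear_upto:
  assumes "\<And>r. length (s r) \<le> L"
  shows "runs (Clear_upto m) s (m * (2 * L + 1) + 2) (\<lambda>r. if 0 < r \<and> r \<le> m then [] else s r)"
proof (induction m)
  case 0
  have "(\<lambda>r. if 0 < r \<and> r \<le> 0 then [] else s r) = s" by auto
  then show ?case using runs_Skip[of s] by (simp add: numeral_2_eq_2)
next
  case (Suc m)
  let ?s = "\<lambda>m r. if 0 < r \<and> r \<le> m then [] else s r"
  have "runs (Clear (Suc m)) (?s m) (2 * L + 1) (?s (Suc m))"
    by (rule runs_weaken[OF runs_Clear]) (use assms[of "Suc m"] in \<open>auto simp: le_Suc_eq\<close>)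
  from runs_Seq[OF Suc this] show ?case
    unfolding Clear_upto.simps by (rule runs_weaken) auto
qed

section \<open>An instance as a header followed by one stream of rationals\<close>

definition tokens :: "inst \<Rightarrow> rat list" where
  "tokens I = list_of_vec (vec_a I) @ list_of_vec (vec_b I) @
     concat (mat_to_list (mat_A I)) @ concat (mat_to_list (mat_W I)) @ concat (mat_to_list (B_const I)) @
     concat (map (\<lambda>M. concat (mat_to_list M)) (B_coef I)) @
     concat (map (\<lambda>M. concat (mat_to_list M)) (T_coef I))"

lemma enc_inst_tokens:
  "enc_inst I = enc_dim (n_x I) @ enc_dim (n_u I) @ enc_dim (n_y I) @
     enc_dim (m_x I) @ enc_dim (m_u I) @ enc_dim (m_y I) @ enc_nat (bound_R I) @
     concat (map enc_rat (tokens I))"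
proof -
  have "concat (map enc_mat Ms) = concat (map enc_rat (concat (map (\<lambda>M. concat (mat_to_list M)) Ms)))" for Ms
    by (induction Ms) (simp_all add: enc_mat_def)
  then show ?thesis by (simp add: enc_inst_def tokens_def enc_vec_def enc_mat_def)
qed

text \<open>
  A variable denotes the height of its stack, so variable 2 is the length of the encoded bound
  and not the bound itself.
\<close>

definition regs :: "inst \<Rightarrow> nat \<Rightarrow> nat \<Rightarrow> nat" where
  "regs I K = (\<lambda>_. 0)(0 := length (concat (map enc_rat (tokens I))), 2 := length (enc_nat (bound_R I)),
     3 := n_x I, 4 := n_u I, 5 := n_y I, 6 := m_x I, 7 := m_u I, 8 := m_y I, 9 := K)"

text \<open>Unary dimensions become register heights at once. The bound is read in reverse, so it
  passes through register 10 to arrive in register 2 in its original order.\<close>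

definition Parse :: com where
  "Parse = Seq (Seq (Seq (Seq (Seq (Seq (Seq (Read_dim 0 3 10) (Read_dim 0 4 10)) (Read_dim 0 5 10))
     (Read_dim 0 6 10)) (Read_dim 0 7 10)) (Read_dim 0 8 10)) (Read_nat 0 10 11)) (Move 10 2)"

lemma runs_Parse:
  assumes "s 0 = enc_inst I" "\<And>r. r \<notin> {0, 9} \<Longrightarrow> s r = []" "length (enc_inst I) = n"
  shows "runs Parse s (44 * n + 71)
    (s(0 := concat (map enc_rat (tokens I)), 2 := enc_nat (bound_R I),
       3 := replicate (n_x I) True, 4 := replicate (n_u I) True, 5 := replicate (n_y I) True,
       6 := replicate (m_x I) True, 7 := replicate (m_u I) True, 8 := replicate (m_y I) True))"
proof -
  note e = enc_inst_tokens[of I]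
  let ?w8 = "enc_nat (bound_R I) @ concat (map enc_rat (tokens I))"
  let ?w7 = "enc_dim (m_y I) @ ?w8" let ?w6 = "enc_dim (m_u I) @ ?w7" let ?w5 = "enc_dim (m_x I) @ ?w6"
  let ?w4 = "enc_dim (n_y I) @ ?w5" let ?w3 = "enc_dim (n_u I) @ ?w4"
  let ?s1 = "s(0 := ?w3, 3 := replicate (n_x I) True)"
  let ?s2 = "?s1(0 := ?w4, 4 := replicate (n_u I) True)"
  let ?s3 = "?s2(0 := ?w5, 5 := replicate (n_y I) True)"
  let ?s4 = "?s3(0 := ?w6, 6 := replicate (m_x I) True)"
  let ?s5 = "?s4(0 := ?w7, 7 := replicate (m_u I) True)"
  let ?s6 = "?s5(0 := ?w8, 8 := replicate (m_y I) True)"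
  let ?s7 = "?s6(0 := concat (map enc_rat (tokens I)), 10 := rev (enc_nat (bound_R I)))"
  have dim: "runs (Read_dim 0 b 10) t (5 * n + 10) (t(0 := w, b := replicate k True))"
    if "t 0 = enc_dim k @ w" "length (t 0) \<le> n" "t b = []" "t 10 = []" "b \<noteq> 0" "b \<noteq> 10" for t b k w
    by (rule runs_weaken[OF runs_Read_dim]) (use that in auto)
  have 1: "runs (Read_dim 0 3 10) s (5 * n + 10) ?s1"
    by (rule dim) (use assms e in auto)
  have 2: "runs (Read_dim 0 4 10) ?s1 (5 * n + 10) ?s2"
    by (rule dim) (use assms e in auto)
  have 3: "runs (Read_dim 0 5 10) ?s2 (5 * n + 10) ?s3"
    by (rule dim) (use assms e in auto)
  have 4: "runs (Read_dim 0 6 10) ?s3 (5 * n + 10) ?s4"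
    by (rule dim) (use assms e in auto)
  have 5: "runs (Read_dim 0 7 10) ?s4 (5 * n + 10) ?s5"
    by (rule dim) (use assms e in auto)
  have 6: "runs (Read_dim 0 8 10) ?s5 (5 * n + 10) ?s6"
    by (rule dim) (use assms e in auto)
  have 7: "runs (Read_nat 0 10 11) ?s6 (10 * n + 10) ?s7"
    by (rule runs_weaken[OF runs_Read_nat]) (use assms e in auto)
  have 8: "runs (Move 10 2) ?s7 (4 * n + 1) (?s7(10 := [], 2 := enc_nat (bound_R I)))"
    by (rule runs_weaken[OF runs_Move]) (use assms e in auto)
  show ?thesis unfolding Parse_def
    by (rule runs_weaken[OF runs_Seq[OF runs_Seq[OF runs_Seq[OF runs_Seq[OF runs_Seq[OF runs_Seq[OF
      runs_Seq[OF 1 2] 3] 4] 5] 6] 7] 8]]) (use assms in \<open>auto simp: fun_eq_iff\<close>)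
qed

text \<open>The value \<open>K I\<close> is supplied by an arbitrary polynomial-time program, which
  may ruin the input and leave garbage. The input is therefore saved above its registers and brought
  back afterwards. Writing \<open>K I\<close> in unary into register 9 is affordable because of the
  polynomial bound \<open>q\<close>.\<close>

theorem polytime_den:
  assumes f: "polytime_on (enc_inst ` D) f" "\<And>I. I \<in> D \<Longrightarrow> f (enc_inst I) = enc_nat (K I)"
    and K: "\<And>I. I \<in> D \<Longrightarrow> K I \<le> poly q (length (enc_inst I))"
    and S: "swf S 10" "\<And>I. I \<in> D \<Longrightarrow> g (enc_inst I) = den S (tokens I) (bound_R I) 10 (regs I (K I))"
  shows "polytime_on (enc_inst ` D) g"
proof -
  obtain c p where c: "\<And>w. w \<in> enc_inst ` D \<Longrightarrow> \<exists>t s. exec c ((\<lambda>_. [])(0 := w)) t s \<and> s 0 = f w \<and> t \<le> poly p (length w)"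
    using f(1) unfolding polytime_on_def by blast
  obtain m0 where m0: "regs_below c m0" using ex_regs_below by blast
  \<comment> \<open>The summand 12 keeps registers 9 and 10, which \<open>Unary\<close> uses while
    the input is still saved in \<open>Suc m\<close>, distinct from the saved copy and from the
    scratch register \<open>m + 2\<close>.\<close>
  define m where "m = m0 + 12"
  have m: "regs_below c (Suc m)" "12 \<le> m"
    using regs_below_mono[OF m0, of "Suc m"] by (simp_all add: m_def)
  define prog where "prog = Seq (Seq (Seq (Seq (Seq (Seq (Seq (Seq (Seq (Seq
    (Copy 0 (Suc m) (m + 2)) c) (Clear_upto m)) (Move 0 (m + 2))) (Unary (m + 2) 9 10))
    (Move (Suc m) (m + 2))) (Move (m + 2) 0)) Parse) (stmt_com S 10)) (Clear 0)) (Move 1 0)"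
  define L where "L n = n + poly p n" for n
  define B where "B n = n + poly q n" for n
  define T where "T n = (10 * n + 2) + poly p n + (m * (2 * L n + 1) + 2) + (4 * L n + 1)
    + (poly q n * (7 * poly q n + 8) + 2) + (4 * n + 1) + (4 * n + 1) + (44 * n + 71)
    + stime S (B n) + (2 * n + 1) + (4 * stime S (B n) + 1)" for n
  have "poly_bounded T"
    unfolding T_def L_def B_def
    by (intro poly_bounded_intros poly_bounded_comp[OF poly_bounded_stime])
  then obtain pT where pT: "\<And>n. T n \<le> poly pT n"
    unfolding poly_bounded_def by blast
  have "\<exists>s. runs prog ((\<lambda>_. [])(0 := w)) (T (length w)) s \<and> s 0 = g w" if w: "w \<in> enc_inst ` D" for w
  proof -
    from w obtain I where I: "I \<in> D" "w = enc_inst I" by blast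
    let ?n = "length w"
    let ?s0 = "(\<lambda>_. [])(0 := w)"
    let ?s1 = "?s0(Suc m := w)"
    have 1: "runs (Copy 0 (Suc m) (m + 2)) ?s0 (10 * ?n + 2) ?s1"
      by (rule runs_weaken[OF runs_Copy]) (use m in auto)
    obtain s where s: "runs c ?s0 (poly p ?n) s" "s 0 = enc_nat (K I)"
      using c[OF w] f(2)[OF I(1)] I(2) unfolding runs_def by fastforce
    have "(\<lambda>r. if r < Suc m then ?s0 r else ?s1 r) = ?s1" by auto
    with runs_frame[OF s(1) m(1), of ?s1]
    have 2: "runs c ?s1 (poly p ?n) (\<lambda>r. if r < Suc m then s r else ?s1 r)" by simp
    let ?s2 = "\<lambda>r. if r < Suc m then s r else ?s1 r"
    \<comment> \<open>What the unknown program leaves behind is bounded only through its running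
      time; this pays for clearing it.\<close>
    have L: "length (s r) \<le> L ?n" for r
      using runs_length[OF s(1), of r] by (auto simp: L_def split: if_splits)
    have L': "length (?s2 r) \<le> L ?n" for r
      using L[of r] by (auto simp: L_def)
    let ?s3 = "(\<lambda>_. [])(0 := enc_nat (K I), Suc m := w)"
    have 3: "runs (Clear_upto m) ?s2 (m * (2 * L ?n + 1) + 2) ?s3"
      by (rule runs_weaken[OF runs_Clear_upto[OF L']]) (use s(2) in \<open>auto simp: fun_eq_iff\<close>)
    let ?s4 = "(\<lambda>_. [])(Suc m := w, m + 2 := rev (enc_nat (K I)))"
    have 4: "runs (Move 0 (m + 2)) ?s3 (4 * L ?n + 1) ?s4"
      by (rule runs_weaken[OF runs_Move]) (use L[of 0] s(2) in \<open>auto simp: fun_eq_iff\<close>)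
    let ?s5 = "(\<lambda>_. [])(Suc m := w, 9 := replicate (K I) True)"
    have KI: "K I \<le> poly q ?n" using K[OF I(1)] I(2) by simp
    have 5: "runs (Unary (m + 2) 9 10) ?s4 (poly q ?n * (7 * poly q ?n + 8) + 2) ?s5"
    proof (rule runs_weaken[OF runs_Unary])
      show "K I * (7 * K I + 8) + 2 \<le> poly q ?n * (7 * poly q ?n + 8) + 2"
        using KI by (intro add_mono mult_mono) auto
    qed (use m in \<open>auto simp: fun_eq_iff\<close>)
    let ?s6 = "(\<lambda>_. [])(m + 2 := rev w, 9 := replicate (K I) True)"
    have 6: "runs (Move (Suc m) (m + 2)) ?s5 (4 * ?n + 1) ?s6"
      by (rule runs_weaken[OF runs_Move]) (use m in \<open>auto simp: fun_eq_iff\<close>)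
    let ?s7 = "(\<lambda>_::nat. [])(0 := w, 9 := replicate (K I) True)"
    have 7: "runs (Move (m + 2) 0) ?s6 (4 * ?n + 1) ?s7"
      by (rule runs_weaken[OF runs_Move]) (use m in \<open>auto simp: fun_eq_iff\<close>)
    let ?s8 = "(?s7 :: stacks)(0 := concat (map enc_rat (tokens I)), 2 := enc_nat (bound_R I),
       3 := replicate (n_x I) True, 4 := replicate (n_u I) True, 5 := replicate (n_y I) True,
       6 := replicate (m_x I) True, 7 := replicate (m_u I) True, 8 := replicate (m_y I) True)"
    have 8: "runs Parse ?s7 (44 * ?n + 71) ?s8"
      by (rule runs_Parse) (use I(2) in auto)
    let ?s9 = "?s8(1 := rev (g w))"
    have "runs (stmt_com S 10) ?s8 (stime S (B ?n))
        (?s8(1 := rev (den S (tokens I) (bound_R I) 10 (regs I (K I))) @ ?s8 (1 :: nat)))"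
    proof (rule runs_stmt_com)
      show "length (?s8 v) = regs I (K I) v" if "v < 10" "v \<noteq> 1" for v
        using that by (simp add: regs_def)
      show "regs I (K I) v \<le> B ?n" if "v < 10" "v \<noteq> 1" for v
        using that KI I(2) unfolding enc_inst_tokens[of I]
        by (simp add: regs_def B_def enc_dim_def)
    qed (use S(1) in auto)
    then have 9: "runs (stmt_com S 10) ?s8 (stime S (B ?n)) ?s9"
      using S(2)[OF I(1)] I(2) by simp
    have len: "length (g w) \<le> stime S (B ?n)"
      using runs_length[OF 9, of 1] by simp
    have 10: "runs (Clear 0) ?s9 (2 * ?n + 1) (?s9(0 := []))"
      by (rule runs_weaken[OF runs_Clear]) (use I(2) enc_inst_tokens[of I] in auto)
    have 11: "runs (Move 1 0) (?s9(0 := [])) (4 * stime S (B ?n) + 1) (?s9(1 := [], 0 := g w))"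
      by (rule runs_weaken[OF runs_Move]) (use len in \<open>auto simp: fun_eq_iff\<close>)
    have "runs prog ?s0 (T ?n) (?s9(1 := [], 0 := g w))"
      unfolding prog_def T_def
      by (rule runs_Seq[OF runs_Seq[OF runs_Seq[OF runs_Seq[OF runs_Seq[OF runs_Seq[OF runs_Seq[OF
        runs_Seq[OF runs_Seq[OF runs_Seq[OF 1 2] 3] 4] 5] 6] 7] 8] 9] 10] 11])
    then show ?thesis by (intro exI conjI) (assumption, simp)
  qed
  then show ?thesis
    unfolding polytime_on_def runs_def
    by (intro exI[of _ prog] exI[of _ pT]) (use pT in \<open>blast intro: le_trans\<close>)
qed

text \<open>Constructions that do not involve \<open>K\<close> are run with the constant value 1 in
  its place.\<close>

lemma polytime_const: "polytime_on D (\<lambda>_. w)"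
proof -
  have "runs (Seq (Clear 0) (Push_list (rev w) 0)) ((\<lambda>_. [])(0 := v))
      (poly [:length w + 3, 2:] (length v)) ((\<lambda>_. [])(0 := w))" for v
    by (rule runs_weaken[OF runs_Seq[OF runs_Clear runs_Push_list]]) (auto simp: fun_eq_iff)
  then show ?thesis
    unfolding polytime_on_def runs_def
    by (intro exI[of _ "Seq (Clear 0) (Push_list (rev w) 0)"] exI[of _ "[:length w + 3, 2:]"])
      (metis fun_upd_same)
qed

section \<open>Access to the data of an instance\<close>

lemma concat_uniform:
  assumes "\<And>xs. xs \<in> set xss \<Longrightarrow> length xs = n"
  shows "length (concat xss) = length xss * n"
    and "i < length xss \<Longrightarrow> j < n \<Longrightarrow> concat xss ! (i * n + j) = xss ! i ! j"
proof -
  show "length (concat xss) = length xss * n" using assms by (induction xss) auto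
  show "i < length xss \<Longrightarrow> j < n \<Longrightarrow> concat xss ! (i * n + j) = xss ! i ! j"
    using assms
  proof (induction xss arbitrary: i)
    case (Cons xs xss)
    then show ?case by (cases i) (auto simp: nth_append add.assoc)
  qed simp
qed

lemma length_concat_mat_to_list:
  "M \<in> carrier_mat m n \<Longrightarrow> length (concat (mat_to_list M)) = m * n"
  by (subst concat_uniform(1)[where n = n]) (auto simp: mat_to_list_def)

lemma nth_concat_mat_to_list:
  assumes "M \<in> carrier_mat m n" "i < m" "j < n"
  shows "concat (mat_to_list M) ! (i * n + j) = M $$ (i, j)"
  using assms by (subst concat_uniform(2)) (auto simp: mat_to_list_def)

lemma mult_add_less: "i < m \<Longrightarrow> j < n \<Longrightarrow> i * n + j < m * (n :: nat)"
proof -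
  assume "i < m" "j < n"
  then have "i * n + j < Suc i * n" "Suc i * n \<le> m * n" by (simp, intro mult_right_mono) auto
  then show ?thesis by simp
qed

lemma nth_concat_mats:
  assumes "set Ms \<subseteq> carrier_mat m n" "l < length Ms" "i < m" "j < n"
  shows "concat (map (\<lambda>M. concat (mat_to_list M)) Ms) ! (l * (m * n) + (i * n + j)) = (Ms ! l) $$ (i, j)"
proof -
  have u: "length xs = m * n" if "xs \<in> set (map (\<lambda>M. concat (mat_to_list M)) Ms)" for xs
    using that assms(1) length_concat_mat_to_list by auto
  have "Ms ! l \<in> carrier_mat m n" using assms(1,2) nth_mem by blast
  then show ?thesis
    using concat_uniform(2)[of "map (\<lambda>M. concat (mat_to_list M)) Ms" "m * n" l "i * n + j", OF u] assms mult_add_less[OF assms(3,4)]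
    by (simp add: nth_concat_mat_to_list)
qed

lemma length_concat_mats:
  assumes "set Ms \<subseteq> carrier_mat m n"
  shows "length (concat (map (\<lambda>M. concat (mat_to_list M)) Ms)) = length Ms * (m * n)"
  by (subst concat_uniform(1)[where n = "m * n"]) (use assms length_concat_mat_to_list in auto)

section \<open>Addresses of the data within the stream\<close>

definition dims :: "inst \<Rightarrow> (nat \<Rightarrow> nat) \<Rightarrow> bool" where
  "dims I \<sigma> \<longleftrightarrow> \<sigma> 3 = n_x I \<and> \<sigma> 4 = n_u I \<and> \<sigma> 5 = n_y I \<and> \<sigma> 6 = m_x I \<and> \<sigma> 7 = m_u I \<and> \<sigma> 8 = m_y I"

lemma dims_regs: "dims I (regs I K)"
  by (simp add: dims_def regs_def)

text \<open>Loop registers lie above the dimension registers, so the dimensions survive under any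
  nesting of loops; as a rewrite rule this settles the side conditions of
  \<open>den_Put\<close>.\<close>

lemma dims_upd [simp]: "8 < d \<Longrightarrow> dims I (\<sigma>(d := x)) \<longleftrightarrow> dims I \<sigma>"
  by (simp add: dims_def)

text \<open>Together with the six definitions that follow: the offsets at which the successive
  blocks of \<open>tokens\<close> begin, computed from the dimension registers.\<close>

definition "pos_b = Var 6"
definition "pos_A = Plus pos_b (Var 7)"
definition "pos_W = Plus pos_A (Times (Var 6) (Var 3))"
definition "pos_B0 = Plus pos_W (Times (Var 8) (Var 5))"
definition "pos_B = Plus pos_B0 (Times (Var 7) (Var 4))"
definition "pos_T = Plus pos_B (Times (Var 3) (Times (Var 7) (Var 4)))"
definition "pos_end = Plus pos_T (Times (Var 4) (Times (Var 8) (Var 3)))"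

lemmas pos_defs = pos_b_def pos_A_def pos_W_def pos_B0_def pos_B_def pos_T_def pos_end_def

definition "Put_a i = Token i"
definition "Put_b i = Token (Plus pos_b i)"
definition "Put_A i j = Token (Plus pos_A (Plus (Times i (Var 3)) j))"
definition "Put_W i j = Token (Plus pos_W (Plus (Times i (Var 5)) j))"
definition "Put_B0 i k = Token (Plus pos_B0 (Plus (Times i (Var 4)) k))"
definition "Put_B l i k = Token (Plus pos_B (Plus (Times l (Times (Var 7) (Var 4))) (Plus (Times i (Var 4)) k)))"
definition "Put_T l i j = Token (Plus pos_T (Plus (Times l (Times (Var 8) (Var 3))) (Plus (Times i (Var 3)) j)))"

lemmas Put_defs = Put_a_def Put_b_def Put_A_def Put_W_def Put_B0_def Put_B_def Put_T_def

lemma den_Token: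
  assumes "neval e \<sigma> < length qs" "qs ! neval e \<sigma> = q"
  shows "den (Token e) qs R d \<sigma> = enc_rat q"
  using assms by (simp add: take_Suc_conv_app_nth hd_drop_conv_nth flip: One_nat_def)
    (metis Cons_nth_drop_Suc One_nat_def append.right_neutral concat.simps list.map take0 take_Suc_Cons)

context
  fixes I \<sigma>
  assumes wf: "wf_inst I" and dims: "dims I \<sigma>"
begin

private lemma
  len: "dim_vec (vec_a I) = m_x I" "dim_vec (vec_b I) = m_u I"
    "length (concat (mat_to_list (mat_A I))) = m_x I * n_x I"
    "length (concat (mat_to_list (mat_W I))) = m_y I * n_y I"
    "length (concat (mat_to_list (B_const I))) = m_u I * n_u I"
    "length (concat (map (\<lambda>M. concat (mat_to_list M)) (B_coef I))) = n_x I * (m_u I * n_u I)"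
    "length (concat (map (\<lambda>M. concat (mat_to_list M)) (T_coef I))) = n_u I * (m_y I * n_x I)"
  using wf length_concat_mats[of "B_coef I" "m_u I" "n_u I"] length_concat_mats[of "T_coef I" "m_y I" "n_x I"]
  by (auto simp: wf_inst_def length_concat_mat_to_list)

lemma length_tokens: "length (tokens I) = neval pos_end \<sigma>"
  using dims by (simp add: tokens_def len pos_defs dims_def)

lemma den_Put_a: "neval i \<sigma> < m_x I \<Longrightarrow> den (Put_a i) (tokens I) R d \<sigma> = enc_rat (vec_a I $ neval i \<sigma>)"
  unfolding Put_defs using dims wf
  by (intro den_Token) (auto simp: tokens_def len nth_append dims_def wf_inst_def)

lemma den_Put_b: "neval i \<sigma> < m_u I \<Longrightarrow> den (Put_b i) (tokens I) R d \<sigma> = enc_rat (vec_b I $ neval i \<sigma>)"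
  unfolding Put_defs pos_defs using dims wf
  by (intro den_Token) (auto simp: tokens_def len nth_append dims_def wf_inst_def)

lemma den_Put_A:
  assumes "neval i \<sigma> < m_x I" "neval j \<sigma> < n_x I"
  shows "den (Put_A i j) (tokens I) R d \<sigma> = enc_rat (mat_A I $$ (neval i \<sigma>, neval j \<sigma>))"
  unfolding Put_defs pos_defs using dims wf mult_add_less[OF assms] assms
  by (intro den_Token) (auto simp: tokens_def len nth_append dims_def wf_inst_def nth_concat_mat_to_list)

lemma den_Put_W:
  assumes "neval i \<sigma> < m_y I" "neval j \<sigma> < n_y I"
  shows "den (Put_W i j) (tokens I) R d \<sigma> = enc_rat (mat_W I $$ (neval i \<sigma>, neval j \<sigma>))"
  unfolding Put_defs pos_defs using dims wf mult_add_less[OF assms] assms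
  by (intro den_Token) (auto simp: tokens_def len nth_append dims_def wf_inst_def nth_concat_mat_to_list)

lemma den_Put_B0:
  assumes "neval i \<sigma> < m_u I" "neval j \<sigma> < n_u I"
  shows "den (Put_B0 i j) (tokens I) R d \<sigma> = enc_rat (B_const I $$ (neval i \<sigma>, neval j \<sigma>))"
  unfolding Put_defs pos_defs using dims wf mult_add_less[OF assms] assms
  by (intro den_Token) (auto simp: tokens_def len nth_append dims_def wf_inst_def nth_concat_mat_to_list)

lemma den_Put_B:
  assumes "neval l \<sigma> < n_x I" "neval i \<sigma> < m_u I" "neval j \<sigma> < n_u I"
  shows "den (Put_B l i j) (tokens I) R d \<sigma> = enc_rat ((B_coef I ! neval l \<sigma>) $$ (neval i \<sigma>, neval j \<sigma>))"
  unfolding Put_defs pos_defs using dims wf mult_add_less[OF assms(1) mult_add_less[OF assms(2,3)]] assms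
  by (intro den_Token) (auto simp: tokens_def len nth_append dims_def wf_inst_def nth_concat_mats)

lemma den_Put_T:
  assumes "neval l \<sigma> < n_u I" "neval i \<sigma> < m_y I" "neval j \<sigma> < n_x I"
  shows "den (Put_T l i j) (tokens I) R d \<sigma> = enc_rat ((T_coef I ! neval l \<sigma>) $$ (neval i \<sigma>, neval j \<sigma>))"
  unfolding Put_defs pos_defs using dims wf mult_add_less[OF assms(1) mult_add_less[OF assms(2,3)]] assms
  by (intro den_Token) (auto simp: tokens_def len nth_append dims_def wf_inst_def nth_concat_mats)

end

lemmas den_Put = den_Put_a den_Put_b den_Put_A den_Put_W den_Put_B0 den_Put_B den_Put_T

definition "Put_dim e = For e (Emit [True]) ;; Emit [False]"

lemma den_Put_dim: "den (Put_dim e) qs R d \<sigma> = enc_dim (neval e \<sigma>)"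
  by (simp add: Put_dim_def enc_dim_def map_replicate_const)

definition "IfEq a b S S' = IfZ (Plus (Minus a b) (Minus b a)) S S'"

lemma den_IfEq: "den (IfEq a b S S') qs R d \<sigma> =
    (if neval a \<sigma> = neval b \<sigma> then den S qs R d \<sigma> else den S' qs R d \<sigma>)"
  by (auto simp: IfEq_def)

lemma enc_mat_mat:
  "enc_mat (mat m n f) = concat (map (\<lambda>i. concat (map (\<lambda>j. enc_rat (f (i, j))) [0..<n])) [0..<m])"
proof -
  have "concat (map h (concat xss)) = concat (map (\<lambda>xs. concat (map h xs)) xss)" for xss and h :: "rat \<Rightarrow> bool list"
    by (induction xss) auto
  then show ?thesis
    by (auto simp: enc_mat_def mat_to_list_def intro!: arg_cong[where f = concat])
qed

lemma enc_vec_vec: "enc_vec (vec n f) = concat (map (\<lambda>i. enc_rat (f i)) [0..<n])"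
  by (auto simp: enc_vec_def list_of_vec_map intro!: arg_cong[where f = concat])

text \<open>The function on words is specified through the inverse of the injective encoding, but it
  is computed without decoding, as \<open>S\<close> prints the new code directly. Injectivity of
  \<open>enc\<close> on \<open>D\<close> ensures that a code determines its answer.\<close>

lemma reduces_to_den:
  assumes "polytime_on (enc_inst ` instances U) f" "\<And>I. I \<in> instances U \<Longrightarrow> f (enc_inst I) = enc_nat (K I)"
    and "\<And>I. I \<in> instances U \<Longrightarrow> K I \<le> poly q (length (enc_inst I))"
    and "swf S 10" "\<And>I. I \<in> instances U \<Longrightarrow> den S (tokens I) (bound_R I) 10 (regs I (K I)) = enc (G I)"
    and "inj_on enc D" "\<And>I. I \<in> instances U \<Longrightarrow> G I \<in> D" "\<And>I. I \<in> instances U \<Longrightarrow> P I \<longleftrightarrow> Q (G I)"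
  shows "problem enc_inst (instances U) P \<le>\<^sub>p problem enc D Q"
proof -
  define g where "g w = enc (G (inv_into (instances U) enc_inst w))" for w
  have inj: "inj_on enc_inst (instances U)"
    by (rule inj_on_subset[OF inj_on_enc_inst]) (auto simp: instances_def)
  have g: "g (enc_inst I) = enc (G I)" if "I \<in> instances U" for I
    using that inj by (simp add: g_def)
  have "polytime_on (enc_inst ` instances U) g"
    by (rule polytime_den[OF assms(1-4)]) (simp_all add: g assms(5))
  moreover have "enc_inst I \<in> enc_inst ` {I \<in> instances U. P I} \<longleftrightarrow> P I" if "I \<in> instances U" for I
    using that inj by (auto dest: inj_onD)
  moreover have "enc J \<in> enc ` {J \<in> D. Q J} \<longleftrightarrow> Q J" if "J \<in> D" for J
    using that assms(6) by (auto dest: inj_onD)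
  ultimately show ?thesis
    unfolding reduces_to_def problem_def fst_conv snd_conv using assms(7,8)
    by (intro exI[of _ g] conjI ballI) (simp, elim imageE, simp add: g, elim imageE, simp add: g)
qed


section \<open>The sets of an instance in coordinates\<close>

lemma X_cont_iff:
  assumes "wf_inst I"
  shows "x \<in> X_cont I \<longleftrightarrow> x \<in> box I (n_x I) \<and>
    (\<forall>i<m_x I. (\<Sum>j<n_x I. of_rat (mat_A I $$ (i, j)) * x $ j) \<le> of_rat (vec_a I $ i))"
  using assms
  by (auto simp: X_cont_def wf_inst_def box_def less_eq_vec_def scalar_prod_def atLeast0LessThan)

lemma U_cont_iff:
  assumes "wf_inst I"
  shows "u \<in> U_cont I x \<longleftrightarrow> u \<in> box I (n_u I) \<and>
    (\<forall>i<m_u I. (\<Sum>k<n_u I. B_of I x $$ (i, k) * u $ k) \<le> of_rat (vec_b I $ i))"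
  using assms
  by (auto simp: U_cont_def B_of_def wf_inst_def box_def less_eq_vec_def scalar_prod_def atLeast0LessThan)

text \<open>Row \<open>i\<close> of \<open>T(u) x\<close>. For a fixed \<open>x\<close>, all that a
  row sees of \<open>u\<close> is this single number, so the possible \<open>u\<close> are linearly
  ordered by how hard they make the row.\<close>

definition lhs :: "inst \<Rightarrow> real vec \<Rightarrow> real vec \<Rightarrow> nat \<Rightarrow> real" where
  "lhs I x u i = (\<Sum>j<n_x I. (\<Sum>k<n_u I. of_rat ((T_coef I ! k) $$ (i, j)) * u $ k) * x $ j)"

lemma Y_cont_iff:
  assumes "wf_inst I" "x \<in> carrier_vec (n_x I)"
  shows "y \<in> Y_cont I x u \<longleftrightarrow> y \<in> box I (n_y I) \<and>
    (\<forall>i<m_y I. lhs I x u i + (\<Sum>j<n_y I. of_rat (mat_W I $$ (i, j)) * y $ j) \<le> 0)"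
  using assms
  by (auto simp: Y_cont_def T_of_def lhs_def wf_inst_def box_def less_eq_vec_def scalar_prod_def atLeast0LessThan)

lemma X_set_carrier: "x \<in> X_set X I \<Longrightarrow> x \<in> carrier_vec (n_x I)"
  by (cases X) (auto simp: X_cont_def box_def)

lemma Y_set_carrier: "y \<in> Y_set Y I x u \<Longrightarrow> y \<in> carrier_vec (n_y I)"
  by (cases Y) (auto simp: Y_cont_def box_def)

lemma X_set_iff:
  assumes "wf_inst I"
  shows "x \<in> X_set X I \<longleftrightarrow> x \<in> box I (n_x I) \<and> (X = Xd \<longrightarrow> x \<in> int_vecs (n_x I)) \<and>
    (\<forall>i<m_x I. (\<Sum>j<n_x I. of_rat (mat_A I $$ (i, j)) * x $ j) \<le> of_rat (vec_a I $ i))"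
  by (cases X) (auto simp: X_cont_iff[OF assms])

lemma U_set_iff:
  assumes "wf_inst I"
  shows "u \<in> U_set U I x \<longleftrightarrow> u \<in> box I (n_u I) \<and> (U \<in> {Ud, Udx} \<longrightarrow> u \<in> int_vecs (n_u I)) \<and>
    (\<forall>i<m_u I. (\<Sum>k<n_u I. B_of I x $$ (i, k) * u $ k) \<le> of_rat (vec_b I $ i))"
  by (cases U) (auto simp: U_cont_iff[OF assms])

lemma Y_set_iff:
  assumes "wf_inst I" "x \<in> carrier_vec (n_x I)"
  shows "y \<in> Y_set Y I x u \<longleftrightarrow> y \<in> box I (n_y I) \<and> (Y = Yd \<longrightarrow> y \<in> int_vecs (n_y I)) \<and>
    (\<forall>i<m_y I. lhs I x u i + (\<Sum>j<n_y I. of_rat (mat_W I $$ (i, j)) * y $ j) \<le> 0)"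
  by (cases Y) (auto simp: Y_cont_iff[OF assms])

section \<open>From two stages to finite adaptability\<close>

lemma less_power_length_bits: "n < 2 ^ length (bits n)"
proof (induction n rule: bits.induct)
  case (1 n)
  then show ?case by (cases "n = 0") (auto simp: bits.simps[of n] bits.simps[of 0])
qed

lemma bits_power2: "bits (2 ^ l) = replicate l False @ [True]"
proof (induction l)
  case 0
  then show ?case by (simp add: bits.simps[of "Suc 0"] bits.simps[of 0])
next
  case (Suc l)
  then show ?case by (simp add: bits.simps[of "2 * 2 ^ l"])
qed

lemma card_box_int:
  shows "finite (box I n \<inter> int_vecs n)" "card (box I n \<inter> int_vecs n) \<le> (bound_R I + 1) ^ n"
proof -
  let ?L = "{xs. set xs \<subseteq> {..bound_R I} \<and> length xs = n}"
  have "box I n \<inter> int_vecs n \<subseteq> (\<lambda>xs. vec_of_list (map real xs)) ` ?L"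
  proof
    fix v assume v: "v \<in> box I n \<inter> int_vecs n"
    define xs where "xs = map (\<lambda>i. nat \<lfloor>v $ i\<rfloor>) [0..<n]"
    have *: "real (nat \<lfloor>v $ i\<rfloor>) = v $ i" "nat \<lfloor>v $ i\<rfloor> \<le> bound_R I" if "i < n" for i
      using v that by (auto simp: box_def int_vecs_def le_floor_iff nat_le_iff floor_le_iff elim!: Ints_cases)
    have "v = vec_of_list (map real xs)"
    proof (rule eq_vecI)
      show "v $ i = vec_of_list (map real xs) $ i" if "i < dim_vec (vec_of_list (map real xs))" for i
        using that *(1)[of i] by (simp add: vec_of_list_index xs_def)
    qed (use v in \<open>auto simp: xs_def box_def\<close>)
    moreover have "xs \<in> ?L" using * by (auto simp: xs_def)
    ultimately show "v \<in> (\<lambda>xs. vec_of_list (map real xs)) ` ?L" by (rule image_eqI)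
  qed
  note sub = this
  have L: "finite ?L" "card ?L = (bound_R I + 1) ^ n"
    using finite_lists_length_eq[of "{..bound_R I}"] card_lists_length_eq[of "{..bound_R I}" n] by simp_all
  show "finite (box I n \<inter> int_vecs n)"
    using finite_subset[OF sub finite_imageI[OF L(1)]] .
  show "card (box I n \<inter> int_vecs n) \<le> (bound_R I + 1) ^ n"
    using surj_card_le[OF L(1) sub] unfolding L(2) .
qed

text \<open>The code of \<open>R\<close> has at least as many bits as \<open>R\<close>, so
  \<open>R + 1\<close> is at most 2 to the power of its length. The exponent
  \<open>n_u I + n_y I\<close> serves integral \<open>u\<close> and integral \<open>y\<close> alike.
  Only the code length of \<open>R\<close> is available as a counter, and a power of two is printed
  by a loop over its exponent.\<close>

definition policy_count :: "inst \<Rightarrow> nat" where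
  "policy_count I = 2 ^ (length (enc_nat (bound_R I)) * (n_u I + n_y I))"

lemma card_box_int_le_policy_count:
  assumes "n \<le> n_u I + n_y I"
  shows "card (box I n \<inter> int_vecs n) \<le> policy_count I"
proof -
  have "length (concat (map (\<lambda>b. [True, b]) bs)) = 2 * length bs" for bs :: "bool list"
    by (induction bs) auto
  then have "length (bits (bound_R I)) \<le> length (enc_nat (bound_R I))"
    by (simp add: enc_nat_def)
  then have "bound_R I < 2 ^ length (enc_nat (bound_R I))"
    using less_power_length_bits[of "bound_R I"] power_increasing[of _ _ "2::nat"] by (metis less_le_trans one_le_numeral)
  then have "(bound_R I + 1) ^ n \<le> (2 ^ length (enc_nat (bound_R I))) ^ n"
    by (intro power_mono) auto
  also have "\<dots> \<le> policy_count I"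
    using assms unfolding policy_count_def power_mult[symmetric] by (intro power_increasing mult_left_mono) auto
  finally show ?thesis using card_box_int(2)[of I n] by simp
qed

text \<open>A choice function \<open>f\<close> of second-stage answers has few values: integral
  \<open>u\<close> make its domain a set of integral box points, integral \<open>y\<close> its
  range. Listing the values gives the policies. Conversely, a policy that covers \<open>u\<close> is
  an answer to \<open>u\<close>.\<close>

lemma two_stage_iff_adaptability:
  assumes wf: "wf_inst I" and "U = Ud \<or> U = Udx \<or> Y = Yd"
  shows "two_stage_yes X U Y I \<longleftrightarrow> adaptability_yes (policy_count I) X U Y I"
proof
  assume "adaptability_yes (policy_count I) X U Y I"
  then show "two_stage_yes X U Y I"
    unfolding adaptability_yes_def two_stage_yes_def by blast
next
  assume "two_stage_yes X U Y I"
  then obtain x where x: "x \<in> X_set X I" "\<forall>u \<in> U_set U I x. \<exists>y. y \<in> Y_set Y I x u"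
    unfolding two_stage_yes_def by blast
  then obtain f where f: "\<And>u. u \<in> U_set U I x \<Longrightarrow> f u \<in> Y_set Y I x u" by metis
  obtain n and Z :: "real vec set" where Z: "Z = f ` U_set U I x" "finite Z" "card Z \<le> policy_count I"
  proof -
    consider "U \<in> {Ud, Udx}" | "Y = Yd" using assms(2) by auto
    then show ?thesis
    proof cases
      case 1
      then have sub: "U_set U I x \<subseteq> box I (n_u I) \<inter> int_vecs (n_u I)"
        using U_set_iff[OF wf] by auto
      have fin: "finite (U_set U I x)" by (rule finite_subset[OF sub card_box_int(1)])
      have "card (U_set U I x) \<le> policy_count I"
        using card_mono[OF card_box_int(1) sub] card_box_int_le_policy_count[of "n_u I" I] by simp
      then show ?thesis using that fin card_image_le[OF fin, of f] by fastforce
    next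
      case 2
      then have sub: "f ` U_set U I x \<subseteq> box I (n_y I) \<inter> int_vecs (n_y I)"
        using f by (auto simp: Y_cont_def)
      have "card (f ` U_set U I x) \<le> policy_count I"
        using card_mono[OF card_box_int(1) sub] card_box_int_le_policy_count[of "n_y I" I] by simp
      then show ?thesis using that finite_subset[OF sub card_box_int(1)] by blast
    qed
  qed
  obtain h where h: "bij_betw h {0..<card Z} Z" using ex_bij_betw_nat_finite[OF Z(2)] by blast
  \<comment> \<open>Policies are numbered from 1 but \<open>h\<close> from 0; surplus indices get
    the zero vector, which has the required dimension.\<close>
  define ys where "ys k = (if k - 1 < card Z then h (k - 1) else 0\<^sub>v (n_y I))" for k
  have "Z \<subseteq> carrier_vec (n_y I)" using f Z(1) Y_set_carrier by blast
  then have "ys k \<in> carrier_vec (n_y I)" for k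
    using bij_betwE[OF h] by (auto simp: ys_def)
  moreover have "ys ` {1..policy_count I} \<inter> Y_set Y I x u \<noteq> {}" if u: "u \<in> U_set U I x" for u
  proof -
    obtain i where "i < card Z" "h i = f u"
      using h u Z(1) unfolding bij_betw_def by (metis atLeastLessThan_iff imageE image_eqI)
    then have "ys (Suc i) = f u" "Suc i \<in> {1..policy_count I}" using Z(3) by (auto simp: ys_def)
    then show ?thesis using f[OF u] by (metis IntI empty_iff imageI)
  qed
  ultimately show "adaptability_yes (policy_count I) X U Y I"
    unfolding adaptability_yes_def using x(1) by blast
qed

text \<open>The first two statements print a power of two: a zero digit per round, then the digit
  one and the end mark. The rest reprints the instance.\<close>

definition policy_count_prog :: stmt where
  "policy_count_prog = For (Times (Var 2) (Plus (Var 4) (Var 5))) (Emit [True, False]) ;; Emit [True, True, False] ;;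
     Put_dim (Var 3) ;; Put_dim (Var 4) ;; Put_dim (Var 5) ;; Put_dim (Var 6) ;; Put_dim (Var 7) ;; Put_dim (Var 8) ;;
     Bound ;; For pos_end (Token (Var 11))"

lemma den_policy_count_prog:
  assumes wf: "wf_inst I"
  shows "den policy_count_prog (tokens I) (bound_R I) 10 (regs I K) = enc_inst_K (I, policy_count I)"
proof -
  have "concat (map (\<lambda>i. concat (map enc_rat (take 1 (drop i qs)))) [0..<length qs]) = concat (map enc_rat qs)" for qs
  proof (induction qs)
    case (Cons q qs)
    have "[0..<length (q # qs)] = 0 # map Suc [0..<length qs]"
      by (simp add: upt_conv_Cons map_Suc_upt del: upt_Suc)
    with Cons show ?case by (simp add: o_def)
  qed simp
  moreover have "enc_nat (2 ^ l) = concat (replicate l [True, False]) @ [True, True, False]" for l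
    by (simp add: enc_nat_def bits_power2)
  moreover have "regs I K 2 = length (enc_nat (bound_R I))" by (simp add: regs_def)
  moreover note length_tokens[OF wf dims_regs[of I K], symmetric] dims_regs[of I K, unfolded dims_def]
  ultimately show ?thesis
    by (simp add: policy_count_prog_def den_Put_dim enc_inst_K_def enc_inst_tokens policy_count_def
      map_replicate_const)
qed

lemma two_stage_le_finite_adaptability:
  assumes "U = Ud \<or> U = Udx \<or> Y = Yd"
  shows "Bounded_Two_Stage X U Y \<le>\<^sub>p Bounded_Finite_Adaptability X U Y"
  unfolding Bounded_Two_Stage_def Bounded_Finite_Adaptability_def
proof (rule reduces_to_den[where K = "\<lambda>_. 1" and q = "[:1:]" and G = "\<lambda>I. (I, policy_count I)" and S = policy_count_prog,
    OF polytime_const])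
  show "swf policy_count_prog 10"
    by (simp add: policy_count_prog_def pos_defs Put_dim_def)
  show "inj_on enc_inst_K (instances U \<times> {1..})"
    by (rule inj_on_subset[OF inj_on_enc_inst_K]) (auto simp: instances_def)
qed (auto simp: instances_def policy_count_def den_policy_count_prog two_stage_iff_adaptability[OF _ assms])


section \<open>From one policy to several policies\<close>

lemma concat_map_upt_mult:
  "concat (map f [0..<m * n]) = concat (map (\<lambda>p. concat (map (\<lambda>i. f (p * n + i)) [0..<n])) [0..<m])"
proof (induction m)
  case (Suc m)
  have "[0..<Suc m * n] = [0..<m * n] @ map (\<lambda>i. m * n + i) [0..<n]"
    using upt_add_eq_append[of 0 "m * n" n] map_add_upt[of "m * n" n] by (simp add: add.commute)
  with Suc show ?case by (simp add: o_def)
qed simp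

lemma concat_map_nth: "length xs = n \<Longrightarrow> concat (map f xs) = concat (map (\<lambda>i. f (xs ! i)) [0..<n])"
  by (metis (no_types, lifting) map_map map_nth map_eq_conv comp_apply)

lemma enc_vec_carrier:
  assumes "v \<in> carrier_vec n"
  shows "enc_vec v = concat (map (\<lambda>i. enc_rat (v $ i)) [0..<n])"
proof -
  have "v = vec n (\<lambda>i. v $ i)" using assms by auto
  then have "enc_vec v = enc_vec (vec n (\<lambda>i. v $ i))" by simp
  then show ?thesis unfolding enc_vec_vec .
qed

lemma enc_mat_carrier:
  assumes "M \<in> carrier_mat m n"
  shows "enc_mat M = concat (map (\<lambda>i. concat (map (\<lambda>j. enc_rat (M $$ (i, j))) [0..<n])) [0..<m])"
proof -
  have "M = mat m n (\<lambda>(i, j). M $$ (i, j))" using assms by auto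
  then have "enc_mat M = enc_mat (mat m n (\<lambda>(i, j). M $$ (i, j)))" by simp
  then show ?thesis unfolding enc_mat_mat by simp
qed

lemma all_less_mult: "(\<forall>i < m * n. P i) \<longleftrightarrow> (\<forall>p < m. \<forall>k < n. P (p * n + k :: nat))"
proof
  assume *: "\<forall>p < m. \<forall>k < n. P (p * n + k)"
  show "\<forall>i < m * n. P i"
  proof (intro allI impI)
    fix i assume "i < m * n"
    moreover from this have "0 < n" by (cases n) auto
    ultimately have "i div n < m" "i mod n < n" by (simp_all add: less_mult_imp_div_less)
    with * have "P (i div n * n + i mod n)" by blast
    then show "P i" by simp
  qed
qed (simp add: mult_add_less)

lemma sum_lessThan_add: "(\<Sum>c < m + n. f c) = (\<Sum>c < m. f c) + (\<Sum>k < n. f (m + k :: nat))"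
  by (induction n) (simp_all add: add.assoc)

lemma sum_lessThan_mult: "(\<Sum>c < m * n. f c) = (\<Sum>q < m. \<Sum>k < n. f (q * n + k :: nat))"
  by (induction m) (simp_all add: sum_lessThan_add add.commute[of n])

lemma finite_argmax:
  fixes f :: "'a \<Rightarrow> 'b :: linorder"
  assumes "finite A" "A \<noteq> {}"
  shows "\<exists>z\<in>A. \<forall>u\<in>A. f u \<le> f z"
proof -
  have "Max (f ` A) \<in> f ` A" using assms by simp
  then obtain z where "z \<in> A" "Max (f ` A) = f z" by auto
  then show ?thesis using assms(1) Max_ge[of "f ` A"] by (intro bexI[of _ z]) auto
qed

lemma all_less_add: "(\<forall>i < m + n. P i) \<longleftrightarrow> (\<forall>i < m. P i) \<and> (\<forall>c < n. P (m + c :: nat))"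
  by (metis add_less_cancel_left le_Suc_ex linorder_not_less trans_less_add1)

text \<open>The block-diagonal matrix with \<open>m_y I\<close> copies of \<open>M\<close>:
  quotients name the block, remainders the position inside it. The programs have no division; there,
  nested loops supply quotient and remainder as separate indices.\<close>

definition blocks :: "inst \<Rightarrow> rat mat \<Rightarrow> rat mat" where
  "blocks I M = mat (m_y I * m_u I) (m_y I * n_u I) (\<lambda>(i, k).
     if i div m_u I = k div n_u I then M $$ (i mod m_u I, k mod n_u I) else 0)"

text \<open>Each row of the second-stage constraints gets its own copy of \<open>u\<close>.\<close>

definition copies :: "inst \<Rightarrow> inst" where
  "copies I = I \<lparr>n_u := m_y I * n_u I, m_u := m_y I * m_u I,
     vec_b := vec (m_y I * m_u I) (\<lambda>i. vec_b I $ (i mod m_u I)),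
     B_const := blocks I (B_const I), B_coef := map (blocks I) (B_coef I),
     T_coef := map (\<lambda>q. mat (m_y I) (n_x I) (\<lambda>(i, j).
       if i = q div n_u I then (T_coef I ! (q mod n_u I)) $$ (i, j) else 0)) [0..<m_y I * n_u I]\<rparr>"

text \<open>Loops start at depth 10, so the indices of nested loops are \<open>Var 11\<close>,
  \<open>Var 13\<close>, \<open>Var 15\<close> and so on, from the outermost inwards.\<close>

definition copies_prog :: stmt where
  "copies_prog = Put_dim (Var 3) ;; Put_dim (Times (Var 8) (Var 4)) ;; Put_dim (Var 5) ;;
     Put_dim (Var 6) ;; Put_dim (Times (Var 8) (Var 7)) ;; Put_dim (Var 8) ;; Bound ;;
     For (Var 6) (Put_a (Var 11)) ;;
     For (Var 8) (For (Var 7) (Put_b (Var 13))) ;;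
     For (Var 6) (For (Var 3) (Put_A (Var 11) (Var 13))) ;;
     For (Var 8) (For (Var 5) (Put_W (Var 11) (Var 13))) ;;
     For (Var 8) (For (Var 7) (For (Var 8) (For (Var 4)
       (IfEq (Var 11) (Var 15) (Put_B0 (Var 13) (Var 17)) (Emit (enc_rat 0)))))) ;;
     For (Var 3) (For (Var 8) (For (Var 7) (For (Var 8) (For (Var 4)
       (IfEq (Var 13) (Var 17) (Put_B (Var 11) (Var 15) (Var 19)) (Emit (enc_rat 0))))))) ;;
     For (Var 8) (For (Var 4) (For (Var 8) (For (Var 3)
       (IfEq (Var 15) (Var 11) (Put_T (Var 13) (Var 15) (Var 17)) (Emit (enc_rat 0))))))"

context
  fixes I
  assumes wf: "wf_inst I"
begin

private lemma wf':
  "vec_a I \<in> carrier_vec (m_x I)" "vec_b I \<in> carrier_vec (m_u I)" "mat_A I \<in> carrier_mat (m_x I) (n_x I)"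
  "mat_W I \<in> carrier_mat (m_y I) (n_y I)" "B_const I \<in> carrier_mat (m_u I) (n_u I)"
  "length (B_coef I) = n_x I" "length (T_coef I) = n_u I"
  using wf by (auto simp: wf_inst_def)

lemma den_copies_prog:
  assumes dims: "dims I \<sigma>"
  shows "den copies_prog (tokens I) (bound_R I) 10 \<sigma> = enc_inst (copies I)"
proof -
  have \<sigma>: "\<sigma> 3 = n_x I" "\<sigma> 4 = n_u I" "\<sigma> 5 = n_y I" "\<sigma> 6 = m_x I" "\<sigma> 7 = m_u I" "\<sigma> 8 = m_y I"
    using dims by (simp_all add: dims_def)
  note put = den_Put[OF wf] den_IfEq dims \<sigma>
  have "enc_vec (vec (m_y I * m_u I) (\<lambda>i. vec_b I $ (i mod m_u I))) =
      den (For (Var 8) (For (Var 7) (Put_b (Var 13)))) (tokens I) (bound_R I) 10 \<sigma>"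
    by (simp add: enc_vec_vec concat_map_upt_mult put cong: list.map_cong_simp if_cong)
  moreover have "enc_mat (blocks I (B_const I)) = den (For (Var 8) (For (Var 7) (For (Var 8) (For (Var 4)
       (IfEq (Var 11) (Var 15) (Put_B0 (Var 13) (Var 17)) (Emit (enc_rat 0)))))))
       (tokens I) (bound_R I) 10 \<sigma>"
    by (simp add: blocks_def enc_mat_mat concat_map_upt_mult put if_distrib[of enc_rat] cong: list.map_cong_simp if_cong)
  moreover have "concat (map enc_mat (map (blocks I) (B_coef I))) = den (For (Var 3) (For (Var 8) (For (Var 7) (For (Var 8) (For (Var 4)
       (IfEq (Var 13) (Var 17) (Put_B (Var 11) (Var 15) (Var 19)) (Emit (enc_rat 0))))))))
       (tokens I) (bound_R I) 10 \<sigma>"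
    by (simp add: blocks_def enc_mat_mat concat_map_nth[OF wf'(6)] o_def concat_map_upt_mult put if_distrib[of enc_rat] cong: list.map_cong_simp if_cong)
  moreover have "concat (map enc_mat (T_coef (copies I))) = den (For (Var 8) (For (Var 4) (For (Var 8) (For (Var 3)
       (IfEq (Var 15) (Var 11) (Put_T (Var 13) (Var 15) (Var 17)) (Emit (enc_rat 0)))))))
       (tokens I) (bound_R I) 10 \<sigma>"
    by (simp add: copies_def enc_mat_mat o_def concat_map_upt_mult put if_distrib[of enc_rat] cong: list.map_cong_simp if_cong)
  ultimately show ?thesis
    by (simp add: enc_inst_def copies_prog_def copies_def den_Put_dim enc_vec_carrier[OF wf'(1)]
      enc_mat_carrier[OF wf'(3)] enc_mat_carrier[OF wf'(4)] put cong: list.map_cong_simp if_cong)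
qed

lemma wf_copies: "wf_inst (copies I)"
  using wf by (auto simp: wf_inst_def copies_def blocks_def)

lemma B_of_copies:
  assumes "i < m_y I * m_u I" "k < m_y I * n_u I"
  shows "B_of (copies I) x $$ (i, k) =
    (if i div m_u I = k div n_u I then B_of I x $$ (i mod m_u I, k mod n_u I) else 0)"
proof -
  have "0 < m_u I" "0 < n_u I" using assms by (auto intro: gr0I)
  then show ?thesis using assms wf'(6) by (simp add: B_of_def copies_def blocks_def)
qed

lemma constant_B_copies: "constant_B I \<Longrightarrow> constant_B (copies I)"
  unfolding constant_B_def
proof (intro ballI)
  fix x x' :: "real vec" assume B: "\<forall>x \<in> carrier_vec (n_x I). \<forall>x' \<in> carrier_vec (n_x I). B_of I x = B_of I x'"
    and x: "x \<in> carrier_vec (n_x (copies I))" "x' \<in> carrier_vec (n_x (copies I))"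
  have "n_x (copies I) = n_x I" by (simp add: copies_def)
  then have eq: "B_of I x = B_of I x'" using bspec[OF bspec[OF B, of x], of x'] x by simp
  show "B_of (copies I) x = B_of (copies I) x'"
  proof (rule eq_matI)
    have d: "dim_row (B_of (copies I) z) = m_y I * m_u I" "dim_col (B_of (copies I) z) = m_y I * n_u I" for z
      by (simp_all add: B_of_def copies_def)
    then show "dim_row (B_of (copies I) x) = dim_row (B_of (copies I) x')"
      "dim_col (B_of (copies I) x) = dim_col (B_of (copies I) x')" by simp_all
    show "B_of (copies I) x $$ (i, k) = B_of (copies I) x' $$ (i, k)"
      if "i < dim_row (B_of (copies I) x')" "k < dim_col (B_of (copies I) x')" for i k
      using that B_of_copies[of i k x] B_of_copies[of i k x'] eq unfolding d by simp
  qed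
qed

definition block :: "nat \<Rightarrow> real vec \<Rightarrow> real vec" where
  "block p u = vec (n_u I) (\<lambda>k. u $ (p * n_u I + k))"

text \<open>Off-diagonal blocks vanish, so the uncertainty set becomes a power of the old one. This
  independence of the copies is what permits a different failure in every row.\<close>

lemma U_set_copies:
  "u \<in> U_set U (copies I) x \<longleftrightarrow> u \<in> carrier_vec (m_y I * n_u I) \<and> (\<forall>p < m_y I. block p u \<in> U_set U I x)"
proof -
  have "(\<Sum>c < m_y I * n_u I. B_of (copies I) x $$ (p * m_u I + i, c) * u $ c) =
     (\<Sum>k < n_u I. B_of I x $$ (i, k) * block p u $ k)" if "p < m_y I" "i < m_u I" for p i
  proof -
    have "(\<Sum>c < m_y I * n_u I. B_of (copies I) x $$ (p * m_u I + i, c) * u $ c) =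
      (\<Sum>q < m_y I. \<Sum>k < n_u I. B_of (copies I) x $$ (p * m_u I + i, q * n_u I + k) * u $ (q * n_u I + k))"
      by (rule sum_lessThan_mult)
    also have "\<dots> = (\<Sum>q < m_y I. if q = p then \<Sum>k < n_u I. B_of I x $$ (i, k) * u $ (q * n_u I + k) else 0)"
      using that by (intro sum.cong) (auto simp: B_of_copies mult_add_less)
    finally show ?thesis using that by (simp add: block_def)
  qed
  then show ?thesis
    unfolding U_set_iff[OF wf] U_set_iff[OF wf_copies]
    by (simp add: copies_def box_def int_vecs_def all_less_mult block_def) blast
qed

lemma lhs_copies:
  assumes "i < m_y I"
  shows "lhs (copies I) x u i = lhs I x (block i u) i"
proof -
  have "(\<Sum>c < m_y I * n_u I. real_of_rat ((T_coef (copies I) ! c) $$ (i, j)) * u $ c) =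
     (\<Sum>k < n_u I. of_rat ((T_coef I ! k) $$ (i, j)) * block i u $ k)" if "j < n_x I" for j
  proof -
    have "(\<Sum>c < m_y I * n_u I. real_of_rat ((T_coef (copies I) ! c) $$ (i, j)) * u $ c) =
      (\<Sum>q < m_y I. \<Sum>k < n_u I. real_of_rat ((T_coef (copies I) ! (q * n_u I + k)) $$ (i, j)) * u $ (q * n_u I + k))"
      by (rule sum_lessThan_mult)
    also have "\<dots> = (\<Sum>q < m_y I. if q = i then \<Sum>k < n_u I. of_rat ((T_coef I ! k) $$ (i, j)) * u $ (q * n_u I + k) else 0)"
      using that assms by (intro sum.cong) (auto simp: copies_def mult_add_less)
    finally show ?thesis using assms by (simp add: block_def)
  qed
  then show ?thesis by (simp add: lhs_def copies_def)
qed

lemma X_set_copies: "X_set X (copies I) = X_set X I"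
  unfolding X_set_iff[OF wf] X_set_iff[OF wf_copies] set_eq_iff by (simp add: copies_def box_def)

lemma Y_set_copies:
  assumes "x \<in> carrier_vec (n_x I)"
  shows "y \<in> Y_set Y (copies I) x u \<longleftrightarrow> y \<in> box I (n_y I) \<and> (Y = Yd \<longrightarrow> y \<in> int_vecs (n_y I)) \<and>
    (\<forall>i<m_y I. lhs I x (block i u) i + (\<Sum>j<n_y I. of_rat (mat_W I $$ (i, j)) * y $ j) \<le> 0)"
proof -
  have "n_x (copies I) = n_x I" "m_y (copies I) = m_y I" "n_y (copies I) = n_y I" "mat_W (copies I) = mat_W I"
    "box (copies I) = box I"
    by (auto simp: copies_def box_def)
  then show ?thesis
    using Y_set_iff[OF wf_copies, of x] assms by (simp add: lhs_copies)
qed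

text \<open>
  If every policy fails for some \<open>u\<close>, then all of them fail for a single choice of the copies:
  the copy for row \<open>i\<close> is the worst one for row \<open>i\<close> among the finitely many failures.
\<close>

lemma adaptability_copies:
  assumes K: "1 \<le> K"
  shows "adaptability_yes 1 X U Y I \<longleftrightarrow> adaptability_yes K X U Y (copies I)"
proof
  assume "adaptability_yes 1 X U Y I"
  then obtain x ys where x: "x \<in> X_set X I" and y: "ys (1 :: nat) \<in> carrier_vec (n_y I)"
    "\<And>u. u \<in> U_set U I x \<Longrightarrow> ys 1 \<in> Y_set Y I x u"
    unfolding adaptability_yes_def by auto
  note xc = X_set_carrier[OF x]
  \<comment> \<open>Without second-stage rows there are no copies, and the new uncertainty set
    consists of the empty vector even if the old one is empty and says nothing about
    \<open>ys 1\<close>. The zero vector is feasible then.\<close>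
  define z where "z = (if m_y I = 0 then 0\<^sub>v (n_y I) else ys 1)"
  have "z \<in> Y_set Y (copies I) x u" if u: "u \<in> U_set U (copies I) x" for u
  proof (cases "m_y I = 0")
    case True
    then show ?thesis using xc by (simp add: Y_set_copies z_def box_def int_vecs_def)
  next
    case False
    have "ys 1 \<in> Y_set Y I x (block p u)" if "p < m_y I" for p
      using u y(2) that U_set_copies by blast
    with False show ?thesis
      unfolding Y_set_copies[OF xc] Y_set_iff[OF wf xc] z_def by auto
  qed
  moreover have "z \<in> carrier_vec (n_y (copies I))"
    using y(1) by (simp add: z_def copies_def)
  ultimately show "adaptability_yes K X U Y (copies I)"
    unfolding adaptability_yes_def X_set_copies
    using x K by (intro bexI[of _ x] exI[of _ "\<lambda>_. z"]) (auto simp: image_constant_conv)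
next
  assume "adaptability_yes K X U Y (copies I)"
  then obtain x ys where x: "x \<in> X_set X I" and ys: "\<And>k. k \<in> {1..K} \<Longrightarrow> ys k \<in> carrier_vec (n_y I)"
    and cover: "\<And>u. u \<in> U_set U (copies I) x \<Longrightarrow> \<exists>k\<in>{1..K}. ys k \<in> Y_set Y (copies I) x u"
  proof -
    have "n_y (copies I) = n_y I" by (simp add: copies_def)
    with \<open>adaptability_yes K X U Y (copies I)\<close> obtain x ys where
      "x \<in> X_set X I" "\<forall>k\<in>{1..K}. ys k \<in> carrier_vec (n_y I)"
      "\<forall>u\<in>U_set U (copies I) x. ys ` {1..K} \<inter> Y_set Y (copies I) x u \<noteq> {}"
      unfolding adaptability_yes_def X_set_copies by auto
    then show ?thesis by (intro that[of x ys]) blast+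
  qed
  note xc = X_set_carrier[OF x]
  obtain k where "k \<in> {1..K}" "\<forall>u\<in>U_set U I x. ys k \<in> Y_set Y I x u"
  proof (rule ccontr)
    assume "\<not> thesis"
    with that obtain v where v: "\<And>k. k \<in> {1..K} \<Longrightarrow> v k \<in> U_set U I x"
      "\<And>k. k \<in> {1..K} \<Longrightarrow> ys k \<notin> Y_set Y I x (v k)" by metis
    have "finite (v ` {1..K})" "v ` {1..K} \<noteq> {}" using K by auto
    then have "\<exists>z\<in>v ` {1..K}. \<forall>u\<in>v ` {1..K}. lhs I x u i \<le> lhs I x z i" for i
      by (rule finite_argmax)
    then obtain g where g: "\<And>i. g i \<in> v ` {1..K}"
      "\<And>i k. k \<in> {1..K} \<Longrightarrow> lhs I x (v k) i \<le> lhs I x (g i) i" by (metis imageI)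
    have gU: "g i \<in> U_set U I x" for i using g(1)[of i] v(1) by auto
    then have gc: "g i \<in> carrier_vec (n_u I)" for i using U_set_iff[OF wf] by (auto simp: box_def)
    define w where "w = vec (m_y I * n_u I) (\<lambda>c. g (c div n_u I) $ (c mod n_u I))"
    have bw: "block p w = g p" if "p < m_y I" for p
      by (rule eq_vecI) (use that gc[of p] in \<open>auto simp: block_def w_def mult_add_less\<close>)
    have "w \<in> U_set U (copies I) x"
      unfolding U_set_copies using bw gU by (simp add: w_def)
    then obtain k where k: "k \<in> {1..K}" "ys k \<in> Y_set Y (copies I) x w" using cover by blast
    \<comment> \<open>The contribution of \<open>mat_W I\<close> to a row is independent of
      \<open>u\<close>, so passing from the worst failure \<open>g i\<close> to \<open>v k\<close>
      can only lower the left-hand side.\<close>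
    then have "ys k \<in> Y_set Y I x (v k)"
      unfolding Y_set_copies[OF xc] Y_set_iff[OF wf xc] using bw g(2)[OF k(1)] by (smt (verit))
    with v(2) k(1) show False by blast
  qed
  then show "adaptability_yes 1 X U Y I"
    unfolding adaptability_yes_def using x ys by (intro bexI[of _ x] exI[of _ "\<lambda>_. ys k"]) auto
qed

end

lemma one_adaptability_le_K_adaptability:
  assumes "\<And>I. I \<in> instances U \<Longrightarrow> 1 \<le> K I"
  shows "Bounded_K_Adaptability (\<lambda>_. 1) X U Y \<le>\<^sub>p Bounded_K_Adaptability K X U Y"
  unfolding Bounded_K_Adaptability_def
proof (rule reduces_to_den[where K = "\<lambda>_. 1" and q = "[:1:]" and G = copies and S = copies_prog,
    OF polytime_const])
  show "swf copies_prog 10"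
    by (simp add: copies_prog_def Put_defs pos_defs Put_dim_def IfEq_def)
  show "inj_on enc_inst (instances U)"
    by (rule inj_on_subset[OF inj_on_enc_inst]) (auto simp: instances_def)
  show inst: "copies I \<in> instances U" if "I \<in> instances U" for I
    using that by (auto simp: instances_def wf_copies constant_B_copies)
  show "adaptability_yes 1 X U Y I \<longleftrightarrow> adaptability_yes (K (copies I)) X U Y (copies I)"
    if "I \<in> instances U" for I
    using that adaptability_copies[OF _ assms[OF inst[OF that]]] by (simp add: instances_def)
qed (auto simp: instances_def den_copies_prog dims_regs)

section \<open>From several policies to two stages\<close>

context
  fixes I :: inst and K :: nat
begin

private abbreviation "nc \<equiv> K * n_y I"

text \<open>The extra row bounds the last coordinate from below by \<open>R\<close>; the box
  supplies the other direction.\<close>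

definition select_A :: "rat mat" where
  "select_A = mat (Suc (m_x I)) (Suc (n_x I + nc)) (\<lambda>(i, j).
     if i < m_x I then if j < n_x I then mat_A I $$ (i, j) else 0
     else if j < n_x I + nc then 0 else -1)"

definition select_B0 :: "rat mat" where
  "select_B0 = mat (m_u I + 2) (Suc (n_u I)) (\<lambda>(i, k).
     if i < m_u I then if k < n_u I then B_const I $$ (i, k) else 0
     else if k < n_u I then 0 else if i = m_u I then 1 else -1)"

definition select_B :: "nat \<Rightarrow> rat mat" where
  "select_B l = mat (m_u I + 2) (Suc (n_u I)) (\<lambda>(i, k).
     if l < n_x I then if i < m_u I then if k < n_u I then (B_coef I ! l) $$ (i, k) else 0 else 0 else 0)"

text \<open>Below the original rows come two families indexed by \<open>k * n_y I + j\<close>, one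
  for each sign of \<open>y - v\<^sub>k\<close> in coordinate \<open>j\<close>, and a final row for
  the sum of the indicators. That row is scaled by \<open>R\<close>, because \<open>R\<close> and
  not 1 is the constant obtainable from the fixed coordinates.\<close>

definition select_W :: "rat mat" where
  "select_W = mat (Suc (m_y I + (nc + nc))) (n_y I + K) (\<lambda>(i, j).
     if i < m_y I then if j < n_y I then mat_W I $$ (i, j) else 0
     else if i < m_y I + nc then
       if j < n_y I then if j = (i - m_y I) mod n_y I then 1 else 0
       else if j = n_y I + (i - m_y I) div n_y I then of_nat (bound_R I) else 0
     else if i < m_y I + (nc + nc) then
       if j < n_y I then if j = (i - m_y I - nc) mod n_y I then -1 else 0
       else if j = n_y I + (i - m_y I - nc) div n_y I then of_nat (bound_R I) else 0
     else if j < n_y I then 0 else - of_nat (bound_R I))"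

text \<open>The stored policies and the constant \<open>R\<close> enter only through the coefficient
  of the last coordinate of \<open>u\<close>, which is fixed to 1; the constant is its product with
  the last coordinate of \<open>x\<close>.\<close>

definition select_T :: "nat \<Rightarrow> rat mat" where
  "select_T q = mat (Suc (m_y I + (nc + nc))) (Suc (n_x I + nc)) (\<lambda>(i, j).
     if q < n_u I then if i < m_y I then if j < n_x I then (T_coef I ! q) $$ (i, j) else 0 else 0
     else if i < m_y I then 0
     else if i < m_y I + nc then
       if j = n_x I + (i - m_y I) then -1 else if j = n_x I + nc then -1 else 0
     else if i < m_y I + (nc + nc) then
       if j = n_x I + (i - m_y I - nc) then 1 else if j = n_x I + nc then -1 else 0
     else if j = n_x I + nc then 1 else 0)"

text \<open>
  The first stage \<open>(x, v\<^sub>1, \<dots>, v\<^sub>K, x\<^sub>0)\<close> contains the policies \<open>v\<^sub>k\<close>, and \<open>x\<^sub>0\<close> is forced to be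
  the bound \<open>R\<close>. In \<open>(u, u\<^sub>0)\<close> the last coordinate is forced to be 1, so that \<open>u\<^sub>0 v\<^sub>k\<close> and
  \<open>u\<^sub>0 x\<^sub>0\<close> turn first-stage variables into terms of \<open>T(u) x\<close>. The second stage \<open>(y, z)\<close> is subject to
  \<open>\<bar>y - v\<^sub>k\<bar> + R z\<^sub>k \<le> R\<close> and \<open>R \<le> R (z\<^sub>1 + \<dots> + z\<^sub>K)\<close>, hence selects some \<open>y = v\<^sub>k\<close>.
\<close>

definition select :: inst where
  "select = \<lparr>n_x = Suc (n_x I + nc), n_u = Suc (n_u I), n_y = n_y I + K,
     m_x = Suc (m_x I), m_u = m_u I + 2, m_y = Suc (m_y I + (nc + nc)), bound_R = bound_R I,
     vec_a = vec (Suc (m_x I)) (\<lambda>i. if i < m_x I then vec_a I $ i else - of_nat (bound_R I)),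
     vec_b = vec (m_u I + 2) (\<lambda>i. if i < m_u I then vec_b I $ i else if i = m_u I then 1 else -1),
     mat_A = select_A, mat_W = select_W, B_const = select_B0,
     B_coef = map select_B [0..<Suc (n_x I + nc)], T_coef = map select_T [0..<Suc (n_u I)]\<rparr>"

end

section \<open>Printing the selection instance\<close>

definition "IfLess a b S S' = IfZ (Minus b a) S' S"

lemma den_IfLess: "den (IfLess a b S S') qs R d \<sigma> =
    (if neval a \<sigma> < neval b \<sigma> then den S qs R d \<sigma> else den S' qs R d \<sigma>)"
  by (auto simp: IfLess_def)

definition "Zero = Emit (enc_rat 0)"
definition "One = Emit (enc_rat 1)"
definition "MinusOne = Emit (enc_rat (-1))"

lemma den_constants:
  "den Zero qs R d \<sigma> = enc_rat 0" "den One qs R d \<sigma> = enc_rat 1" "den MinusOne qs R d \<sigma> = enc_rat (-1)"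
  by (simp_all add: Zero_def One_def MinusOne_def)

definition "PosR = Emit [False] ;; Bound ;; Emit (enc_int 1)"
text \<open>Zero is encoded without the sign bit, so \<open>R = 0\<close> has to be detected.
  Although \<open>R\<close> is not a counter, its code has length 1 exactly in that case.\<close>

definition "NegR = IfZ (Minus (Var 2) (Num 1)) (Emit [False]) (Emit [True]) ;; Bound ;; Emit (enc_int 1)"

lemma den_PosR: "den PosR qs R d \<sigma> = enc_rat (of_nat R)"
proof -
  have "quotient_of (of_nat R) = (int R, 1)" using quotient_of_int[of "int R"] by simp
  then show ?thesis by (simp add: PosR_def enc_rat_def enc_int_def)
qed

lemma den_NegR:
  assumes "\<sigma> 2 = length (enc_nat R)"
  shows "den NegR qs R d \<sigma> = enc_rat (- of_nat R)"
proof -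
  have "quotient_of (- of_nat R) = (- int R, 1)" using quotient_of_int[of "int R"]
    by (simp add: rat_uminus_code)
  moreover have "length (enc_nat R) \<le> Suc 0 \<longleftrightarrow> R = 0"
    by (cases "R = 0") (simp_all add: enc_nat_def bits.simps[of R] bits.simps[of 0])
  ultimately show ?thesis using assms by (simp add: NegR_def enc_rat_def enc_int_def)
qed

definition "NC = Times (Var 9) (Var 5)"
definition "NX = Plus (Plus (Var 3) NC) (Num 1)"
definition "NU = Plus (Var 4) (Num 1)"
definition "NY = Plus (Var 5) (Var 9)"
definition "MX = Plus (Var 6) (Num 1)"
definition "MU = Plus (Var 7) (Num 2)"
definition "MY = Plus (Plus (Var 8) (Plus NC NC)) (Num 1)"

lemmas size_defs = NC_def NX_def NU_def NY_def MX_def MU_def MY_def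

definition "select_a_prog = For MX (IfLess (Var 11) (Var 6) (Put_a (Var 11)) NegR)"
definition "select_b_prog = For MU (IfLess (Var 11) (Var 7) (Put_b (Var 11)) (IfEq (Var 11) (Var 7) One MinusOne))"
definition "select_A_prog = For MX (For NX (IfLess (Var 11) (Var 6)
   (IfLess (Var 13) (Var 3) (Put_A (Var 11) (Var 13)) Zero)
   (IfLess (Var 13) (Plus (Var 3) NC) Zero MinusOne)))"
text \<open>Entries in the two middle families of rows depend on quotient and remainder of the row
  index by \<open>n_y I\<close>; separate loops over \<open>k\<close> and \<open>j\<close> provide
  these as indices.\<close>

definition "select_W_prog =
   For (Var 8) (For NY (IfLess (Var 13) (Var 5) (Put_W (Var 11) (Var 13)) Zero)) ;;
   For (Var 9) (For (Var 5) (For NY (IfLess (Var 15) (Var 5)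
     (IfEq (Var 15) (Var 13) One Zero) (IfEq (Var 15) (Plus (Var 5) (Var 11)) PosR Zero)))) ;;
   For (Var 9) (For (Var 5) (For NY (IfLess (Var 15) (Var 5)
     (IfEq (Var 15) (Var 13) MinusOne Zero) (IfEq (Var 15) (Plus (Var 5) (Var 11)) PosR Zero)))) ;;
   For NY (IfLess (Var 11) (Var 5) Zero NegR)"
definition "select_B0_prog = For MU (For NU (IfLess (Var 11) (Var 7)
   (IfLess (Var 13) (Var 4) (Put_B0 (Var 11) (Var 13)) Zero)
   (IfLess (Var 13) (Var 4) Zero (IfEq (Var 11) (Var 7) One MinusOne))))"
definition "select_B_prog = For NX (For MU (For NU (IfLess (Var 11) (Var 3)
   (IfLess (Var 13) (Var 7) (IfLess (Var 15) (Var 4) (Put_B (Var 11) (Var 13) (Var 15)) Zero) Zero) Zero)))"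
definition "select_T_prog = For NU (For MY (For NX (IfLess (Var 11) (Var 4)
   (IfLess (Var 13) (Var 8) (IfLess (Var 15) (Var 3) (Put_T (Var 11) (Var 13) (Var 15)) Zero) Zero)
   (IfLess (Var 13) (Var 8) Zero
   (IfLess (Var 13) (Plus (Var 8) NC)
     (IfEq (Var 15) (Plus (Var 3) (Minus (Var 13) (Var 8))) MinusOne (IfEq (Var 15) (Plus (Var 3) NC) MinusOne Zero))
   (IfLess (Var 13) (Plus (Var 8) (Plus NC NC))
     (IfEq (Var 15) (Plus (Var 3) (Minus (Minus (Var 13) (Var 8)) NC)) One (IfEq (Var 15) (Plus (Var 3) NC) MinusOne Zero))
     (IfEq (Var 15) (Plus (Var 3) NC) One Zero)))))))"

definition "select_prog = Put_dim NX ;; Put_dim NU ;; Put_dim NY ;; Put_dim MX ;; Put_dim MU ;; Put_dim MY ;; Bound ;;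
   select_a_prog ;; select_b_prog ;; select_A_prog ;; select_W_prog ;; select_B0_prog ;; select_B_prog ;; select_T_prog"

lemma concat_map_upt_add:
  "concat (map f [0..<m + n]) = concat (map f [0..<m]) @ concat (map (\<lambda>i. f (m + i)) [0..<n])"
  by (induction n) simp_all

context
  fixes I :: inst and K :: nat
  assumes wf: "wf_inst I"
begin

lemma den_select_prog:
  assumes dims: "dims I \<sigma>" and K: "\<sigma> 9 = K" and R: "\<sigma> 2 = length (enc_nat (bound_R I))"
  shows "den select_prog (tokens I) (bound_R I) 10 \<sigma> = enc_inst (select I K)"
proof -
  have \<sigma>: "\<sigma> 3 = n_x I" "\<sigma> 4 = n_u I" "\<sigma> 5 = n_y I" "\<sigma> 6 = m_x I" "\<sigma> 7 = m_u I" "\<sigma> 8 = m_y I"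
    using dims by (simp_all add: dims_def)
  note put = den_Put[OF wf] den_IfEq den_IfLess dims \<sigma> K R den_constants den_PosR den_NegR size_defs if_distrib[of enc_rat]
  let ?den = "\<lambda>S. den S (tokens I) (bound_R I) 10 \<sigma>"
  have "enc_vec (vec_a (select I K)) = ?den select_a_prog"
    by (simp add: select_def select_a_prog_def enc_vec_vec put del: upt_Suc cong: list.map_cong_simp if_cong)
  moreover have "enc_vec (vec_b (select I K)) = ?den select_b_prog"
    by (simp add: select_def select_b_prog_def enc_vec_vec put del: upt_Suc cong: list.map_cong_simp if_cong)
  moreover have "enc_mat (select_A I K) = ?den select_A_prog"
    by (simp add: select_A_def select_A_prog_def enc_mat_mat put del: upt_Suc cong: list.map_cong_simp if_cong)
  moreover have "enc_mat (select_W I K) = ?den select_W_prog"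
    by (simp add: select_W_def select_W_prog_def enc_mat_mat put concat_map_upt_add concat_map_upt_mult mult_add_less
      cong: list.map_cong_simp if_cong)
  moreover have "enc_mat (select_B0 I) = ?den select_B0_prog"
    by (simp add: select_B0_def select_B0_prog_def enc_mat_mat put del: upt_Suc cong: list.map_cong_simp if_cong)
  moreover have "concat (map enc_mat (B_coef (select I K))) = ?den select_B_prog"
    by (simp add: select_def select_B_def select_B_prog_def enc_mat_mat put o_def del: upt_Suc cong: list.map_cong_simp if_cong)
  moreover have "concat (map enc_mat (T_coef (select I K))) = ?den select_T_prog"
    by (simp add: select_def select_T_def select_T_prog_def enc_mat_mat put o_def del: upt_Suc cong: list.map_cong_simp if_cong)
  ultimately show ?thesis
    by (simp add: enc_inst_def select_prog_def den_Put_dim select_def[of I K] K \<sigma> size_defs del: upt_Suc)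
qed

lemma wf_select: "wf_inst (select I K)"
  by (auto simp: wf_inst_def select_def select_A_def select_B0_def select_B_def select_W_def select_T_def)

section \<open>The feasible sets of the selection instance in terms of the original ones\<close>

definition x_part :: "real vec \<Rightarrow> real vec" where "x_part x = vec (n_x I) (\<lambda>j. x $ j)"
definition u_part :: "real vec \<Rightarrow> real vec" where "u_part u = vec (n_u I) (\<lambda>j. u $ j)"
definition y_part :: "real vec \<Rightarrow> real vec" where "y_part y = vec (n_y I) (\<lambda>j. y $ j)"

lemmas part_defs = x_part_def u_part_def y_part_def

lemma X_set_select:
  "x \<in> X_set X (select I K) \<longleftrightarrow> x \<in> carrier_vec (Suc (n_x I + K * n_y I)) \<and> x_part x \<in> X_set X I \<and>
    (\<forall>c < K * n_y I. 0 \<le> x $ (n_x I + c) \<and> x $ (n_x I + c) \<le> bound_R I \<and> (X = Xd \<longrightarrow> x $ (n_x I + c) \<in> \<int>)) \<and>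
    x $ (n_x I + K * n_y I) = bound_R I"
proof -
  show ?thesis
    unfolding X_set_iff[OF wf] X_set_iff[OF wf_select]
    by (simp add: select_def select_A_def box_def int_vecs_def part_defs all_less_add All_less_Suc sum_lessThan_add) 
      (auto simp: of_rat_minus)
qed

lemma B_of_select:
  assumes "i < m_u I + 2" "k < Suc (n_u I)"
  shows "B_of (select I K) x $$ (i, k) =
    (if i < m_u I then if k < n_u I then B_of I (x_part x) $$ (i, k) else 0
     else if k < n_u I then 0 else if i = m_u I then 1 else -1)"
  using assms
  by (simp add: B_of_def select_def select_B0_def select_B_def sum_lessThan_add part_defs of_rat_minus
      nth_append del: upt_Suc)

lemma constant_B_select:
  assumes "constant_B I" shows "constant_B (select I K)"
  unfolding constant_B_def
proof (intro ballI)
  fix x x' :: "real vec"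
  have "B_of I (x_part x) = B_of I (x_part x')"
    using assms unfolding constant_B_def by (auto simp: part_defs)
  note eq = this
  show "B_of (select I K) x = B_of (select I K) x'"
  proof (rule eq_matI)
    have d: "dim_row (B_of (select I K) z) = m_u I + 2" "dim_col (B_of (select I K) z) = Suc (n_u I)" for z
      by (simp_all add: B_of_def select_def)
    then show "dim_row (B_of (select I K) x) = dim_row (B_of (select I K) x')"
      "dim_col (B_of (select I K) x) = dim_col (B_of (select I K) x')" by simp_all
    show "B_of (select I K) x $$ (i, k) = B_of (select I K) x' $$ (i, k)"
      if "i < dim_row (B_of (select I K) x')" "k < dim_col (B_of (select I K) x')" for i k
      using that B_of_select[of i k x] B_of_select[of i k x'] eq unfolding d by simp
  qed
qed

text \<open>The coordinate fixed to 1 must lie in the box, so the new uncertainty set is empty for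
  \<open>R = 0\<close>.\<close>

lemma U_set_select:
  "u \<in> U_set U (select I K) x \<longleftrightarrow> u \<in> carrier_vec (Suc (n_u I)) \<and> u_part u \<in> U_set U I (x_part x) \<and>
     u $ n_u I = 1 \<and> 1 \<le> bound_R I"
proof -
  have s: "n_u (select I K) = Suc (n_u I)" "m_u (select I K) = Suc (Suc (m_u I))" "bound_R (select I K) = bound_R I"
    "vec_b (select I K) = vec (m_u I + 2) (\<lambda>i. if i < m_u I then vec_b I $ i else if i = m_u I then 1 else -1)"
    by (simp_all add: select_def)
  show ?thesis
    unfolding U_set_iff[OF wf] U_set_iff[OF wf_select]
    by (simp add: s box_def int_vecs_def part_defs All_less_Suc B_of_select[simplified] of_rat_minus) auto
qed


private lemma select_fields:
  "n_x (select I K) = Suc (n_x I + K * n_y I)" "n_u (select I K) = Suc (n_u I)" "n_y (select I K) = n_y I + K"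
  "m_y (select I K) = Suc (m_y I + (K * n_y I + K * n_y I))" "bound_R (select I K) = bound_R I"
  "mat_W (select I K) = select_W I K"
  by (simp_all add: select_def)

private abbreviation "last_T i j u \<equiv> of_rat (select_T I K (n_u I) $$ (i, j)) * (u $ n_u I)"

lemma T_select:
  assumes "i < Suc (m_y I + (K * n_y I + K * n_y I))" "j < Suc (n_x I + K * n_y I)"
  shows "(\<Sum>q < n_u (select I K). real_of_rat ((T_coef (select I K) ! q) $$ (i, j)) * u $ q) =
    (if i < m_y I \<and> j < n_x I then \<Sum>q < n_u I. of_rat ((T_coef I ! q) $$ (i, j)) * u_part u $ q else 0) + last_T i j u"
proof -
  have "T_coef (select I K) ! q = select_T I K q" if "q < Suc (n_u I)" for q
    using that by (simp add: select_def nth_append del: upt_Suc)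
  then show ?thesis
    using assms by (cases "i < m_y I"; cases "j < n_x I") (simp_all add: select_fields select_T_def part_defs)
qed

lemma lhs_select:
  "i < m_y I \<Longrightarrow> lhs (select I K) x u i = lhs I (x_part x) (u_part u) i"
  "c < K * n_y I \<Longrightarrow> lhs (select I K) x u (m_y I + c) =
     - (u $ n_u I * x $ (n_x I + c)) - u $ n_u I * x $ (n_x I + K * n_y I)"
  "c < K * n_y I \<Longrightarrow> lhs (select I K) x u (m_y I + (K * n_y I + c)) =
     u $ n_u I * x $ (n_x I + c) - u $ n_u I * x $ (n_x I + K * n_y I)"
  "lhs (select I K) x u (m_y I + (K * n_y I + K * n_y I)) = u $ n_u I * x $ (n_x I + K * n_y I)"
proof -
  have lhs: "lhs (select I K) x u i = (\<Sum>j < Suc (n_x I + K * n_y I).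
    ((if i < m_y I \<and> j < n_x I then \<Sum>q < n_u I. of_rat ((T_coef I ! q) $$ (i, j)) * u_part u $ q else 0) + last_T i j u) * x $ j)"
    if "i < Suc (m_y I + (K * n_y I + K * n_y I))" for i
    unfolding lhs_def select_fields(1) using that by (intro sum.cong refl) (simp add: T_select)
  note sums = sum_lessThan_add select_T_def if_distrib[of of_rat] if_distrib[of "\<lambda>t. t * _"]
    if_distrib[of "\<lambda>t. _ * t"] of_rat_minus algebra_simps
  show "i < m_y I \<Longrightarrow> lhs (select I K) x u i = lhs I (x_part x) (u_part u) i"
    by (simp add: lhs sum_lessThan_add select_T_def) (simp add: lhs_def part_defs)
  show "c < K * n_y I \<Longrightarrow> lhs (select I K) x u (m_y I + c) =
     - (u $ n_u I * x $ (n_x I + c)) - u $ n_u I * x $ (n_x I + K * n_y I)"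
    by (simp add: lhs sums cong: if_cong)
  show "c < K * n_y I \<Longrightarrow> lhs (select I K) x u (m_y I + (K * n_y I + c)) =
     u $ n_u I * x $ (n_x I + c) - u $ n_u I * x $ (n_x I + K * n_y I)"
    by (simp add: lhs sums cong: if_cong)
  show "lhs (select I K) x u (m_y I + (K * n_y I + K * n_y I)) = u $ n_u I * x $ (n_x I + K * n_y I)"
    by (simp add: lhs sums cong: if_cong)
qed

lemma W_select:
  "i < m_y I \<Longrightarrow> (\<Sum>j < n_y I + K. real_of_rat (select_W I K $$ (i, j)) * y $ j) =
     (\<Sum>j < n_y I. of_rat (mat_W I $$ (i, j)) * y_part y $ j)"
  "k < K \<Longrightarrow> j < n_y I \<Longrightarrow>
     (\<Sum>l < n_y I + K. real_of_rat (select_W I K $$ (m_y I + (k * n_y I + j), l)) * y $ l) =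
       y $ j + bound_R I * y $ (n_y I + k)"
  "k < K \<Longrightarrow> j < n_y I \<Longrightarrow>
     (\<Sum>l < n_y I + K. real_of_rat (select_W I K $$ (m_y I + (K * n_y I + (k * n_y I + j)), l)) * y $ l) =
       - y $ j + bound_R I * y $ (n_y I + k)"
  "(\<Sum>l < n_y I + K. real_of_rat (select_W I K $$ (m_y I + (K * n_y I + K * n_y I), l)) * y $ l) =
     - (bound_R I * (\<Sum>k < K. y $ (n_y I + k)))"
  using mult_add_less[of k K j "n_y I"]
  by (simp_all add: sum_lessThan_add select_W_def part_defs if_distrib[of of_rat] if_distrib[of "\<lambda>t. t * _"]
      of_rat_minus sum_distrib_left sum_negf cong: if_cong)

text \<open>With the fixed coordinates inserted, the bilinear terms of the extra rows become stored
  policy entries and the constant \<open>R\<close>, and rows of opposite sign merge into an absolute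
  value.\<close>

lemma Y_set_select:
  assumes x: "x \<in> carrier_vec (Suc (n_x I + K * n_y I))" "x $ (n_x I + K * n_y I) = bound_R I"
    and u: "u $ n_u I = 1"
  shows "y \<in> Y_set Yd (select I K) x u \<longleftrightarrow> y \<in> carrier_vec (n_y I + K) \<and>
    y_part y \<in> Y_set Yd I (x_part x) (u_part u) \<and>
    (\<forall>k < K. 0 \<le> y $ (n_y I + k) \<and> y $ (n_y I + k) \<le> bound_R I \<and> y $ (n_y I + k) \<in> \<int>) \<and>
    (\<forall>k < K. \<forall>j < n_y I. \<bar>y $ j - x $ (n_x I + (k * n_y I + j))\<bar> + bound_R I * y $ (n_y I + k) \<le> bound_R I) \<and>
    bound_R I \<le> bound_R I * (\<Sum>k < K. y $ (n_y I + k))"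
proof -
  have xp: "x_part x \<in> carrier_vec (n_x I)" by (simp add: part_defs)
  have abs: "\<bar>a - b\<bar> + c \<le> r \<longleftrightarrow> a + c \<le> b + r \<and> c \<le> a - b + r" for a b c r :: real by auto
  have row1: "lhs (select I K) x u (m_y I + (k * n_y I + j)) +
      (\<Sum>l < n_y I + K. real_of_rat (select_W I K $$ (m_y I + (k * n_y I + j), l)) * y $ l) =
      (y $ j + bound_R I * y $ (n_y I + k)) - (x $ (n_x I + (k * n_y I + j)) + bound_R I)"
    and row2: "lhs (select I K) x u (m_y I + (K * n_y I + (k * n_y I + j))) +
      (\<Sum>l < n_y I + K. real_of_rat (select_W I K $$ (m_y I + (K * n_y I + (k * n_y I + j)), l)) * y $ l) =
      bound_R I * y $ (n_y I + k) - (y $ j - x $ (n_x I + (k * n_y I + j)) + bound_R I)"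
    if "k < K" "j < n_y I" for k j
    using x(2) u that by (simp_all add: lhs_select W_select mult_add_less)
  have row3: "lhs (select I K) x u (m_y I + (K * n_y I + K * n_y I)) +
      (\<Sum>l < n_y I + K. real_of_rat (select_W I K $$ (m_y I + (K * n_y I + K * n_y I), l)) * y $ l) =
      bound_R I - bound_R I * (\<Sum>k < K. y $ (n_y I + k))"
    using x(2) u by (simp add: lhs_select W_select)
  have xs: "x \<in> carrier_vec (n_x (select I K))" using x(1) by (simp add: select_fields)
  show ?thesis
    unfolding Y_set_iff[OF wf_select xs] Y_set_iff[OF wf xp] abs select_fields All_less_Suc all_less_add all_less_mult row3
    by (simp add: row1 row2 lhs_select(1) W_select(1) box_def int_vecs_def all_less_add select_fields)
      (auto simp: part_defs)
qed


text \<open>If policy \<open>k\<close> covers \<open>u\<close>, the answer is that policy together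
  with the \<open>k\<close>-th unit vector as indicators.\<close>

lemma two_stage_select_if_adaptability:
  assumes "1 \<le> K" "adaptability_yes K X U Yd I"
  shows "two_stage_yes X U Yd (select I K)"
proof -
  let ?N = "n_x I" and ?n = "n_y I" and ?R = "real (bound_R I)"
  obtain x ys where x: "x \<in> X_set X I"
    and "\<forall>u \<in> U_set U I x. ys ` {1..K} \<inter> Y_set Yd I x u \<noteq> {}"
    using assms(2) unfolding adaptability_yes_def by blast
  then have cover: "\<exists>k\<in>{1..K}. ys k \<in> Y_set Yd I x u" if "u \<in> U_set U I x" for u
    using that by blast
  have xc: "x \<in> carrier_vec ?N" by (rule X_set_carrier[OF x])
  \<comment> \<open>A policy that is not an integral point of the box covers no \<open>u\<close>.
    Replacing it by 0 loses nothing and satisfies the box and integrality constraints of the first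
    stage.\<close>
  define v where "v k = (if ys (Suc k) \<in> box I ?n \<inter> int_vecs ?n then ys (Suc k) else 0\<^sub>v ?n)" for k
  have v: "0 \<le> v k $ j" "v k $ j \<le> ?R" "v k $ j \<in> \<int>" if "j < ?n" for k j
    using that by (auto simp: v_def box_def int_vecs_def)
  define xv where "xv = vec (Suc (?N + K * ?n)) (\<lambda>j. if j < ?N then x $ j
    else if j < ?N + K * ?n then v ((j - ?N) div ?n) $ ((j - ?N) mod ?n) else ?R)"
  have xv_v: "xv $ (?N + (k * ?n + j)) = v k $ j" if "k < K" "j < ?n" for k j
    using mult_add_less[OF that] that by (simp add: xv_def)
  have xv_part: "x_part xv = x" using xc by (auto simp: xv_def part_defs)
  have xv: "xv \<in> carrier_vec (Suc (?N + K * ?n))" "xv $ (?N + K * ?n) = ?R" by (simp_all add: xv_def)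
  have "xv \<in> X_set X (select I K)"
    unfolding X_set_select xv_part all_less_mult using xv x v by (simp add: xv_v)
  moreover have "\<exists>y. y \<in> Y_set Yd (select I K) xv u" if u: "u \<in> U_set U (select I K) xv" for u
  proof -
    have u1: "u_part u \<in> U_set U I x" "u $ n_u I = 1" and R: "1 \<le> bound_R I"
      using u unfolding U_set_select xv_part by auto
    obtain k where k: "k < K" "ys (Suc k) \<in> Y_set Yd I x (u_part u)"
      using cover[OF u1(1)] by (metis Suc_le_D Suc_le_lessD atLeastAtMost_iff One_nat_def)
    have yk: "ys (Suc k) \<in> carrier_vec ?n" "ys (Suc k) = v k"
      using k(2) unfolding Y_set_iff[OF wf xc] by (auto simp: v_def box_def)
    define y where "y = vec (?n + K) (\<lambda>j. if j < ?n then v k $ j else if j = ?n + k then 1 else 0)"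
    have y1: "y $ j = v k $ j" if "j < ?n" for j using that by (simp add: y_def)
    have y2: "y $ (?n + l) = (if l = k then 1 else 0)" if "l < K" for l using that by (simp add: y_def)
    have "y_part y = ys (Suc k)" using yk y1 by (auto simp: part_defs)
    \<comment> \<open>For \<open>l = k\<close> the difference vanishes; for other \<open>l\<close>
      the indicator is 0, and two numbers between 0 and \<open>R\<close> differ by at most
      \<open>R\<close>.\<close>
    moreover have "\<bar>y $ j - v l $ j\<bar> + ?R * y $ (?n + l) \<le> ?R" if "l < K" "j < ?n" for l j
      using v[OF that(2), of k] v[OF that(2), of l] that by (auto simp: y1 y2)
    moreover have "(\<Sum>l < K. y $ (?n + l)) = 1" using k(1) by (simp add: y2)
    moreover have "y \<in> carrier_vec (?n + K)" by (simp add: y_def)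
    ultimately have "y \<in> Y_set Yd (select I K) xv u"
      unfolding Y_set_select[OF xv u1(2)] xv_part using k(2) R by (simp add: y2 xv_v)
    then show ?thesis by blast
  qed
  ultimately show ?thesis unfolding two_stage_yes_def by blast
qed

text \<open>For \<open>R > 0\<close>, nonnegative integral indicators with sum at least 1 include
  one that is at least 1, and its rows leave no slack: the second-stage \<open>y\<close> equals the
  stored policy and is therefore an integral one.\<close>

lemma adaptability_if_two_stage_select:
  assumes "1 \<le> K" "two_stage_yes X U Yd (select I K)"
  shows "adaptability_yes K X U Yd I"
proof -
  let ?N = "n_x I" and ?n = "n_y I" and ?R = "real (bound_R I)"
  obtain xv where xv: "xv \<in> X_set X (select I K)"
    and y: "\<And>u. u \<in> U_set U (select I K) xv \<Longrightarrow> \<exists>y. y \<in> Y_set Yd (select I K) xv u"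
    using assms(2) unfolding two_stage_yes_def by blast
  have xv1: "xv \<in> carrier_vec (Suc (?N + K * ?n))" "xv $ (?N + K * ?n) = ?R" and x: "x_part xv \<in> X_set X I"
    using xv unfolding X_set_select by auto
  note xc = X_set_carrier[OF x]
  define ys where "ys k = (if bound_R I = 0 then 0\<^sub>v ?n else vec ?n (\<lambda>j. xv $ (?N + ((k - 1) * ?n + j))))" for k
  have "\<exists>k\<in>{1..K}. ys k \<in> Y_set Yd I (x_part xv) u" if u: "u \<in> U_set U I (x_part xv)" for u
  proof (cases "bound_R I = 0")
    \<comment> \<open>Here the selection instance has no \<open>u\<close> at all and gives no
      information. But the box leaves only \<open>x = 0\<close>, so \<open>T(u) x\<close> vanishes
      and the zero policy satisfies every row.\<close>
    case True
    then have "x_part xv $ j = 0" if "j < ?N" for j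
      using x that unfolding X_set_iff[OF wf] by (force simp: box_def)
    then have "0\<^sub>v ?n \<in> Y_set Yd I (x_part xv) u"
      unfolding Y_set_iff[OF wf xc] by (auto simp: lhs_def box_def int_vecs_def)
    then show ?thesis using assms(1) True by (auto simp: ys_def simp del: Y_set.simps)
  next
    case False
    define u1 where "u1 = vec (Suc (n_u I)) (\<lambda>q. if q < n_u I then u $ q else 1)"
    have "u \<in> carrier_vec (n_u I)" using u unfolding U_set_iff[OF wf] by (simp add: box_def)
    then have u1: "u_part u1 = u" "u1 $ n_u I = 1" by (auto simp: u1_def part_defs)
    have "u1 \<in> U_set U (select I K) xv"
      unfolding U_set_select u1 using u False by (simp add: u1_def)
    then obtain yz where yz: "yz \<in> Y_set Yd (select I K) xv u1" using y by blast
    note yz = yz[unfolded Y_set_select[OF xv1 u1(2)] u1(1)]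
    obtain k where k: "k < K" "1 \<le> yz $ (?n + k)"
    proof (rule ccontr)
      assume "\<not> thesis"
      with that have small: "\<not> 1 \<le> yz $ (?n + k)" if "k < K" for k using \<open>k < K\<close> by blast
      have "yz $ (?n + k) = 0" if "k < K" for k
      proof -
        have "yz $ (?n + k) \<in> \<int>" "0 \<le> yz $ (?n + k)" "yz $ (?n + k) < 1"
          using yz small \<open>k < K\<close> by (auto simp: not_le)
        then show ?thesis by (auto elim!: Ints_cases)
      qed
      then have "(\<Sum>k < K. yz $ (?n + k)) = 0" by simp
      with yz False show False by simp
    qed
    have "yz $ j = xv $ (?N + (k * ?n + j))" if "j < ?n" for j
    proof -
      have "\<bar>yz $ j - xv $ (?N + (k * ?n + j))\<bar> + ?R * yz $ (?n + k) \<le> ?R" using yz k(1) that by blast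
      moreover have "?R * 1 \<le> ?R * yz $ (?n + k)" using k(2) by (intro mult_left_mono) auto
      ultimately show ?thesis by simp
    qed
    then have "ys (Suc k) = y_part yz" using False by (auto simp: ys_def part_defs)
    then show ?thesis using yz k(1) by (intro bexI[of _ "Suc k"]) auto
  qed
  moreover have "ys k \<in> carrier_vec ?n" for k by (simp add: ys_def)
  ultimately show ?thesis
    unfolding adaptability_yes_def using x
    by (intro bexI[of _ "x_part xv"] exI[of _ ys] conjI ballI) (auto simp del: Y_set.simps U_set.simps)
qed

end

text \<open>The dimensions of \<open>select\<close> grow linearly in \<open>K\<close> and are
  written in unary, so \<open>K\<close> has to be both polynomially bounded and computed by the
  reduction.\<close>

lemma K_adaptability_le_two_stage:
  assumes K: "polynomial_in_input U K" "polytime_computable U K"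
  shows "Bounded_K_Adaptability K X U Yd \<le>\<^sub>p Bounded_Two_Stage X U Yd"
proof -
  obtain f where f: "polytime_on (enc_inst ` instances U) f" "\<And>I. I \<in> instances U \<Longrightarrow> f (enc_inst I) = enc_nat (K I)"
    using K(2) unfolding polytime_computable_def by blast
  obtain q where q: "\<And>I. I \<in> instances U \<Longrightarrow> K I \<le> poly q (length (enc_inst I))"
    and K1: "\<And>I. I \<in> instances U \<Longrightarrow> 1 \<le> K I"
    using K(1) unfolding polynomial_in_input_def by blast
  show ?thesis
    unfolding Bounded_K_Adaptability_def Bounded_Two_Stage_def
  proof (rule reduces_to_den[where G = "\<lambda>I. select I (K I)" and S = select_prog, OF f q])
    show "swf select_prog 10"
      by (simp add: select_prog_def select_a_prog_def select_b_prog_def select_A_prog_def select_W_prog_def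
        select_B0_prog_def select_B_prog_def select_T_prog_def Put_defs pos_defs Put_dim_def size_defs
        IfEq_def IfLess_def Zero_def One_def MinusOne_def PosR_def NegR_def)
    show "inj_on enc_inst (instances U)"
      by (rule inj_on_subset[OF inj_on_enc_inst]) (auto simp: instances_def)
    show "den select_prog (tokens I) (bound_R I) 10 (regs I (K I)) = enc_inst (select I (K I))"
      if "I \<in> instances U" for I
      using that by (intro den_select_prog) (auto simp: instances_def dims_regs, simp_all add: regs_def)
    show "select I (K I) \<in> instances U" if "I \<in> instances U" for I
      using that by (auto simp: instances_def wf_select constant_B_select)
    show "adaptability_yes (K I) X U Yd I \<longleftrightarrow> two_stage_yes X U Yd (select I (K I))" if "I \<in> instances U" for I
    proof -
      have wf: "wf_inst I" using that by (simp add: instances_def)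
      show ?thesis
        using two_stage_select_if_adaptability[OF wf K1[OF that]] adaptability_if_two_stage_select[OF wf K1[OF that]]
        by blast
    qed
  qed
qed

theorem theorem18:
  fixes X :: xtype and U :: utype and Y :: ytype
  shows "(\<forall>K. polynomial_in_input U K \<longrightarrow>
            Bounded_K_Adaptability (\<lambda>_. 1) X U Y \<le>\<^sub>p Bounded_K_Adaptability K X U Y)
       \<and> (\<forall>K. polynomial_in_input U K \<and> polytime_computable U K \<and> Y = Yd \<longrightarrow>
            Bounded_K_Adaptability K X U Y \<le>\<^sub>p Bounded_Two_Stage X U Y)
       \<and> (U = Ud \<or> U = Udx \<or> Y = Yd \<longrightarrow>
            Bounded_Two_Stage X U Y \<le>\<^sub>p Bounded_Finite_Adaptability X U Y)"
proof (intro conjI allI impI)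
  show "Bounded_K_Adaptability (\<lambda>_. 1) X U Y \<le>\<^sub>p Bounded_K_Adaptability K X U Y"
    if "polynomial_in_input U K" for K
    using that by (intro one_adaptability_le_K_adaptability) (simp add: polynomial_in_input_def)
  show "Bounded_K_Adaptability K X U Y \<le>\<^sub>p Bounded_Two_Stage X U Y"
    if "polynomial_in_input U K \<and> polytime_computable U K \<and> Y = Yd" for K
    using that K_adaptability_le_two_stage by blast
  show "Bounded_Two_Stage X U Y \<le>\<^sub>p Bounded_Finite_Adaptability X U Y"
    if "U = Ud \<or> U = Udx \<or> Y = Yd"
    using that by (rule two_stage_le_finite_adaptability)
qed

end
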